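(* Let $D=(d_{ij})_{1\le i,j\le m}$ be a constant real matrix which is monotone, irreducible, and has a row all of whose entries are nonzero (i.e. there exists $i$ such that $d_{ij}\neq 0$ for all $j=1,\dots,m$). For $i=1,\dots,m$ let $u_{0i}\in C(\mathbb{T}^N)$ and $H_i(x,p)=F_i(x,p)-f_i(x)$, where $F_i\in C(\mathbb{T}^N\times\mathbb{R}^N)$, $f_i\in C(\mathbb{T}^N)$, $F_i(x,\cdot)$ is convex for each $x$, $F_i$ is coercive in $p$ uniformly in $x\in\mathbb{T}^N$, and $F_i(x,p)\ge F_i(x,0)=0$ for all $(x,p)$. Assume that $$\mathcal{S}:=\Big\{x_0\in\mathbb{T}^N:\ f_i(x_0)=\min_{x\in\mathbb{T}^N}f_i(x)\ \text{ for all } i=1,\dots,m\Big\}\ne\emptyset .$$ Let $u=(u_1,\dots,u_m)$ be the solution of $$\frac{\partial u_i}{\partial t}+H_i(x,Du_i)+\sum_{j=1}^m d_{ij}u_j=0 \ \text{ in } \mathbb{T}^N\times(0,\infty),\qquad u_i(x,0)=u_{0i}(x)\ \text{ on } \mathbb{T}^N,\qquad i=1,\dots,m.$$ Then there exist $c=(c_1,\dots,c_1)\in\mathbb{R}^m$ (all components equal) and a solution $u_\infty=(u_{\infty 1},\dots,u_{\infty m})\in W^{1,\infty}(\mathbb{T}^N)^m$ of $$H_i(x,Du_{\infty i})+\sum_{j=1}^m d_{ij}u_{\infty j}=c_1\ \text{ in }\mathbb{T}^N,\qquad i=1,\dots,m,$$ such that $u(\cdot,t)+ct\to u_\infty$ in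 $C(\mathbb{T}^N)^m$ as $t\to\infty$.
   Context: $\mathbb{T}^N$ is the $N$-dimensional flat torus. All solutions are understood in the viscosity sense; the solution $u$ of the Cauchy problem is the unique continuous one. $W^{1,\infty}(\mathbb{T}^N)^m$ denotes $m$-tuples of Lipschitz continuous functions. $D$ is monotone if $d_{ii}\ge 0$ for all $i$, $d_{ij}\le 0$ for $i\ne j$, and $\sum_{j=1}^m d_{ij}=0$ for all $i$. $D$ is irreducible if for every (nonempty) proper subset $\mathcal{I}\subsetneq\{1,\dots,m\}$ there exist $i\in\mathcal{I}$ and $j\notin\mathcal{I}$ with $d_{ij}\ne 0$. Coercive in $p$ uniformly in $x$ means $F_i(x,p)\to+\infty$ as $|p|\to\infty$ uniformly in $x\in\mathbb{T}^N$. *)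

theory Defs
  imports "HOL-Analysis.Analysis"
begin

text \<open>
  Functions on the flat torus \<open>T\<^sup>N\<close> (the quotient of \<open>\<real>\<^sup>N\<close> by \<open>\<int>\<^sup>N\<close>) are represented by
  \<open>\<int>\<^sup>N\<close>-periodic functions on \<open>\<real>\<^sup>N\<close>, with \<open>N = CARD('n)\<close>.
\<close>

definition torus_fun :: "(real ^ 'n \<Rightarrow> 'b) \<Rightarrow> bool" where
  "torus_fun g \<longleftrightarrow> (\<forall>x k. (\<forall>l. k $ l \<in> \<int>) \<longrightarrow> g (x + k) = g x)"

definition monotone_matrix :: "real ^ 'm ^ 'm \<Rightarrow> bool" where
  "monotone_matrix D \<longleftrightarrow>
     (\<forall>i. D $ i $ i \<ge> 0) \<and> (\<forall>i j. i \<noteq> j \<longrightarrow> D $ i $ j \<le> 0) \<and> (\<forall>i. (\<Sum>j\<in>UNIV. D $ i $ j) = 0)"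

definition irreducible_matrix :: "real ^ 'm ^ 'm \<Rightarrow> bool" where
  "irreducible_matrix D \<longleftrightarrow>
     (\<forall>I. I \<noteq> {} \<and> I \<noteq> UNIV \<longrightarrow> (\<exists>i\<in>I. \<exists>j. j \<notin> I \<and> D $ i $ j \<noteq> 0))"

definition uniformly_coercive :: "('a \<Rightarrow> 'b::real_normed_vector \<Rightarrow> real) \<Rightarrow> bool" where
  "uniformly_coercive G \<longleftrightarrow> (\<forall>M. \<exists>R. \<forall>x p. norm p \<ge> R \<longrightarrow> G x p \<ge> M)"

definition common_minimizers :: "('i \<Rightarrow> 'a \<Rightarrow> real) \<Rightarrow> 'a set" where
  "common_minimizers f = {x\<^sub>0. \<forall>i. \<forall>x. f i x\<^sub>0 \<le> f i x}"

definition C1_with_gradient :: "'a::real_inner set \<Rightarrow> ('a \<Rightarrow> real) \<Rightarrow> ('a \<Rightarrow> 'a) \<Rightarrow> bool" where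
  "C1_with_gradient S \<phi> G \<longleftrightarrow> (\<forall>z\<in>S. GDERIV \<phi> z :> G z) \<and> continuous_on S G"

text \<open>
  Viscosity solutions of a weakly coupled first-order system
  \<open>E\<^sub>i(z, u(z), Du\<^sub>i(z)) = 0\<close> in an open set \<open>S\<close>: each test function touches only the component
  \<open>u\<^sub>i\<close>, while the coupling uses the whole vector \<open>u(z)\<close>. For periodic \<open>u\<close> it makes no difference
  whether the test functions are required to be periodic, because the extrema are local.
\<close>

definition viscosity_subsolution ::
  "'a::real_inner set \<Rightarrow> ('m \<Rightarrow> 'a \<Rightarrow> real ^ 'm \<Rightarrow> 'a \<Rightarrow> real) \<Rightarrow> ('a \<Rightarrow> real ^ 'm) \<Rightarrow> bool" where
  "viscosity_subsolution S E u \<longleftrightarrow>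
     (\<forall>i \<phi> G z. C1_with_gradient S \<phi> G \<and> z \<in> S \<and>
        (\<forall>\<^sub>F y in nhds z. u y $ i - \<phi> y \<le> u z $ i - \<phi> z) \<longrightarrow> E i z (u z) (G z) \<le> 0)"

definition viscosity_supersolution ::
  "'a::real_inner set \<Rightarrow> ('m \<Rightarrow> 'a \<Rightarrow> real ^ 'm \<Rightarrow> 'a \<Rightarrow> real) \<Rightarrow> ('a \<Rightarrow> real ^ 'm) \<Rightarrow> bool" where
  "viscosity_supersolution S E u \<longleftrightarrow>
     (\<forall>i \<phi> G z. C1_with_gradient S \<phi> G \<and> z \<in> S \<and>
        (\<forall>\<^sub>F y in nhds z. u y $ i - \<phi> y \<ge> u z $ i - \<phi> z) \<longrightarrow> E i z (u z) (G z) \<ge> 0)"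

definition viscosity_solution ::
  "'a::real_inner set \<Rightarrow> ('m \<Rightarrow> 'a \<Rightarrow> real ^ 'm \<Rightarrow> 'a \<Rightarrow> real) \<Rightarrow> ('a \<Rightarrow> real ^ 'm) \<Rightarrow> bool" where
  "viscosity_solution S E u \<longleftrightarrow>
     continuous_on S u \<and> viscosity_subsolution S E u \<and> viscosity_supersolution S E u"

text \<open>
  In the evolution problem the gradient of a test function at \<open>z = (x, t)\<close> is the pair
  \<open>(p, a)\<close> of its spatial gradient \<open>p\<close> and its time derivative \<open>a\<close>. The values of \<open>u\<close> at
  negative times are irrelevant.
\<close>

definition cauchy_solution ::
  "('m \<Rightarrow> real ^ 'n \<Rightarrow> real ^ 'n \<Rightarrow> real) \<Rightarrow> real ^ 'm ^ 'm \<Rightarrow> ('m \<Rightarrow> real ^ 'n \<Rightarrow> real)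
    \<Rightarrow> (real ^ 'n \<Rightarrow> real \<Rightarrow> real ^ 'm) \<Rightarrow> bool" where
  "cauchy_solution H D u0 u \<longleftrightarrow>
     (\<forall>t\<ge>0. torus_fun (\<lambda>x. u x t)) \<and>
     continuous_on (UNIV \<times> {0..}) (\<lambda>(x, t). u x t) \<and>
     viscosity_solution (UNIV \<times> {0<..})
       (\<lambda>i (x, t) r (p, a). a + H i x p + (\<Sum>j\<in>UNIV. D $ i $ j * r $ j)) (\<lambda>(x, t). u x t) \<and>
     (\<forall>i x. u x 0 $ i = u0 i x)"

definition stationary_solution ::
  "('m \<Rightarrow> real ^ 'n \<Rightarrow> real ^ 'n \<Rightarrow> real) \<Rightarrow> real ^ 'm ^ 'm \<Rightarrow> real
    \<Rightarrow> (real ^ 'n \<Rightarrow> real ^ 'm) \<Rightarrow> bool" where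
  "stationary_solution H D c v \<longleftrightarrow>
     torus_fun v \<and>
     viscosity_solution UNIV (\<lambda>i x r p. H i x p + (\<Sum>j\<in>UNIV. D $ i $ j * r $ j) - c) v"

end

theory Submission
  imports Defs
begin

text \<open>
  Solve \<open>D a = (min f\<^sub>i)\<^sub>i + c (1, \<dots>, 1)\<close>. Then \<open>w = u + c t (1, \<dots>, 1) - a\<close> solves the system with
  \<open>H\<^sub>i\<close> normalised such that \<open>H\<^sub>i(x, p) \<ge> H\<^sub>i(x, 0)\<close> and \<open>H\<^sub>i(x, 0) \<le> 0\<close>, with equality for all \<open>i\<close> exactly
  on the set \<open>S\<close> of common minimizers. Cones with vertex in \<open>S\<close> and constants bound \<open>w\<close>. Time translates
  of \<open>w\<close> do not move apart, so \<open>w\<close> is equicontinuous in time, and by coercivity also in space. Hence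
  the upper and lower limits \<open>W\<close> and \<open>U\<close> of \<open>w\<close> as \<open>t \<rightarrow> \<infinity>\<close> are a continuous stationary subsolution and
  supersolution. On \<open>S\<close> the Hamiltonian can be dropped and \<open>w\<^sub>t + D w \<le> 0\<close> along the time axis, which by
  irreducibility forces all components to converge to one common limit; thus \<open>W = U\<close> on \<open>S\<close>. Off \<open>S\<close>
  convexity makes \<open>\<mu> W\<close> with \<open>\<mu> < 1\<close> strict in some component, irreducibility spreads this to
  all components, and the comparison principle gives \<open>W \<le> U\<close> everywhere.
\<close>

text \<open>\<open>D\<close> annihilates constant vectors, so by irreducibility its range has
  codimension one; \<open>c\<close> corrects the vector of minima into the range. For the same
  reason the coupling provides no discount, and strictness in a comparison has to come from
  elsewhere: an artificial slope in time for the evolution, the factor \<mu> for the stationary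
  system. The gain from \<mu> vanishes where every \<open>H i x 0\<close> is zero, so the common
  minimizers need a separate argument. The initial data are merely continuous and \<open>w\<close>
  need not be Lipschitz; its spatial modulus has the form \<open>e + K * norm (x - y)\<close> with
  \<open>K\<close> depending on \<open>e\<close>. This suffices for relaxed limits that are
  approached uniformly from one side, and the upper limit is Lipschitz afterwards because it is a
  stationary subsolution. The lower limit is obtained as the upper limit of \<open>- w\<close>,
  whose Hamiltonian \<open>- H i x (- p)\<close> is neither convex nor coercive; therefore the limit
  lemmas rest on continuity of the Hamiltonian, and the moduli that they take as input are
  established for \<open>w\<close> itself.\<close>

subsection \<open>Monotone irreducible matrices\<close>

text \<open>Because the row sums to zero, \<open>r $ i\<close> may be subtracted inside the sum, and
  at a maximal index every term \<open>D $ i $ j * (r $ j - r $ i)\<close> is nonnegative. The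
  second claim is the propagation step that, with irreducibility, spreads a maximum to all
  components.\<close>

lemma monotone_matrix_mult_ge_0:
  fixes D :: "real ^ 'm ^ 'm"
  assumes "monotone_matrix D" and "\<And>j. r $ j \<le> r $ i"
  shows "(D *v r) $ i \<ge> 0"
    and "(D *v r) $ i \<le> 0 \<Longrightarrow> D $ i $ j \<noteq> 0 \<Longrightarrow> r $ j = r $ i"
proof -
  have row: "(\<Sum>j\<in>UNIV. D $ i $ j) = 0" using assms(1) by (auto simp: monotone_matrix_def)
  have "(D *v r) $ i = (\<Sum>j\<in>UNIV. D $ i $ j * r $ j) - (\<Sum>j\<in>UNIV. D $ i $ j) * r $ i"
    using row by (simp add: matrix_vector_mult_def)
  also have "\<dots> = (\<Sum>j\<in>UNIV. D $ i $ j * (r $ j - r $ i))"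
    by (simp add: sum_distrib_right right_diff_distrib sum_subtractf)
  finally have eq: "(D *v r) $ i = (\<Sum>j\<in>UNIV. D $ i $ j * (r $ j - r $ i))" .
  have nn: "D $ i $ j * (r $ j - r $ i) \<ge> 0" for j
    using assms by (cases "j = i") (auto simp: monotone_matrix_def mult_nonpos_nonpos)
  show "(D *v r) $ i \<ge> 0" unfolding eq using nn by (intro sum_nonneg) auto
  assume "(D *v r) $ i \<le> 0" and nz: "D $ i $ j \<noteq> 0"
  then have "(\<Sum>j\<in>UNIV. D $ i $ j * (r $ j - r $ i)) = 0"
    unfolding eq using nn by (intro antisym sum_nonneg) auto
  then have "\<forall>j\<in>UNIV. D $ i $ j * (r $ j - r $ i) = 0"
    using sum_nonneg_eq_0_iff[of UNIV "\<lambda>j. D $ i $ j * (r $ j - r $ i)"] nn by simp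
  then have "D $ i $ j * (r $ j - r $ i) = 0" by blast
  then show "r $ j = r $ i" using nz by simp
qed

text \<open>Applied to the set of indices at which a maximum is attained.\<close>

lemma irreducible_matrix_closed_UNIV:
  fixes D :: "real ^ 'm ^ 'm"
  assumes "irreducible_matrix D" and "I \<noteq> {}" and "\<And>i j. i \<in> I \<Longrightarrow> D $ i $ j \<noteq> 0 \<Longrightarrow> j \<in> I"
  shows "I = UNIV"
  using assms unfolding irreducible_matrix_def by metis

text \<open>By the maximum principle \<open>a \<mapsto> D a - a\<^sub>k (1, \<dots>, 1)\<close> is injective for every \<open>k\<close>, hence surjective.\<close>

lemma monotone_irreducible_solvable:
  fixes D :: "real ^ 'm ^ 'm"
  assumes mono: "monotone_matrix D" and irr: "irreducible_matrix D"
  obtains a c where "D *v a = b + (\<chi> i. c)"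
proof -
  have extreme: "\<exists>i. \<forall>j. r $ j \<le> r $ i" for r :: "real ^ 'm"
  proof -
    have "Max (range (\<lambda>j. r $ j)) \<in> range (\<lambda>j. r $ j)" by (intro Max_in) auto
    then obtain i where i: "Max (range (\<lambda>j. r $ j)) = r $ i" by (rule rangeE)
    have "r $ j \<le> r $ i" for j unfolding i[symmetric] by (intro Max_ge) auto
    then show ?thesis by blast
  qed
  define i\<^sub>0 :: 'm where "i\<^sub>0 = undefined"
  define f where "f a = D *v a - (\<chi> i. a $ i\<^sub>0)" for a
  have lin: "linear f"
    by (rule linearI) (auto simp: f_def matrix_vector_right_distrib matrix_vector_mult_scaleR vec_eq_iff algebra_simps)
  have "a = 0" if "f a = 0" for a
  proof -
    have D: "(D *v a) $ i = a $ i\<^sub>0" for i using that by (simp add: f_def vec_eq_iff)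
    obtain i where i: "\<And>j. a $ j \<le> a $ i" using extreme[of a] by blast
    obtain k where k: "\<And>j. (- a) $ j \<le> (- a) $ k" using extreme[of "- a"] by blast
    have "(D *v a) $ i \<ge> 0" using monotone_matrix_mult_ge_0(1)[OF mono i] .
    moreover have "(D *v (- a)) $ k \<ge> 0" using monotone_matrix_mult_ge_0(1)[OF mono k] .
    then have "(D *v a) $ k \<le> 0" by (simp add: matrix_vector_mult_def sum_negf)
    \<comment> \<open>All entries of \<open>D *v a\<close> coincide; a maximal index makes their
      common value nonnegative, a minimal one nonpositive.\<close>
    ultimately have a0: "a $ i\<^sub>0 = 0" using D[of i] D[of k] by simp
    have "{j. a $ j = a $ i} = UNIV"
    proof (rule irreducible_matrix_closed_UNIV[OF irr])
      fix j l assume j: "j \<in> {j. a $ j = a $ i}" and "D $ j $ l \<noteq> 0"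
      then have "a $ l \<le> a $ j" for l using i by simp
      from monotone_matrix_mult_ge_0(2)[OF mono this _ \<open>D $ j $ l \<noteq> 0\<close>]
      show "l \<in> {j. a $ j = a $ i}" using D[of j] a0 j by simp
    qed auto
    then have "a $ j = a $ i" for j by auto
    then show "a = 0" using a0 by (metis vec_eq_iff zero_index)
  qed
  then have "inj f" using linear_injective_0[OF lin] by blast
  then have "surj f" using linear_injective_imp_surjective[OF lin] by blast
  then obtain a where "f a = b" by (metis surjD)
  then have "D *v a = b + (\<chi> i. a $ i\<^sub>0)" by (simp add: f_def algebra_simps)
  then show thesis by (rule that)
qed

subsection \<open>Periodic functions and maxima\<close>

lemma torus_representative:
  fixes x :: "real ^ 'n"
  shows "\<exists>k. (\<forall>l. k $ l \<in> \<int>) \<and> x + k \<in> cbox 0 1"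
proof (intro exI conjI allI)
  define k :: "real ^ 'n" where "k = (\<chi> l. - of_int \<lfloor>x $ l\<rfloor>)"
  show "k $ l \<in> \<int>" for l by (simp add: k_def)
  show "x + k \<in> cbox 0 1"
    by (auto simp: mem_box_cart k_def) (smt (verit) of_int_floor_le real_of_int_floor_add_one_ge)
qed

lemma torus_fun_ex_box:
  assumes "torus_fun g"
  shows "\<exists>y\<in>cbox 0 1. g y = g x"
  using torus_representative[of x] assms by (metis torus_fun_def)

lemma torus_compact_bounded:
  fixes G :: "real ^ 'n \<Rightarrow> 'p::metric_space \<Rightarrow> 'b::real_normed_vector"
  assumes "continuous_on (UNIV \<times> C) (\<lambda>(x, p). G x p)" and "compact C"
    and per: "\<And>p. p \<in> C \<Longrightarrow> torus_fun (\<lambda>x. G x p)"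
  obtains B where "B > 0" "\<And>x p. p \<in> C \<Longrightarrow> norm (G x p) \<le> B"
proof -
  have "compact ((\<lambda>(x, p). G x p) ` (cbox 0 1 \<times> C))"
    using assms by (intro compact_continuous_image compact_Times compact_cbox)
      (auto intro: continuous_on_subset)
  then obtain B where B: "B > 0" "\<And>z. z \<in> cbox 0 1 \<times> C \<Longrightarrow> norm ((\<lambda>(x, p). G x p) z) \<le> B"
    by (metis bounded_pos compact_imp_bounded imageI)
  have "norm (G x p) \<le> B" if "p \<in> C" for x p
    using torus_fun_ex_box[OF per[OF that], of x] B(2) that by fastforce
  then show thesis using B(1) that by blast
qed

lemma torus_compact_uniformly_continuous:
  fixes G :: "real ^ 'n \<Rightarrow> 'p::metric_space \<Rightarrow> 'b::metric_space"
  assumes "continuous_on (UNIV \<times> C) (\<lambda>(x, p). G x p)" and "compact C"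
    and per: "\<And>p. p \<in> C \<Longrightarrow> torus_fun (\<lambda>x. G x p)" and "e > 0"
  obtains d where "d > 0"
    "\<And>x y p q. p \<in> C \<Longrightarrow> q \<in> C \<Longrightarrow> dist x y < d \<Longrightarrow> dist p q < d \<Longrightarrow> dist (G x p) (G y q) < e"
proof -
  \<comment> \<open>Both points are shifted by the same integer vector, which brings only the first
    into the unit cube; the larger box leaves room for a second point at distance below 1.\<close>
  let ?K = "cbox (- 1) (2 :: real ^ 'n) \<times> C"
  have "uniformly_continuous_on ?K (\<lambda>(x, p). G x p)"
    using assms by (intro compact_uniformly_continuous compact_Times compact_cbox)
      (auto intro: continuous_on_subset)
  then obtain d where d: "d > 0"
    "\<And>z z'. z \<in> ?K \<Longrightarrow> z' \<in> ?K \<Longrightarrow> dist z' z < d \<Longrightarrow>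
       dist ((\<lambda>(x, p). G x p) z') ((\<lambda>(x, p). G x p) z) < e"
    unfolding uniformly_continuous_on_def using \<open>e > 0\<close> by metis
  show thesis
  proof (rule that[of "min 1 (d / 2)"])
    show "min 1 (d / 2) > 0" using d by simp
    fix x y :: "real ^ 'n" and p q
    assume p: "p \<in> C" "q \<in> C" and *: "dist x y < min 1 (d / 2)" "dist p q < min 1 (d / 2)"
    obtain k where k: "\<forall>l. k $ l \<in> \<int>" "x + k \<in> cbox 0 1" using torus_representative by blast
    have "\<bar>(y + k) $ l - (x + k) $ l\<bar> < 1" for l
      using *(1) component_le_norm_cart[of "x - y" l] by (simp add: dist_norm abs_minus_commute)
    then have "x + k \<in> cbox (-1) 2" "y + k \<in> cbox (-1) 2"
      using k(2) by (auto simp: mem_box_cart) (smt (verit))+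
    moreover have "dist (x + k, p) (y + k, q) \<le> dist x y + dist p q"
      by (simp add: dist_prod_def) (metis sqrt_sum_squares_le_sum zero_le_dist)
    ultimately have "dist (G (x + k) p) (G (y + k) q) < e"
      using d(2)[of "(y + k, q)" "(x + k, p)"] p * by auto
    then show "dist (G x p) (G y q) < e"
      using per p k(1) by (simp add: torus_fun_def)
  qed
qed

lemma torus_continuous_bounded:
  fixes g :: "real ^ 'n \<Rightarrow> 'b::real_normed_vector"
  assumes "torus_fun g" "continuous_on UNIV g"
  obtains B where "B > 0" "\<And>x. norm (g x) \<le> B"
proof -
  have "continuous_on (UNIV \<times> {0::real}) (\<lambda>(x, t). g x)"
    using continuous_on_compose2[OF assms(2) continuous_on_fst[OF continuous_on_id], of "UNIV \<times> {0::real}"]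
    by (simp add: case_prod_unfold)
  then obtain B where "B > 0" "\<And>x t. t \<in> {0::real} \<Longrightarrow> norm (g x) \<le> B"
    using torus_compact_bounded[of "{0::real}" "\<lambda>x _. g x"] assms(1) by auto
  then show thesis using that by blast
qed

text \<open>Maximising over the index and the point together makes the maximising component dominate
  at the point found, as the maximum principle for \<open>D\<close> requires. The domain may be
  unbounded: only superlevel sets at one reference value have to be bounded.\<close>

lemma family_attains_max:
  fixes \<Phi> :: "'m::finite \<Rightarrow> 'z::heine_borel \<Rightarrow> real"
  assumes "closed X" and "\<And>i. continuous_on X (\<Phi> i)" and "z\<^sub>0 \<in> X"
    and bdd: "\<And>i. bounded {z \<in> X. \<Phi> i z \<ge> \<Phi> i\<^sub>0 z\<^sub>0}"
  obtains i z where "z \<in> X" "\<And>j y. y \<in> X \<Longrightarrow> \<Phi> j y \<le> \<Phi> i z"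
proof -
  define L where "L i = {z \<in> X. \<Phi> i z \<ge> \<Phi> i\<^sub>0 z\<^sub>0}" for i
  have "L i = X \<inter> \<Phi> i -` {\<Phi> i\<^sub>0 z\<^sub>0..}" for i by (auto simp: L_def)
  then have "closed (L i)" for i
    using continuous_closed_preimage[OF assms(2,1)] by (metis closed_atLeast)
  then have comp: "compact (L i)" for i
    using bdd by (simp add: compact_eq_bounded_closed L_def)
  define I where "I = {i. L i \<noteq> {}}"
  have "\<exists>z. i \<in> I \<longrightarrow> z \<in> L i \<and> (\<forall>y\<in>L i. \<Phi> i y \<le> \<Phi> i z)" for i
    using continuous_attains_sup[OF comp[of i], of "\<Phi> i"] continuous_on_subset[OF assms(2)[of i], of "L i"]
    by (auto simp: I_def L_def)
  then obtain z where z: "\<And>i. i \<in> I \<Longrightarrow> z i \<in> L i" "\<And>i y. i \<in> I \<Longrightarrow> y \<in> L i \<Longrightarrow> \<Phi> i y \<le> \<Phi> i (z i)"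
    by metis
  have "z\<^sub>0 \<in> L i\<^sub>0" using assms(3) by (simp add: L_def)
  then have "I \<noteq> {}" by (auto simp: I_def)
  then have "Max ((\<lambda>j. \<Phi> j (z j)) ` I) \<in> (\<lambda>j. \<Phi> j (z j)) ` I" by (intro Max_in) auto
  then obtain i where "i \<in> I" and Max: "Max ((\<lambda>j. \<Phi> j (z j)) ` I) = \<Phi> i (z i)" by blast
  moreover have "\<Phi> j (z j) \<le> \<Phi> i (z i)" if "j \<in> I" for j
    unfolding Max[symmetric] using that by (intro Max_ge) auto
  ultimately have i: "i \<in> I" "\<And>j. j \<in> I \<Longrightarrow> \<Phi> j (z j) \<le> \<Phi> i (z i)" by auto
  show thesis
  proof (rule that)
    show "z i \<in> X" using z(1)[OF i(1)] by (simp add: L_def)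
    fix j y assume "y \<in> X"
    show "\<Phi> j y \<le> \<Phi> i (z i)"
    proof (cases "y \<in> L j")
      case True
      then have "j \<in> I" by (auto simp: I_def)
      then show ?thesis using z(2)[OF _ True] i(2) by force
    next
      case False
      then show ?thesis using \<open>y \<in> X\<close> z(1)[OF i(1)] by (auto simp: L_def)
    qed
  qed
qed

lemma coercive_attains_max:
  fixes \<Phi> :: "'z::heine_borel \<Rightarrow> real"
  assumes "closed X" and "continuous_on X \<Phi>" and "z\<^sub>0 \<in> X" and "bounded {z \<in> X. \<Phi> z \<ge> \<Phi> z\<^sub>0}"
  obtains z where "z \<in> X" "\<And>y. y \<in> X \<Longrightarrow> \<Phi> y \<le> \<Phi> z"
  using family_attains_max[of X "\<lambda>_::unit. \<Phi>" z\<^sub>0] assms by auto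

subsection \<open>Test functions and viscosity inequalities\<close>

lemma C1_with_gradient_const: "C1_with_gradient S (\<lambda>_. c) (\<lambda>_. 0)"
  by (auto simp: C1_with_gradient_def intro: GDERIV_const)

lemma C1_with_gradient_add:
  assumes "C1_with_gradient S \<phi> G" and "C1_with_gradient S \<psi> G'"
  shows "C1_with_gradient S (\<lambda>x. \<phi> x + \<psi> x) (\<lambda>x. G x + G' x)"
  using assms by (auto simp: C1_with_gradient_def intro!: GDERIV_add continuous_intros)

lemma C1_with_gradient_cmult:
  assumes "C1_with_gradient S \<phi> G"
  shows "C1_with_gradient S (\<lambda>x. c * \<phi> x) (\<lambda>x. c *\<^sub>R G x)"
  using assms by (auto simp: C1_with_gradient_def gderiv_def intro!: derivative_eq_intros continuous_intros)

lemma C1_with_gradient_norm_sq: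
  "C1_with_gradient S (\<lambda>x. (norm (x - y))\<^sup>2) (\<lambda>x. 2 *\<^sub>R (x - y))"
  by (auto simp: C1_with_gradient_def gderiv_def power2_norm_eq_inner inner_commute
      intro!: derivative_eq_intros continuous_intros)

text \<open>All test functions used for the evolution are sums of a spatial and a temporal
  part.\<close>

lemma C1_with_gradient_Times:
  assumes "C1_with_gradient UNIV \<phi> G" and "\<And>t. t \<in> T \<Longrightarrow> (\<theta> has_real_derivative \<theta>' t) (at t)"
    and "continuous_on T \<theta>'"
  shows "C1_with_gradient (UNIV \<times> T) (\<lambda>(x, t). \<phi> x + \<theta> t) (\<lambda>(x, t). (G x, \<theta>' t))"
proof -
  have "GDERIV (\<lambda>(x, t). \<phi> x + \<theta> t) (x, t) :> (G x, \<theta>' t)" if "t \<in> T" for x t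
  proof -
    have 1: "(\<phi> has_derivative (\<lambda>h. G x \<bullet> h)) (at (fst (x, t)))"
      using assms(1) by (simp add: C1_with_gradient_def gderiv_def inner_commute)
    have 2: "(\<theta> has_derivative (\<lambda>h. \<theta>' t * h)) (at (snd (x, t)))"
      using assms(2)[OF that] by (simp add: has_field_derivative_def)
    have "((\<lambda>z. \<phi> (fst z)) has_derivative (\<lambda>h. G x \<bullet> fst h)) (at (x, t))"
      using has_derivative_compose[OF bounded_linear_imp_has_derivative[OF bounded_linear_fst] 1] .
    moreover have "((\<lambda>z. \<theta> (snd z)) has_derivative (\<lambda>h. \<theta>' t * snd h)) (at (x, t))"
      using has_derivative_compose[OF bounded_linear_imp_has_derivative[OF bounded_linear_snd] 2] .
    ultimately have "((\<lambda>z. \<phi> (fst z) + \<theta> (snd z)) has_derivative (\<lambda>h. G x \<bullet> fst h + \<theta>' t * snd h)) (at (x, t))"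
      by (rule has_derivative_add)
    moreover have "(\<lambda>h. G x \<bullet> fst h + \<theta>' t * snd h) = (\<lambda>h. h \<bullet> (G x, \<theta>' t))"
      by (rule ext) (simp only: inner_prod_def fst_conv snd_conv inner_commute[of "G x"] inner_real_def mult.commute[of "\<theta>' t"])
    ultimately show ?thesis
      unfolding gderiv_def case_prod_unfold by simp
  qed
  moreover have "continuous_on (UNIV \<times> T) (\<lambda>(x, t). (G x, \<theta>' t))"
  proof -
    have "continuous_on (UNIV \<times> T) (\<lambda>z. G (fst z))"
      using assms(1) by (intro continuous_on_compose2[of UNIV G, OF _ continuous_on_fst[OF continuous_on_id]])
        (auto simp: C1_with_gradient_def)
    moreover have "continuous_on (UNIV \<times> T) (\<lambda>z. \<theta>' (snd z))"
      by (rule continuous_on_compose2[OF assms(3) continuous_on_snd[OF continuous_on_id]]) auto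
    ultimately have "continuous_on (UNIV \<times> T) (\<lambda>z. (G (fst z), \<theta>' (snd z)))"
      by (rule continuous_on_Pair)
    then show ?thesis by (simp add: case_prod_unfold)
  qed
  ultimately show ?thesis by (auto simp: C1_with_gradient_def)
qed

section \<open>One-sided solutions, reflection and the basic test inequalities\<close>

definition evolution_subsolution ::
  "('m \<Rightarrow> real ^ 'n \<Rightarrow> real ^ 'n \<Rightarrow> real) \<Rightarrow> real ^ 'm ^ 'm \<Rightarrow> (real ^ 'n \<Rightarrow> real \<Rightarrow> real ^ 'm) \<Rightarrow> bool" where
  "evolution_subsolution H D w \<longleftrightarrow> viscosity_subsolution (UNIV \<times> {0<..})
     (\<lambda>i (x, t) r (p, a). a + H i x p + (\<Sum>j\<in>UNIV. D $ i $ j * r $ j)) (\<lambda>(x, t). w x t)"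

definition evolution_supersolution ::
  "('m \<Rightarrow> real ^ 'n \<Rightarrow> real ^ 'n \<Rightarrow> real) \<Rightarrow> real ^ 'm ^ 'm \<Rightarrow> (real ^ 'n \<Rightarrow> real \<Rightarrow> real ^ 'm) \<Rightarrow> bool" where
  "evolution_supersolution H D w \<longleftrightarrow> viscosity_supersolution (UNIV \<times> {0<..})
     (\<lambda>i (x, t) r (p, a). a + H i x p + (\<Sum>j\<in>UNIV. D $ i $ j * r $ j)) (\<lambda>(x, t). w x t)"

definition stationary_subsolution ::
  "('m \<Rightarrow> real ^ 'n \<Rightarrow> real ^ 'n \<Rightarrow> real) \<Rightarrow> real ^ 'm ^ 'm \<Rightarrow> (real ^ 'n \<Rightarrow> real ^ 'm) \<Rightarrow> bool" where
  "stationary_subsolution H D v \<longleftrightarrow> viscosity_subsolution UNIV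
     (\<lambda>i x r p. H i x p + (\<Sum>j\<in>UNIV. D $ i $ j * r $ j)) v"

definition stationary_supersolution ::
  "('m \<Rightarrow> real ^ 'n \<Rightarrow> real ^ 'n \<Rightarrow> real) \<Rightarrow> real ^ 'm ^ 'm \<Rightarrow> (real ^ 'n \<Rightarrow> real ^ 'm) \<Rightarrow> bool" where
  "stationary_supersolution H D v \<longleftrightarrow> viscosity_supersolution UNIV
     (\<lambda>i x r p. H i x p + (\<Sum>j\<in>UNIV. D $ i $ j * r $ j)) v"

text \<open>Negating solution and test function exchanges maxima and minima. The coupling is linear
  and comes back unchanged, so for the two systems below only the Hamiltonian is replaced, by
  \<open>- H i x (- p)\<close>.\<close>

lemma viscosity_supersolution_iff_neg:
  "viscosity_supersolution S E u \<longleftrightarrow> viscosity_subsolution S (\<lambda>i z r p. - E i z (- r) (- p)) (\<lambda>z. - u z)"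
proof -
  have C1: "C1_with_gradient S (\<lambda>z. - \<phi> z) (\<lambda>z. - G z)" if "C1_with_gradient S \<phi> G" for \<phi> G
    using C1_with_gradient_cmult[OF that, of "-1"] by simp
  show ?thesis
    unfolding viscosity_supersolution_def viscosity_subsolution_def
  proof (intro iffI allI impI; elim conjE)
    fix i \<phi> G z
    assume *: "\<forall>i \<phi> G z. C1_with_gradient S \<phi> G \<and> z \<in> S \<and>
        (\<forall>\<^sub>F y in nhds z. u y $ i - \<phi> y \<ge> u z $ i - \<phi> z) \<longrightarrow> E i z (u z) (G z) \<ge> 0"
      and "C1_with_gradient S \<phi> G" "z \<in> S"
      and ev: "\<forall>\<^sub>F y in nhds z. (- u y) $ i - \<phi> y \<le> (- u z) $ i - \<phi> z"
    have "\<forall>\<^sub>F y in nhds z. u y $ i - - \<phi> y \<ge> u z $ i - - \<phi> z"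
      using ev by (rule eventually_mono) simp
    then have "E i z (u z) (- G z) \<ge> 0"
      using *[rule_format, of "\<lambda>z. - \<phi> z" "\<lambda>z. - G z" z i] C1[OF \<open>C1_with_gradient S \<phi> G\<close>] \<open>z \<in> S\<close> by simp
    then show "- E i z (- (- u z)) (- G z) \<le> 0" by simp
  next
    fix i \<phi> G z
    assume *: "\<forall>i \<phi> G z. C1_with_gradient S \<phi> G \<and> z \<in> S \<and>
        (\<forall>\<^sub>F y in nhds z. (- u y) $ i - \<phi> y \<le> (- u z) $ i - \<phi> z) \<longrightarrow> - E i z (- (- u z)) (- G z) \<le> 0"
      and "C1_with_gradient S \<phi> G" "z \<in> S"
      and ev: "\<forall>\<^sub>F y in nhds z. u y $ i - \<phi> y \<ge> u z $ i - \<phi> z"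
    have "\<forall>\<^sub>F y in nhds z. (- u y) $ i - - \<phi> y \<le> (- u z) $ i - - \<phi> z"
      using ev by (rule eventually_mono) simp
    then show "E i z (u z) (G z) \<ge> 0"
      using *[rule_format, of "\<lambda>z. - \<phi> z" "\<lambda>z. - G z" z i] C1[OF \<open>C1_with_gradient S \<phi> G\<close>] \<open>z \<in> S\<close> by simp
  qed
qed

lemma evolution_supersolution_iff_neg:
  "evolution_supersolution H D w \<longleftrightarrow> evolution_subsolution (\<lambda>i x p. - H i x (- p)) D (\<lambda>x t. - w x t)"
proof -
  have E: "(\<lambda>i z r p. - (case z of (x, t) \<Rightarrow> \<lambda>r (p, a). a + H i x p + (\<Sum>j\<in>UNIV. D $ i $ j * r $ j)) (- r) (- p))
    = (\<lambda>i (x, t) r (p, a). a + - H i x (- p) + (\<Sum>j\<in>UNIV. D $ i $ j * r $ j))"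
    by (auto simp: fun_eq_iff sum_negf)
  have w: "(\<lambda>z. - (case z of (x, t) \<Rightarrow> w x t)) = (\<lambda>(x, t). - w x t)"
    by (auto simp: fun_eq_iff)
  show ?thesis
    unfolding evolution_supersolution_def evolution_subsolution_def viscosity_supersolution_iff_neg E w ..
qed

lemma stationary_supersolution_iff_neg:
  "stationary_supersolution H D v \<longleftrightarrow> stationary_subsolution (\<lambda>i x p. - H i x (- p)) D (\<lambda>x. - v x)"
  unfolding stationary_supersolution_def stationary_subsolution_def viscosity_supersolution_iff_neg
  by (simp add: sum_negf)

lemma evolution_subsolution_test:
  assumes sub: "evolution_subsolution H D w" and C1: "C1_with_gradient UNIV \<phi> G"
    and \<theta>: "\<And>t. t > 0 \<Longrightarrow> (\<theta> has_real_derivative \<theta>' t) (at t)" "continuous_on {0<..} \<theta>'"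
    and "t\<^sub>0 > 0" and "\<delta> > 0"
    and max: "\<And>y s. norm (y - x\<^sub>0) < \<delta> \<Longrightarrow> \<bar>s - t\<^sub>0\<bar> < \<delta> \<Longrightarrow> s > 0 \<Longrightarrow>
      w y s $ i - \<phi> y - \<theta> s \<le> w x\<^sub>0 t\<^sub>0 $ i - \<phi> x\<^sub>0 - \<theta> t\<^sub>0"
  shows "\<theta>' t\<^sub>0 + H i x\<^sub>0 (G x\<^sub>0) + (D *v w x\<^sub>0 t\<^sub>0) $ i \<le> 0"
proof -
  have C1': "C1_with_gradient (UNIV \<times> {0<..}) (\<lambda>(x, t). \<phi> x + \<theta> t) (\<lambda>(x, t). (G x, \<theta>' t))"
    using C1 \<theta> by (intro C1_with_gradient_Times) auto
  have "\<forall>\<^sub>F y in nhds (x\<^sub>0, t\<^sub>0). (\<lambda>(x, t). w x t) y $ i - (\<lambda>(x, t). \<phi> x + \<theta> t) y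
      \<le> (\<lambda>(x, t). w x t) (x\<^sub>0, t\<^sub>0) $ i - (\<lambda>(x, t). \<phi> x + \<theta> t) (x\<^sub>0, t\<^sub>0)"
    unfolding eventually_nhds_metric
  proof (intro exI[of _ "min \<delta> t\<^sub>0"] conjI allI impI)
    show "0 < min \<delta> t\<^sub>0" using \<open>\<delta> > 0\<close> \<open>t\<^sub>0 > 0\<close> by simp
    fix z assume z: "dist z (x\<^sub>0, t\<^sub>0) < min \<delta> t\<^sub>0"
    obtain y s where ys: "z = (y, s)" by force
    have "dist y x\<^sub>0 \<le> dist z (x\<^sub>0, t\<^sub>0)" "dist s t\<^sub>0 \<le> dist z (x\<^sub>0, t\<^sub>0)"
      using dist_fst_le[of z "(x\<^sub>0, t\<^sub>0)"] dist_snd_le[of z "(x\<^sub>0, t\<^sub>0)"] by (auto simp: ys)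
    then have "norm (y - x\<^sub>0) < \<delta>" "\<bar>s - t\<^sub>0\<bar> < \<delta>" "s > 0"
      using z by (auto simp: dist_norm)
    from max[OF this] show "(\<lambda>(x, t). w x t) z $ i - (\<lambda>(x, t). \<phi> x + \<theta> t) z
      \<le> (\<lambda>(x, t). w x t) (x\<^sub>0, t\<^sub>0) $ i - (\<lambda>(x, t). \<phi> x + \<theta> t) (x\<^sub>0, t\<^sub>0)" by (simp add: ys)
  qed
  with sub C1' \<open>t\<^sub>0 > 0\<close> show ?thesis
    unfolding evolution_subsolution_def viscosity_subsolution_def
    by (fastforce simp: matrix_vector_mult_def)
qed

text \<open>The function touching from below is minus \<phi> minus \<theta>, hence the minus signs
  on the slopes: this is the subsolution test for the reflected problem.\<close>

lemma evolution_supersolution_test: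
  assumes super: "evolution_supersolution H D w" and C1: "C1_with_gradient UNIV \<phi> G"
    and \<theta>: "\<And>t. t > 0 \<Longrightarrow> (\<theta> has_real_derivative \<theta>' t) (at t)" "continuous_on {0<..} \<theta>'"
    and "t\<^sub>0 > 0" and "\<delta> > 0"
    and min: "\<And>y s. norm (y - x\<^sub>0) < \<delta> \<Longrightarrow> \<bar>s - t\<^sub>0\<bar> < \<delta> \<Longrightarrow> s > 0 \<Longrightarrow>
      w x\<^sub>0 t\<^sub>0 $ i + \<phi> x\<^sub>0 + \<theta> t\<^sub>0 \<le> w y s $ i + \<phi> y + \<theta> s"
  shows "- \<theta>' t\<^sub>0 + H i x\<^sub>0 (- G x\<^sub>0) + (D *v w x\<^sub>0 t\<^sub>0) $ i \<ge> 0"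
proof -
  have "\<theta>' t\<^sub>0 + - H i x\<^sub>0 (- G x\<^sub>0) + (D *v - w x\<^sub>0 t\<^sub>0) $ i \<le> 0"
    using super[unfolded evolution_supersolution_iff_neg] C1 \<theta> \<open>t\<^sub>0 > 0\<close> \<open>\<delta> > 0\<close>
    by (rule evolution_subsolution_test) (use min in \<open>auto simp: algebra_simps\<close>)
  moreover have "D *v - w x\<^sub>0 t\<^sub>0 = - (D *v w x\<^sub>0 t\<^sub>0)"
    by (simp add: matrix_vector_mult_def vec_eq_iff sum_negf)
  ultimately show ?thesis by simp
qed

lemma stationary_subsolution_test:
  assumes "stationary_subsolution H D v" and "C1_with_gradient UNIV \<phi> G"
    and "\<And>y. v y $ i - \<phi> y \<le> v x\<^sub>0 $ i - \<phi> x\<^sub>0"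
  shows "H i x\<^sub>0 (G x\<^sub>0) + (D *v v x\<^sub>0) $ i \<le> 0"
  using assms(1,2) always_eventually[OF allI[OF assms(3)], where F = "nhds x\<^sub>0"]
  unfolding stationary_subsolution_def viscosity_subsolution_def matrix_vector_mult_def
  by fastforce

lemma stationary_supersolution_test:
  assumes "stationary_supersolution H D v" and "C1_with_gradient UNIV \<phi> G"
    and "\<And>y. v x\<^sub>0 $ i - \<phi> x\<^sub>0 \<le> v y $ i - \<phi> y"
  shows "H i x\<^sub>0 (G x\<^sub>0) + (D *v v x\<^sub>0) $ i \<ge> 0"
  using assms(1,2) always_eventually[OF allI[OF assms(3)], where F = "nhds x\<^sub>0"]
  unfolding stationary_supersolution_def viscosity_supersolution_def matrix_vector_mult_def
  by fastforce

text \<open>A smooth \<psi> that is the same in every component can be moved into the test function,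
  and a constant vector does not affect where extrema lie. Used with \<psi> equal to
  \<open>c * t\<close> to normalise the evolution and with \<psi> zero to undo the shift in the
  limit.\<close>

lemma viscosity_subsolution_shift:
  assumes "viscosity_subsolution S E u" and C1: "C1_with_gradient S \<psi> P"
    and \<psi>: "\<And>z i. z \<in> S \<Longrightarrow> v z $ i = u z $ i + \<psi> z + a $ i"
    and E: "\<And>i z p. z \<in> S \<Longrightarrow> E' i z (v z) p = E i z (u z) (p - P z)"
    and "open S"
  shows "viscosity_subsolution S E' v"
  unfolding viscosity_subsolution_def
proof (intro allI impI, elim conjE)
  fix i \<phi> G z assume \<phi>: "C1_with_gradient S \<phi> G" and "z \<in> S"
    and ev: "\<forall>\<^sub>F y in nhds z. v y $ i - \<phi> y \<le> v z $ i - \<phi> z"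
  have "C1_with_gradient S (\<lambda>z. \<phi> z + -1 * \<psi> z) (\<lambda>z. G z + -1 *\<^sub>R P z)"
    by (intro C1_with_gradient_add C1_with_gradient_cmult \<phi> C1)
  moreover have "\<forall>\<^sub>F y in nhds z. u y $ i - (\<phi> y + -1 * \<psi> y) \<le> u z $ i - (\<phi> z + -1 * \<psi> z)"
    using ev eventually_nhds_in_open[OF \<open>open S\<close> \<open>z \<in> S\<close>]
    by eventually_elim (use \<psi> \<open>z \<in> S\<close> in simp)
  ultimately have "E i z (u z) (G z + -1 *\<^sub>R P z) \<le> 0"
    using assms(1) \<open>z \<in> S\<close> unfolding viscosity_subsolution_def by blast
  then show "E' i z (v z) (G z) \<le> 0" using E[OF \<open>z \<in> S\<close>] by simp
qed

lemma viscosity_supersolution_shift: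
  assumes "viscosity_supersolution S E u" and C1: "C1_with_gradient S \<psi> P"
    and \<psi>: "\<And>z i. z \<in> S \<Longrightarrow> v z $ i = u z $ i + \<psi> z + a $ i"
    and E: "\<And>i z p. z \<in> S \<Longrightarrow> E' i z (v z) p = E i z (u z) (p - P z)"
    and "open S"
  shows "viscosity_supersolution S E' v"
  unfolding viscosity_supersolution_def
proof (intro allI impI, elim conjE)
  fix i \<phi> G z assume \<phi>: "C1_with_gradient S \<phi> G" and "z \<in> S"
    and ev: "\<forall>\<^sub>F y in nhds z. v y $ i - \<phi> y \<ge> v z $ i - \<phi> z"
  have "C1_with_gradient S (\<lambda>z. \<phi> z + -1 * \<psi> z) (\<lambda>z. G z + -1 *\<^sub>R P z)"
    by (intro C1_with_gradient_add C1_with_gradient_cmult \<phi> C1)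
  moreover have "\<forall>\<^sub>F y in nhds z. u y $ i - (\<phi> y + -1 * \<psi> y) \<ge> u z $ i - (\<phi> z + -1 * \<psi> z)"
    using ev eventually_nhds_in_open[OF \<open>open S\<close> \<open>z \<in> S\<close>]
    by eventually_elim (use \<psi> \<open>z \<in> S\<close> in simp)
  ultimately have "E i z (u z) (G z + -1 *\<^sub>R P z) \<ge> 0"
    using assms(1) \<open>z \<in> S\<close> unfolding viscosity_supersolution_def by blast
  then show "E' i z (v z) (G z) \<ge> 0" using E[OF \<open>z \<in> S\<close>] by simp
qed

lemma continuous_on_UNIV_Times_component:
  assumes "continuous_on (UNIV \<times> T) (\<lambda>(x, t). w x t)" and "A \<subseteq> UNIV \<times> T"
  shows "continuous_on A (\<lambda>(x, t). w x t $ i)"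
proof -
  have "continuous_on A (\<lambda>z. (case z of (x, t) \<Rightarrow> w x t) $ i)"
    using continuous_on_subset[OF assms] by (intro continuous_intros)
  then show ?thesis by (simp add: case_prod_unfold)
qed

text \<open>Penalise by \<open>K |x - x\<^sub>0|\<^sup>2\<close> with large \<open>K\<close>; the Hamiltonian can be dropped because it is at least
  its value at \<open>p = 0\<close>.\<close>

lemma evolution_subsolution_restrict:
  fixes w :: "real ^ 'n \<Rightarrow> real \<Rightarrow> real ^ 'm"
  assumes sub: "evolution_subsolution H D w"
    and cont: "continuous_on (UNIV \<times> {0..}) (\<lambda>(x, t). w x t)"
    and H: "\<And>x p. H i x p \<ge> H i x 0" "continuous_on UNIV (\<lambda>x. H i x 0)" "H i x\<^sub>0 0 = 0"
    and \<theta>: "\<And>t. t > 0 \<Longrightarrow> (\<theta> has_real_derivative \<theta>' t) (at t)" "continuous_on {0<..} \<theta>'"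
    and "t\<^sub>0 > 0" and "\<delta> > 0"
    and max: "\<And>s. \<bar>s - t\<^sub>0\<bar> < \<delta> \<Longrightarrow> s > 0 \<Longrightarrow> w x\<^sub>0 s $ i - \<theta> s \<le> w x\<^sub>0 t\<^sub>0 $ i - \<theta> t\<^sub>0"
  shows "\<theta>' t\<^sub>0 + (D *v w x\<^sub>0 t\<^sub>0) $ i \<le> 0"
proof (rule ccontr)
  assume neg: "\<not> ?thesis"
  define S where "S = (UNIV :: (real ^ 'n) set) \<times> {0::real<..}"
  \<comment> \<open>At any point where a test function with this time slope touches,
    \<open>q\<close> is at most zero, however steep the test function is in space. As
    \<open>q\<close> is positive near the point \<open>(x\<^sub>0, t\<^sub>0)\<close>, a contact
    point close to it gives the contradiction.\<close>
  define q where "q = (\<lambda>(x, t). \<theta>' t + 2 * (t - t\<^sub>0) + H i x 0 + (D *v w x t) $ i)"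
  have "continuous_on S (\<lambda>z. (\<Sum>j\<in>UNIV. D $ i $ j * (case z of (x, t) \<Rightarrow> w x t $ j)))"
    by (intro continuous_intros continuous_on_UNIV_Times_component[OF cont]) (auto simp: S_def)
  moreover have "continuous_on S (\<lambda>z. \<theta>' (snd z))"
    by (rule continuous_on_compose2[OF \<theta>(2)]) (auto simp: S_def intro!: continuous_intros)
  moreover have "continuous_on S (\<lambda>z. H i (fst z) 0)"
    by (rule continuous_on_compose2[OF H(2)]) (auto intro!: continuous_intros)
  ultimately have "continuous_on S (\<lambda>z. \<theta>' (snd z) + 2 * (snd z - t\<^sub>0) + H i (fst z) 0
      + (\<Sum>j\<in>UNIV. D $ i $ j * (case z of (x, t) \<Rightarrow> w x t $ j)))"
    by (intro continuous_on_add continuous_on_mult continuous_on_diff continuous_on_const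
        continuous_on_snd continuous_on_id)
  then have "continuous_on S q"
    by (simp add: q_def case_prod_unfold matrix_vector_mult_def)
  moreover have "(x\<^sub>0, t\<^sub>0) \<in> S" "open S" using \<open>t\<^sub>0 > 0\<close> by (auto simp: S_def intro!: open_Times)
  ultimately have "\<forall>\<^sub>F z in nhds (x\<^sub>0, t\<^sub>0). q z > 0"
    using neg H(3) by (intro order_tendstoD(1)[of q "q (x\<^sub>0, t\<^sub>0)"])
      (auto simp: continuous_on_eq_continuous_at isCont_def tendsto_at_iff_tendsto_nhds q_def not_le)
  then obtain r where r: "r > 0" "\<And>z. dist z (x\<^sub>0, t\<^sub>0) < r \<Longrightarrow> q z > 0"
    unfolding eventually_nhds_metric by blast
  define \<rho> where "\<rho> = Min {r / 2, \<delta> / 2, t\<^sub>0 / 2} / 2"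
  have \<rho>: "\<rho> > 0" "2 * \<rho> < r" "\<rho> < \<delta>" "\<rho> < t\<^sub>0"
    using r(1) \<open>\<delta> > 0\<close> \<open>t\<^sub>0 > 0\<close> by (auto simp: \<rho>_def)
  define I where "I = {t\<^sub>0 - \<rho>..t\<^sub>0 + \<rho>}"
  have "uniformly_continuous_on (cball x\<^sub>0 1 \<times> I) (\<lambda>(x, t). w x t)"
    using \<rho> by (intro compact_uniformly_continuous continuous_on_subset[OF cont])
      (auto simp: I_def compact_Times)
  then obtain d where d: "d > 0" "\<And>z z'. z \<in> cball x\<^sub>0 1 \<times> I \<Longrightarrow> z' \<in> cball x\<^sub>0 1 \<times> I \<Longrightarrow>
      dist z' z < d \<Longrightarrow> dist ((\<lambda>(x, t). w x t) z') ((\<lambda>(x, t). w x t) z) < \<rho>\<^sup>2"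
    unfolding uniformly_continuous_on_def using \<rho>(1) by (metis zero_less_power)
  define \<eta> where "\<eta> = Min {d / 2, \<rho>, 1}"
  have \<eta>: "\<eta> > 0" "\<eta> < d" "\<eta> \<le> \<rho>" "\<eta> \<le> 1" using d(1) \<rho>(1) by (auto simp: \<eta>_def)
  have near: "\<bar>w x t $ i - w x\<^sub>0 t $ i\<bar> < \<rho>\<^sup>2" if "norm (x - x\<^sub>0) \<le> \<eta>" "t \<in> I" for x t
  proof -
    have "dist (w x t) (w x\<^sub>0 t) < \<rho>\<^sup>2"
      using d(2)[of "(x\<^sub>0, t)" "(x, t)"] that \<eta>
      by (auto simp: dist_prod_def dist_norm norm_minus_commute)
    then show ?thesis
      using component_le_norm_cart[of "w x t - w x\<^sub>0 t" i] by (simp add: dist_norm)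
  qed
  \<comment> \<open>On the sphere of radius \<eta> the penalty is twice the bound
    \<open>\<rho>\<^sup>2\<close> for the oscillation of \<open>w\<close> in space, so the maximum
    is interior in \<open>x\<close>.\<close>
  define K where "K = 2 * \<rho>\<^sup>2 / \<eta>\<^sup>2"
  \<comment> \<open>The added square in time makes the maximum along the axis strict and so keeps
    the maximum off the ends of \<open>I\<close>.\<close>
  define \<Phi> where "\<Phi> = (\<lambda>(x, t). w x t $ i - K * (norm (x - x\<^sub>0))\<^sup>2 - (\<theta> t + (t - t\<^sub>0)\<^sup>2))"
  have "continuous_on (cball x\<^sub>0 \<eta> \<times> I) \<Phi>"
  proof -
    have "continuous_on I \<theta>"
      using \<rho> by (intro continuous_at_imp_continuous_on ballI DERIV_isCont[OF \<theta>(1)]) (auto simp: I_def)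
    then have "continuous_on (cball x\<^sub>0 \<eta> \<times> I) (\<lambda>z. \<theta> (snd z))"
      by (rule continuous_on_compose2) (auto intro!: continuous_intros)
    moreover have "continuous_on (cball x\<^sub>0 \<eta> \<times> I) (\<lambda>(x, t). w x t $ i)"
      using \<rho> by (intro continuous_on_UNIV_Times_component[OF cont]) (auto simp: I_def)
    ultimately have "continuous_on (cball x\<^sub>0 \<eta> \<times> I) (\<lambda>z. (case z of (x, t) \<Rightarrow> w x t $ i)
        - K * (norm (fst z - x\<^sub>0))\<^sup>2 - (\<theta> (snd z) + (snd z - t\<^sub>0)\<^sup>2))"
      by (intro continuous_intros)
    then show ?thesis by (simp add: \<Phi>_def case_prod_unfold)
  qed
  moreover have "compact (cball x\<^sub>0 \<eta> \<times> I)" "(x\<^sub>0, t\<^sub>0) \<in> cball x\<^sub>0 \<eta> \<times> I"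
    using \<eta>(1) \<rho>(1) by (auto simp: I_def compact_Times)
  ultimately obtain x t where xt: "x \<in> cball x\<^sub>0 \<eta>" "t \<in> I"
    and xt_max: "\<And>y s. y \<in> cball x\<^sub>0 \<eta> \<Longrightarrow> s \<in> I \<Longrightarrow> \<Phi> (y, s) \<le> \<Phi> (x, t)"
    using continuous_attains_sup[of "cball x\<^sub>0 \<eta> \<times> I" \<Phi>] by fastforce
  have ge: "w x\<^sub>0 t\<^sub>0 $ i - \<theta> t\<^sub>0 \<le> \<Phi> (x, t)"
    using xt_max[of x\<^sub>0 t\<^sub>0] \<eta>(1) \<rho>(1) by (simp add: \<Phi>_def I_def)
  have nx: "norm (x - x\<^sub>0) \<le> \<eta>" using xt(1) by (simp add: dist_norm norm_minus_commute)
  have tI: "\<bar>t - t\<^sub>0\<bar> \<le> \<rho>" using xt(2) by (auto simp: I_def)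
  have "w x\<^sub>0 t $ i - \<theta> t \<le> w x\<^sub>0 t\<^sub>0 $ i - \<theta> t\<^sub>0" using max[of t] tI \<rho> by auto
  then have "\<Phi> (x, t) < w x\<^sub>0 t\<^sub>0 $ i - \<theta> t\<^sub>0 + \<rho>\<^sup>2 - K * (norm (x - x\<^sub>0))\<^sup>2 - (t - t\<^sub>0)\<^sup>2"
    using near[OF nx xt(2)] by (simp add: \<Phi>_def)
  then have lt: "K * (norm (x - x\<^sub>0))\<^sup>2 + (t - t\<^sub>0)\<^sup>2 < \<rho>\<^sup>2" using ge by linarith
  have "K > 0" using \<rho>(1) \<eta>(1) by (simp add: K_def)
  have "(t - t\<^sub>0)\<^sup>2 < \<rho>\<^sup>2" using lt \<open>K > 0\<close> by (smt (verit) mult_nonneg_nonneg zero_le_power2)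
  then have "\<bar>t - t\<^sub>0\<bar> < \<bar>\<rho>\<bar>" by (metis abs_le_square_iff not_le)
  then have t_in: "\<bar>t - t\<^sub>0\<bar> < \<rho>" using \<rho>(1) by simp
  have x_in: "norm (x - x\<^sub>0) < \<eta>"
  proof (rule ccontr)
    assume "\<not> ?thesis"
    then have "norm (x - x\<^sub>0) = \<eta>" using nx by simp
    then have "K * (norm (x - x\<^sub>0))\<^sup>2 = 2 * \<rho>\<^sup>2" using \<eta>(1) by (simp add: K_def)
    then show False using lt zero_le_power2[of "t - t\<^sub>0"] zero_le_power2[of \<rho>] by linarith
  qed
  have "t > 0" using t_in \<rho> by auto
  have "(\<theta>' t + 2 * (t - t\<^sub>0)) + H i x (K *\<^sub>R (2 *\<^sub>R (x - x\<^sub>0))) + (D *v w x t) $ i \<le> 0"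
  proof (rule evolution_subsolution_test[OF sub C1_with_gradient_cmult[OF C1_with_gradient_norm_sq]
        _ _ \<open>t > 0\<close>, where \<theta> = "\<lambda>t. \<theta> t + (t - t\<^sub>0)\<^sup>2" and \<theta>' = "\<lambda>t. \<theta>' t + 2 * (t - t\<^sub>0)"
        and \<delta> = "min (\<eta> - norm (x - x\<^sub>0)) (\<rho> - \<bar>t - t\<^sub>0\<bar>)"])
    show "((\<lambda>t. \<theta> t + (t - t\<^sub>0)\<^sup>2) has_real_derivative \<theta>' t + 2 * (t - t\<^sub>0)) (at t)" if "t > 0" for t
      using \<theta>(1)[OF that] by (auto intro!: derivative_eq_intros)
    show "continuous_on {0<..} (\<lambda>t. \<theta>' t + 2 * (t - t\<^sub>0))"
      using \<theta>(2) by (intro continuous_intros)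
    show "min (\<eta> - norm (x - x\<^sub>0)) (\<rho> - \<bar>t - t\<^sub>0\<bar>) > 0" using x_in t_in by simp
    fix y s assume y: "norm (y - x) < min (\<eta> - norm (x - x\<^sub>0)) (\<rho> - \<bar>t - t\<^sub>0\<bar>)"
      and s: "\<bar>s - t\<bar> < min (\<eta> - norm (x - x\<^sub>0)) (\<rho> - \<bar>t - t\<^sub>0\<bar>)"
    have "norm (y - x\<^sub>0) \<le> norm (y - x) + norm (x - x\<^sub>0)"
      using norm_triangle_ineq[of "y - x" "x - x\<^sub>0"] by simp
    then have "y \<in> cball x\<^sub>0 \<eta>" using y by (simp add: dist_norm norm_minus_commute)
    moreover have "s \<in> I" using s by (auto simp: I_def)
    ultimately have "\<Phi> (y, s) \<le> \<Phi> (x, t)" by (rule xt_max)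
    then show "w y s $ i - K * (norm (y - x\<^sub>0))\<^sup>2 - (\<theta> s + (s - t\<^sub>0)\<^sup>2)
      \<le> w x t $ i - K * (norm (x - x\<^sub>0))\<^sup>2 - (\<theta> t + (t - t\<^sub>0)\<^sup>2)" by (simp add: \<Phi>_def)
  qed
  then have "q (x, t) \<le> 0" using H(1)[of x "K *\<^sub>R (2 *\<^sub>R (x - x\<^sub>0))"] by (simp add: q_def)
  moreover have "dist (x, t) (x\<^sub>0, t\<^sub>0) \<le> norm (x - x\<^sub>0) + \<bar>t - t\<^sub>0\<bar>"
    by (simp add: dist_prod_def dist_norm) (metis abs_ge_zero norm_ge_zero power2_abs sqrt_sum_squares_le_sum)
  ultimately show False using r(2)[of "(x, t)"] x_in t_in \<eta>(3) \<rho>(2) by simp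
qed

text \<open>A cone lies below the paraboloid with the same value and slope at the contact point, so that
  quadratic test functions suffice.\<close>

lemma cone_le_paraboloid:
  fixes x y z :: "'a::real_inner"
  assumes "K \<ge> 0" and "x \<noteq> z"
  shows "K * norm (y - z) - K / (2 * norm (x - z)) * (norm (y - z))\<^sup>2
    \<le> K * norm (x - z) - K / (2 * norm (x - z)) * (norm (x - z))\<^sup>2"
proof -
  define a where "a = norm (x - z)"
  have "a > 0" using assms by (simp add: a_def)
  \<comment> \<open>Divided by \<open>2 * a\<close>, this square is exactly the difference of the
    two sides.\<close>
  have "0 \<le> K * (norm (y - z) - a)\<^sup>2" using assms by simp
  then show ?thesis
    unfolding a_def[symmetric] using \<open>a > 0\<close>
    by (simp add: field_simps power2_eq_square)
qed

text \<open>Off its vertex a cone has slope exactly \<open>K\<close>, and for large \<open>K\<close>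
  coercivity excludes such a slope. The upper bound and the spatial modulus of \<open>w\<close> rest
  on this; its stationary counterpart gives Lipschitz continuity.\<close>

lemma evolution_subsolution_cone:
  fixes w :: "real ^ 'n \<Rightarrow> real \<Rightarrow> real ^ 'm"
  assumes sub: "evolution_subsolution H D w" and "K \<ge> 0" and "x \<noteq> z"
    and \<theta>: "\<And>t. t > 0 \<Longrightarrow> (\<theta> has_real_derivative \<theta>' t) (at t)" "continuous_on {0<..} \<theta>'"
    and "t > 0" and "\<delta> > 0"
    and max: "\<And>y s. \<bar>s - t\<bar> < \<delta> \<Longrightarrow> s > 0 \<Longrightarrow>
      w y s $ i - K * norm (y - z) - \<theta> s \<le> w x t $ i - K * norm (x - z) - \<theta> t"
  obtains p where "norm p = K" "\<theta>' t + H i x p + (D *v w x t) $ i \<le> 0"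
proof
  \<comment> \<open>The coefficient for which the paraboloid has slope \<open>K\<close> at
    \<open>x\<close>.\<close>
  define a where "a = K / (2 * norm (x - z))"
  show "norm (a *\<^sub>R (2 *\<^sub>R (x - z))) = K" using assms by (simp add: a_def)
  show "\<theta>' t + H i x (a *\<^sub>R (2 *\<^sub>R (x - z))) + (D *v w x t) $ i \<le> 0"
  proof (rule evolution_subsolution_test[OF sub C1_with_gradient_cmult[OF C1_with_gradient_norm_sq]
        \<theta> \<open>t > 0\<close> \<open>\<delta> > 0\<close>])
    fix y s assume s: "\<bar>s - t\<bar> < \<delta>" "s > 0"
    show "w y s $ i - a * (norm (y - z))\<^sup>2 - \<theta> s \<le> w x t $ i - a * (norm (x - z))\<^sup>2 - \<theta> t"
      using max[OF s, of y] cone_le_paraboloid[OF \<open>K \<ge> 0\<close> \<open>x \<noteq> z\<close>, of y]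
      unfolding a_def by linarith
  qed
qed

lemma stationary_subsolution_cone:
  fixes v :: "real ^ 'n \<Rightarrow> real ^ 'm"
  assumes sub: "stationary_subsolution H D v" and "K \<ge> 0" and "x \<noteq> z"
    and max: "\<And>y. v y $ i - K * norm (y - z) \<le> v x $ i - K * norm (x - z)"
  obtains p where "norm p = K" "H i x p + (D *v v x) $ i \<le> 0"
proof
  define a where "a = K / (2 * norm (x - z))"
  show "norm (a *\<^sub>R (2 *\<^sub>R (x - z))) = K" using assms by (simp add: a_def)
  show "H i x (a *\<^sub>R (2 *\<^sub>R (x - z))) + (D *v v x) $ i \<le> 0"
  proof (rule stationary_subsolution_test[OF sub C1_with_gradient_cmult[OF C1_with_gradient_norm_sq]])
    show "v y $ i - a * (norm (y - z))\<^sup>2 \<le> v x $ i - a * (norm (x - z))\<^sup>2" for y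
      using max[of y] cone_le_paraboloid[OF \<open>K \<ge> 0\<close> \<open>x \<noteq> z\<close>, of y]
      unfolding a_def by linarith
  qed
qed

subsection \<open>Relaxed limits at large times\<close>

text \<open>A perturbed test function touches \<open>w\<close> at late times near the point where the original one
  touches the limit, and its time slope there is small.\<close>

lemma relaxed_limit_stationary_subsolution:
  fixes w :: "real ^ 'n \<Rightarrow> real \<Rightarrow> real ^ 'm" and W :: "real ^ 'n \<Rightarrow> real ^ 'm"
  assumes sub: "evolution_subsolution H D w"
    and cont: "continuous_on (UNIV \<times> {0..}) (\<lambda>(x, t). w x t)"
    and D: "\<And>i j. i \<noteq> j \<Longrightarrow> D $ i $ j \<le> 0"
    and H: "\<And>i. continuous_on UNIV (\<lambda>(x, p). H i x p)"
    and W: "continuous_on UNIV W"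
    and upper: "\<And>e. e > 0 \<Longrightarrow> \<exists>T. \<forall>t\<ge>T. \<forall>x i. w x t $ i \<le> W x $ i + e"
    and attained: "\<And>e T x i. e > 0 \<Longrightarrow> \<exists>t\<ge>T. W x $ i - e \<le> w x t $ i"
  shows "stationary_subsolution H D W"
  unfolding stationary_subsolution_def viscosity_subsolution_def
proof (intro allI impI, elim conjE, rule ccontr)
  fix i \<phi> G z
  assume C1: "C1_with_gradient UNIV \<phi> G" and ev: "\<forall>\<^sub>F y in nhds z. W y $ i - \<phi> y \<le> W z $ i - \<phi> z"
    and "\<not> H i z (G z) + (\<Sum>j\<in>UNIV. D $ i $ j * W z $ j) \<le> 0"
  then have pos: "H i z (G z) + (D *v W z) $ i > 0" by (simp add: matrix_vector_mult_def)
  have cont_G: "continuous_on UNIV G" and cont_\<phi>: "continuous_on UNIV \<phi>"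
    using C1 by (auto simp: C1_with_gradient_def gderiv_def intro!: continuous_at_imp_continuous_on
        has_derivative_continuous)
  \<comment> \<open>The stationary operator at \<open>W\<close> with the gradient of \<phi> plus the
    squared distance to \<open>z\<close>; the square makes the contact at \<open>z\<close>
    strict.\<close>
  define q where "q x = H i x (G x + 2 *\<^sub>R (x - z)) + (\<Sum>j\<in>UNIV. D $ i $ j * W x $ j)" for x
  define \<kappa> where "\<kappa> = q z / 2"
  have "\<kappa> > 0" using pos by (simp add: \<kappa>_def q_def matrix_vector_mult_def)
  have "continuous_on UNIV (\<lambda>x. (\<lambda>(x, p). H i x p) (x, G x + 2 *\<^sub>R (x - z)))"
    by (rule continuous_on_compose2[OF H]) (auto intro!: continuous_intros cont_G)
  then have "continuous_on UNIV q"
    unfolding q_def by (intro continuous_intros W) auto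
  then have "\<forall>\<^sub>F x in nhds z. q x > \<kappa>"
    using \<open>\<kappa> > 0\<close> by (intro order_tendstoD(1)[of q "q z"])
      (auto simp: continuous_on_eq_continuous_at isCont_def tendsto_at_iff_tendsto_nhds \<kappa>_def)
  with ev have "\<forall>\<^sub>F x in nhds z. q x > \<kappa> \<and> W x $ i - \<phi> x \<le> W z $ i - \<phi> z" by eventually_elim simp
  then obtain \<delta> where \<delta>: "\<delta> > 0"
    "\<And>x. dist x z < \<delta> \<Longrightarrow> q x > \<kappa>" "\<And>x. dist x z < \<delta> \<Longrightarrow> W x $ i - \<phi> x \<le> W z $ i - \<phi> z"
    unfolding eventually_nhds_metric by blast
  define A where "A = (\<Sum>j\<in>UNIV. \<bar>D $ i $ j\<bar>)"
  have "A \<ge> 0" unfolding A_def by (intro sum_nonneg) auto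
  \<comment> \<open>The bounds in terms of \<kappa> keep the time slope
    \<open>2 * (t - t\<^sub>0)\<close> within \<kappa>/4 and the coupling error \<open>A * e\<close>
    within \<kappa>/8, together less than \<kappa>.\<close>
  define \<rho> where "\<rho> = Min {\<delta> / 2, 1, \<kappa> / 8, \<kappa> / (8 * (A + 1))}"
  have "\<rho> \<le> \<delta> / 2" and \<rho>_le: "\<rho> \<le> 1" "\<rho> \<le> \<kappa> / 8" "\<rho> \<le> \<kappa> / (8 * (A + 1))"
    unfolding \<rho>_def by (intro Min_le; simp)+
  moreover have "\<rho> > 0" using \<open>\<delta> > 0\<close> \<open>\<kappa> > 0\<close> \<open>A \<ge> 0\<close> by (auto simp: \<rho>_def)
  ultimately have \<rho>: "\<rho> > 0" "\<rho> < \<delta>" "\<rho> \<le> 1" "\<rho> \<le> \<kappa> / 8" "\<rho> \<le> \<kappa> / (8 * (A + 1))"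
    using \<open>\<delta> > 0\<close> by auto
  \<comment> \<open>The perturbed maximum will satisfy that its squared distances in space and time
    add up to at most \<open>2 * e\<close>, half of \<open>\<rho>\<^sup>2\<close>, so that it is
    interior.\<close>
  define e where "e = \<rho>\<^sup>2 / 4"
  have e: "e > 0" "e \<le> \<rho>" "4 * e = \<rho>\<^sup>2"
    using \<rho> power2_eq_square[of \<rho>] mult_left_le[of \<rho> \<rho>] by (auto simp: e_def)
  have "c * (\<kappa> / (8 * c)) = \<kappa> / 8" if "c > 0" for c using that by simp
  from this[of "A + 1"] have c: "(A + 1) * (\<kappa> / (8 * (A + 1))) = \<kappa> / 8" using \<open>A \<ge> 0\<close> by linarith
  have "(A + 1) * e \<le> (A + 1) * (\<kappa> / (8 * (A + 1)))"
    using e \<rho> \<open>A \<ge> 0\<close> by (intro mult_left_mono) auto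
  also note c
  finally have Ae: "A * e \<le> \<kappa> / 8" using \<open>A \<ge> 0\<close> e(1) by (simp add: algebra_simps)
  obtain T where T: "\<And>t x j. t \<ge> T \<Longrightarrow> w x t $ j \<le> W x $ j + e" using upper[OF e(1)] by blast
  obtain t\<^sub>0 where t0: "t\<^sub>0 \<ge> max T 0 + 2" "W z $ i - e \<le> w z t\<^sub>0 $ i" using attained[OF e(1)] by blast
  define I where "I = {t\<^sub>0 - \<rho>..t\<^sub>0 + \<rho>}"
  have I: "t > 0" "t \<ge> T" if "t \<in> I" for t using that t0(1) \<rho>(3) by (auto simp: I_def)
  define \<Psi> where "\<Psi> y = (case y of (x, t) \<Rightarrow> w x t $ i) - (\<phi> (fst y) + (norm (fst y - z))\<^sup>2) - (snd y - t\<^sub>0)\<^sup>2" for y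
  have \<Psi>: "\<Psi> (x, t) = w x t $ i - (\<phi> x + (norm (x - z))\<^sup>2) - (t - t\<^sub>0)\<^sup>2" for x t by (simp add: \<Psi>_def)
  have "continuous_on (cball z \<rho> \<times> I) (\<lambda>y. \<phi> (fst y))"
    by (rule continuous_on_compose2[OF cont_\<phi> continuous_on_fst[OF continuous_on_id]]) auto
  then have "continuous_on (cball z \<rho> \<times> I) \<Psi>"
    unfolding \<Psi>_def using I
    by (intro continuous_on_diff continuous_on_add continuous_on_UNIV_Times_component[OF cont]
        continuous_intros) (auto dest: less_imp_le)
  moreover have "compact (cball z \<rho> \<times> I)" "(z, t\<^sub>0) \<in> cball z \<rho> \<times> I"
    using \<rho>(1) by (auto simp: I_def compact_Times)
  ultimately obtain y where y: "y \<in> cball z \<rho> \<times> I" and y_max: "\<And>y'. y' \<in> cball z \<rho> \<times> I \<Longrightarrow> \<Psi> y' \<le> \<Psi> y"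
    using continuous_attains_sup[of "cball z \<rho> \<times> I" \<Psi>] by blast
  obtain x t where yxt: "y = (x, t)" by force
  have xt: "dist x z \<le> \<rho>" "t \<in> I" using y by (auto simp: yxt dist_commute)
  have "\<Psi> (z, t\<^sub>0) \<le> \<Psi> (x, t)" using y_max[OF \<open>(z, t\<^sub>0) \<in> cball z \<rho> \<times> I\<close>] by (simp add: yxt)
  then have ge: "W z $ i - e - \<phi> z \<le> w x t $ i - \<phi> x - (norm (x - z))\<^sup>2 - (t - t\<^sub>0)\<^sup>2"
    using t0(2) by (simp add: \<Psi>)
  have loc: "W x $ i - \<phi> x \<le> W z $ i - \<phi> z" using \<delta>(3) xt(1) \<rho>(2) by simp
  have "(norm (x - z))\<^sup>2 + (t - t\<^sub>0)\<^sup>2 \<le> 2 * e"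
    using ge loc T[OF I(2)[OF xt(2)], of x i] by linarith
  then have "(norm (x - z))\<^sup>2 < \<rho>\<^sup>2" "\<bar>t - t\<^sub>0\<bar>\<^sup>2 < \<rho>\<^sup>2"
    using e zero_le_power2[of "t - t\<^sub>0"] zero_le_power2[of "norm (x - z)"]
    unfolding power2_abs by linarith+
  then have inside: "norm (x - z) < \<rho>" "\<bar>t - t\<^sub>0\<bar> < \<rho>"
    using power_less_imp_less_base \<rho>(1) by (metis less_imp_le)+
  \<comment> \<open>The diagonal entry of \<open>D\<close> is nonnegative and needs a lower bound on
    component \<open>i\<close>, which maximality supplies at this point. For the other components
    the sign of the entries makes the uniform upper bound enough.\<close>
  have w_ge: "w x t $ i \<ge> W x $ i - e"
    using ge loc zero_le_power2[of "t - t\<^sub>0"] zero_le_power2[of "norm (x - z)"] by linarith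
  have "2 * (t - t\<^sub>0) + H i x (G x + 2 *\<^sub>R (x - z)) + (D *v w x t) $ i \<le> 0"
  proof (rule evolution_subsolution_test[OF sub C1_with_gradient_add[OF C1 C1_with_gradient_norm_sq], where
        \<theta> = "\<lambda>t. (t - t\<^sub>0)\<^sup>2" and \<theta>' = "\<lambda>t. 2 * (t - t\<^sub>0)"
        and \<delta> = "min (\<rho> - norm (x - z)) (\<rho> - \<bar>t - t\<^sub>0\<bar>)"])
    show "((\<lambda>t. (t - t\<^sub>0)\<^sup>2) has_real_derivative 2 * (t - t\<^sub>0)) (at t)" for t
      by (auto intro!: derivative_eq_intros)
    show "0 < min (\<rho> - norm (x - z)) (\<rho> - \<bar>t - t\<^sub>0\<bar>)" using inside by simp
    fix x' s assume x': "norm (x' - x) < min (\<rho> - norm (x - z)) (\<rho> - \<bar>t - t\<^sub>0\<bar>)"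
      and s: "\<bar>s - t\<bar> < min (\<rho> - norm (x - z)) (\<rho> - \<bar>t - t\<^sub>0\<bar>)"
    have "norm (x' - z) \<le> norm (x' - x) + norm (x - z)"
      using norm_triangle_ineq[of "x' - x" "x - z"] by simp
    then have "(x', s) \<in> cball z \<rho> \<times> I"
      using x' s by (auto simp: I_def dist_norm norm_minus_commute)
    then show "w x' s $ i - (\<phi> x' + (norm (x' - z))\<^sup>2) - (s - t\<^sub>0)\<^sup>2
        \<le> w x t $ i - (\<phi> x + (norm (x - z))\<^sup>2) - (t - t\<^sub>0)\<^sup>2"
      using y_max[of "(x', s)"] by (simp add: \<Psi> yxt)
  qed (use I xt in \<open>auto intro!: continuous_intros\<close>)
  moreover have "(D *v w x t) $ i \<ge> (\<Sum>j\<in>UNIV. D $ i $ j * W x $ j) - A * e"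
  proof -
    have "- (\<bar>D $ i $ j\<bar> * e) \<le> D $ i $ j * (w x t $ j - W x $ j)" for j
    proof (cases "j = i")
      case True
      have "\<bar>D $ i $ i * (w x t $ i - W x $ i)\<bar> \<le> \<bar>D $ i $ i\<bar> * e"
        unfolding abs_mult using w_ge T[OF I(2)[OF xt(2)], of x i]
        by (intro mult_left_mono) (auto simp: abs_le_iff)
      then show ?thesis using True by (simp add: abs_le_iff)
    next
      case False
      then have "D $ i $ j \<le> 0" using D by auto
      moreover have "w x t $ j - W x $ j \<le> e" using T[OF I(2)[OF xt(2)], of x j] by simp
      ultimately show ?thesis using mult_left_mono_neg[of "w x t $ j - W x $ j" e "D $ i $ j"] by simp
    qed
    then have "(\<Sum>j\<in>UNIV. - (\<bar>D $ i $ j\<bar> * e)) \<le> (\<Sum>j\<in>UNIV. D $ i $ j * (w x t $ j - W x $ j))"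
      by (intro sum_mono)
    then show ?thesis
      by (simp add: A_def matrix_vector_mult_def sum_negf sum_distrib_right right_diff_distrib sum_subtractf)
  qed
  moreover have "q x > \<kappa>" using \<delta>(2) xt(1) \<rho>(2) by simp
  ultimately have "2 * (t - t\<^sub>0) + \<kappa> - A * e < 0" unfolding q_def by linarith
  then show False using Ae inside(2) \<rho>(4) \<open>\<kappa> > 0\<close> by (simp add: abs_less_iff)
qed

text \<open>\<open>L\<close> is the upper limit of \<open>y\<close> at infinity, written as the
  infimum of its eventual upper bounds.\<close>

lemma limsup_at_top_bounds:
  fixes y :: "real \<Rightarrow> real"
  assumes "\<And>t. t \<ge> 0 \<Longrightarrow> \<bar>y t\<bar> \<le> B"
  defines "L \<equiv> Inf {a. \<exists>T\<ge>0. \<forall>t\<ge>T. y t \<le> a}"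
  shows "e > 0 \<Longrightarrow> \<exists>T. \<forall>t\<ge>T. y t \<le> L + e" and "e > 0 \<Longrightarrow> \<exists>t\<ge>T. L - e \<le> y t"
proof -
  let ?A = "{a. \<exists>T\<ge>0. \<forall>t\<ge>T. y t \<le> a}"
  have "B \<in> ?A" using assms(1) by (auto intro!: exI[of _ 0] simp: abs_le_iff)
  have bdd: "bdd_below ?A"
  proof (rule bdd_belowI)
    fix a assume "a \<in> ?A"
    then obtain T where "T \<ge> 0" "y T \<le> a" by auto
    then show "- B \<le> a" using assms(1)[of T] by (simp add: abs_le_iff)
  qed
  show "\<exists>T. \<forall>t\<ge>T. y t \<le> L + e" if "e > 0"
  proof -
    have "Inf ?A < L + e" using that by (simp add: L_def)
    then obtain a where "a \<in> ?A" "a < L + e"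
      using cInf_less_iff[OF _ bdd] \<open>B \<in> ?A\<close> by blast
    then obtain T where T: "\<And>t. t \<ge> T \<Longrightarrow> y t \<le> a" by auto
    have "y t \<le> L + e" if "t \<ge> T" for t using T[OF that] \<open>a < L + e\<close> by simp
    then show ?thesis by blast
  qed
  show "\<exists>t\<ge>T. L - e \<le> y t" if "e > 0"
  proof (rule ccontr)
    assume "\<not> ?thesis"
    then have "\<forall>t\<ge>max T 0. y t \<le> L - e" by (meson le_cases max.boundedE)
    then have "L - e \<in> ?A" by (auto intro!: exI[of _ "max T 0"])
    then have "L \<le> L - e" unfolding L_def using bdd by (intro cInf_lower) auto
    then show False using that by simp
  qed
qed

text \<open>A spatial modulus uniform in time passes to the upper limit and reduces the bound from
  above to finitely many points of the unit cube, hence makes it uniform in \<open>x\<close>. The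
  times at which the limit is nearly attained still depend on \<open>x\<close>.\<close>

lemma torus_limsup:
  fixes g :: "real ^ 'n \<Rightarrow> real \<Rightarrow> real"
  assumes torus: "\<And>t. t \<ge> 0 \<Longrightarrow> torus_fun (\<lambda>x. g x t)" and bdd: "\<And>x t. t \<ge> 0 \<Longrightarrow> \<bar>g x t\<bar> \<le> B"
    and modulus: "\<And>e. e > 0 \<Longrightarrow> \<exists>K>0. \<forall>x y t. t \<ge> 1 \<longrightarrow> g x t - g y t \<le> e + K * norm (x - y)"
  obtains L where "torus_fun L" "continuous_on UNIV L"
    "\<And>e. e > 0 \<Longrightarrow> \<exists>T. \<forall>t\<ge>T. \<forall>x. g x t \<le> L x + e" "\<And>e T x. e > 0 \<Longrightarrow> \<exists>t\<ge>T. L x - e \<le> g x t"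
proof -
  define L where "L x = Inf {a. \<exists>T\<ge>0. \<forall>t\<ge>T. g x t \<le> a}" for x
  have upper: "\<exists>T. \<forall>t\<ge>T. g x t \<le> L x + e" and attained: "\<exists>t\<ge>T. L x - e \<le> g x t" if "e > 0" for x e T
    using limsup_at_top_bounds[of "g x" B, OF bdd that] by (auto simp: L_def)
  have "torus_fun L"
    unfolding torus_fun_def
  proof (intro allI impI)
    fix x k :: "real ^ 'n" assume "\<forall>l. k $ l \<in> \<int>"
    then have "g (x + k) t = g x t" if "t \<ge> 0" for t using torus[OF that] by (simp add: torus_fun_def)
    then have "(\<exists>T\<ge>0. \<forall>t\<ge>T. g (x + k) t \<le> a) \<longleftrightarrow> (\<exists>T\<ge>0. \<forall>t\<ge>T. g x t \<le> a)" for a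
      by (metis order_trans)
    then show "L (x + k) = L x" by (simp add: L_def)
  qed
  have L_modulus: "\<exists>K>0. \<forall>x y. L x - L y \<le> e + K * norm (x - y)" if "e > 0" for e
  proof -
    obtain K where K: "K > 0" "\<And>x y t. t \<ge> 1 \<Longrightarrow> g x t - g y t \<le> e / 3 + K * norm (x - y)"
      using modulus[of "e / 3"] \<open>e > 0\<close> by auto
    have "L x - L y \<le> e + K * norm (x - y)" for x y
    proof -
      obtain T where T: "\<And>t. t \<ge> T \<Longrightarrow> g y t \<le> L y + e / 3" using upper[of "e / 3" y] \<open>e > 0\<close> by auto
      obtain t where t: "t \<ge> max T 1" "L x - e / 3 \<le> g x t" using attained[of "e / 3" "max T 1" x] \<open>e > 0\<close> by auto
      show ?thesis using T[of t] K(2)[of t x y] t by simp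
    qed
    then show ?thesis using K(1) by blast
  qed
  have "continuous_on UNIV L"
    unfolding continuous_on_iff
  proof (intro ballI allI impI)
    fix x and e :: real assume "e > 0"
    obtain K where K: "K > 0" "\<And>x y. L x - L y \<le> e / 2 + K * norm (x - y)"
      using L_modulus[of "e / 2"] \<open>e > 0\<close> by auto
    show "\<exists>d>0. \<forall>y\<in>UNIV. dist y x < d \<longrightarrow> dist (L y) (L x) < e"
    proof (intro exI[of _ "e / (2 * K)"] conjI ballI impI)
      show "e / (2 * K) > 0" using \<open>e > 0\<close> K(1) by simp
      fix y assume "dist y x < e / (2 * K)"
      then have "K * norm (x - y) < e / 2" using K(1) by (simp add: dist_norm norm_minus_commute field_simps)
      then show "dist (L y) (L x) < e"
        using K(2)[of x y] K(2)[of y x] by (auto simp: dist_real_def norm_minus_commute abs_less_iff)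
    qed
  qed
  have "\<exists>T. \<forall>t\<ge>T. \<forall>x. g x t \<le> L x + e" if "e > 0" for e
  proof -
    \<comment> \<open>Five errors are added: the constant part and the slope part of each modulus,
      for \<open>g\<close> and for \<open>L\<close>, and the excess at the net point.\<close>
    obtain K where K: "K > 0" "\<And>x y t. t \<ge> 1 \<Longrightarrow> g x t - g y t \<le> e / 5 + K * norm (x - y)"
      using modulus[of "e / 5"] \<open>e > 0\<close> by auto
    obtain K' where K': "K' > 0" "\<And>x y. L x - L y \<le> e / 5 + K' * norm (x - y)"
      using L_modulus[of "e / 5"] \<open>e > 0\<close> by auto
    define r where "r = e / (5 * max K K')"
    have "max K K' > 0" using K(1) by simp
    then have "r > 0" using that by (simp add: r_def)
    have r: "K * d \<le> e / 5" "K' * d \<le> e / 5" if "0 \<le> d" "d < r" for d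
    proof -
      have "max K K' * d \<le> max K K' * r" using that \<open>max K K' > 0\<close> by (intro mult_left_mono) auto
      also have "\<dots> = e / 5" using \<open>max K K' > 0\<close> by (simp add: r_def)
      finally show "K * d \<le> e / 5" "K' * d \<le> e / 5"
        using mult_right_mono[of K "max K K'" d] mult_right_mono[of K' "max K K'" d] that by auto
    qed
    obtain A :: "(real ^ 'n) set" where A: "finite A" "cbox 0 1 \<subseteq> (\<Union>x\<in>A. ball x r)"
      using compact_cbox[of 0 1] \<open>r > 0\<close> unfolding compact_eq_totally_bounded by metis
    obtain T where T: "\<And>x t. t \<ge> T x \<Longrightarrow> g x t \<le> L x + e / 5"
      using upper[of "e / 5"] \<open>e > 0\<close> by (metis zero_less_divide_iff zero_less_numeral)
    \<comment> \<open>The inserted 1 places \<open>t\<close> in the range where the modulus of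
      \<open>g\<close> is available.\<close>
    have "g x t \<le> L x + e" if t: "t \<ge> Max (insert 1 (T ` A))" for t x
    proof -
      have "t \<ge> 1" and tT: "t \<ge> T a" if "a \<in> A" for a using t that \<open>finite A\<close> by auto
      have "t \<ge> 1" using t \<open>finite A\<close> by auto
      obtain k where k: "\<forall>l. k $ l \<in> \<int>" "x + k \<in> cbox 0 1" using torus_representative by blast
      obtain a where a: "a \<in> A" "dist a (x + k) < r" using A(2) k(2) by auto
      have "g (x + k) t \<le> L (x + k) + e"
        using K(2)[OF \<open>t \<ge> 1\<close>, of "x + k" a] K'(2)[of a "x + k"] T[OF tT[OF a(1)]] r[of "dist a (x + k)"] a(2)
          norm_minus_commute[of a "x + k"] unfolding dist_norm by fastforce
      then show ?thesis
        using torus[of t] \<open>torus_fun L\<close> k(1) \<open>t \<ge> 1\<close> by (simp add: torus_fun_def)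
    qed
    then show ?thesis by blast
  qed
  then show thesis using that \<open>torus_fun L\<close> \<open>continuous_on UNIV L\<close> attained by blast
qed

text \<open>Stated outside the locales and for a general continuous \<open>H\<close>, so that it
  applies to \<open>w\<close> and also to \<open>- w\<close> with the reflected Hamiltonian.\<close>

lemma ex_relaxed_limit:
  fixes w :: "real ^ 'n \<Rightarrow> real \<Rightarrow> real ^ 'm"
  assumes sub: "evolution_subsolution H D w"
    and torus: "\<And>t. t \<ge> 0 \<Longrightarrow> torus_fun (\<lambda>x. w x t)"
    and cont: "continuous_on (UNIV \<times> {0..}) (\<lambda>(x, t). w x t)"
    and D: "\<And>i j. i \<noteq> j \<Longrightarrow> D $ i $ j \<le> 0"
    and H: "\<And>i. continuous_on UNIV (\<lambda>(x, p). H i x p)"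
    and bdd: "\<And>x t i. t \<ge> 0 \<Longrightarrow> \<bar>w x t $ i\<bar> \<le> B"
    and modulus: "\<And>e. e > 0 \<Longrightarrow> \<exists>K>0. \<forall>x y t i. t \<ge> 1 \<longrightarrow> w x t $ i - w y t $ i \<le> e + K * norm (x - y)"
  obtains W where "torus_fun W" "continuous_on UNIV W" "stationary_subsolution H D W"
    "\<And>e. e > 0 \<Longrightarrow> \<exists>T. \<forall>t\<ge>T. \<forall>x i. w x t $ i \<le> W x $ i + e"
    "\<And>e T x i. e > 0 \<Longrightarrow> \<exists>t\<ge>T. W x $ i - e \<le> w x t $ i"
proof -
  have "\<exists>L. torus_fun L \<and> continuous_on UNIV L \<and>
    (\<forall>e>0. \<exists>T. \<forall>t\<ge>T. \<forall>x. w x t $ i \<le> L x + e) \<and> (\<forall>e>0. \<forall>T x. \<exists>t\<ge>T. L x - e \<le> w x t $ i)" for i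
  proof -
    have tor: "torus_fun (\<lambda>x. w x t $ i)" if "t \<ge> 0" for t
      using torus[OF that] by (simp add: torus_fun_def)
    have mod: "\<exists>K>0. \<forall>x y t. t \<ge> 1 \<longrightarrow> w x t $ i - w y t $ i \<le> e + K * norm (x - y)" if "e > 0" for e
      using modulus[OF that] by blast
    show ?thesis
      by (rule torus_limsup[where g = "\<lambda>x t. w x t $ i" and B = B, OF tor bdd mod]) blast+
  qed
  then obtain L where L: "\<And>i. torus_fun (L i)" "\<And>i. continuous_on UNIV (L i)"
    "\<And>i e. e > 0 \<Longrightarrow> \<exists>T. \<forall>t\<ge>T. \<forall>x. w x t $ i \<le> L i x + e"
    "\<And>i e T x. e > 0 \<Longrightarrow> \<exists>t\<ge>T. L i x - e \<le> w x t $ i" by metis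
  define W where "W x = (\<chi> i. L i x)" for x
  have "torus_fun W" using L(1) by (simp add: W_def torus_fun_def)
  moreover have contW: "continuous_on UNIV W" unfolding W_def by (intro continuous_on_vec_lambda L(2))
  moreover have upper: "\<exists>T. \<forall>t\<ge>T. \<forall>x i. w x t $ i \<le> W x $ i + e" if "e > 0" for e
  proof -
    obtain T where T: "\<And>i t x. t \<ge> T i \<Longrightarrow> w x t $ i \<le> L i x + e" using L(3)[OF \<open>e > 0\<close>] by metis
    have "w x t $ i \<le> W x $ i + e" if "t \<ge> Max (range T)" for t x i
      using T that Max_ge[of "range T" "T i"] by (simp add: W_def)
    then show ?thesis by blast
  qed
  moreover have attained: "\<exists>t\<ge>T. W x $ i - e \<le> w x t $ i" if "e > 0" for e T x i
    using L(4)[OF that] by (simp add: W_def)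
  moreover have "stationary_subsolution H D W"
    using relaxed_limit_stationary_subsolution[OF sub cont D H contW upper attained] .
  ultimately show thesis using that by blast
qed

subsection \<open>The stationary system\<close>

text \<open>The situation after each \<open>f i\<close> has been reduced by its minimum:
  \<open>H i x 0\<close> is minus the excess of \<open>f i\<close> over that minimum, and
  \<open>ex_zero\<close> provides a common minimizer.\<close>

locale normalized_system =
  fixes H :: "'m::finite \<Rightarrow> real ^ 'n \<Rightarrow> real ^ 'n \<Rightarrow> real" and D :: "real ^ 'm ^ 'm"
  assumes monotone: "monotone_matrix D"
    and irreducible: "irreducible_matrix D"
    and torus_H: "\<And>i. torus_fun (H i)"
    and cont_H: "\<And>i. continuous_on UNIV (\<lambda>(x, p). H i x p)"
    and convex_H: "\<And>i x. convex_on UNIV (H i x)"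
    and coercive_H: "\<And>i. uniformly_coercive (H i)"
    and H_ge: "\<And>i x p. H i x p \<ge> H i x 0"
    and H_0_le: "\<And>i x. H i x 0 \<le> 0"
    and ex_zero: "\<exists>x. \<forall>i. H i x 0 = 0"
begin

lemma torus_H_arg: "torus_fun (\<lambda>x. H i x p)"
  using torus_H[of i] by (simp add: torus_fun_def)

lemma cont_H_0: "continuous_on UNIV (\<lambda>x. H i x 0)"
proof -
  have "continuous_on UNIV (\<lambda>x. (\<lambda>(x, p). H i x p) (x, 0))"
    by (rule continuous_on_compose2[OF cont_H]) (auto intro!: continuous_intros)
  then show ?thesis by simp
qed

lemma coercive_all:
  obtains R where "R > 0" "\<And>i x p. norm p \<ge> R \<Longrightarrow> H i x p \<ge> M"
proof -
  have "\<forall>i. \<exists>R. \<forall>x p. norm p \<ge> R \<longrightarrow> H i x p \<ge> M"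
    using coercive_H unfolding uniformly_coercive_def by blast
  then obtain R where R: "\<And>i x p. norm p \<ge> R i \<Longrightarrow> H i x p \<ge> M" by metis
  have "R i \<le> Max (range R)" for i by simp
  then have "H i x p \<ge> M" if "norm p \<ge> max 1 (Max (range R))" for i x p
    using R[where i = i] that by (meson max.boundedE order_trans)
  moreover have "max 1 (Max (range R)) > 0" by simp
  ultimately show thesis using that by blast
qed

lemma H_uniformly_continuous:
  assumes "e > 0"
  obtains d where "d > 0"
    "\<And>i x y p q. norm p \<le> R \<Longrightarrow> norm q \<le> R \<Longrightarrow> dist x y < d \<Longrightarrow> dist p q < d \<Longrightarrow> \<bar>H i x p - H i y q\<bar> < e"
proof -
  define V where "V x p = (\<chi> i. H i x p)" for x p
  have "continuous_on (UNIV \<times> cball 0 R) (\<lambda>z. \<chi> i. (\<lambda>(x, p). H i x p) z)"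
    by (intro continuous_on_vec_lambda continuous_on_subset[OF cont_H]) auto
  then have "continuous_on (UNIV \<times> cball 0 R) (\<lambda>(x, p). V x p)"
    by (simp add: V_def case_prod_unfold)
  moreover have "torus_fun (\<lambda>x. V x p)" for p
    using torus_H_arg by (simp add: V_def torus_fun_def)
  ultimately obtain d where d: "d > 0" "\<And>x y p q. p \<in> cball 0 R \<Longrightarrow> q \<in> cball 0 R \<Longrightarrow> dist x y < d
      \<Longrightarrow> dist p q < d \<Longrightarrow> dist (V x p) (V y q) < e"
    using torus_compact_uniformly_continuous[of "cball 0 R" V e] \<open>e > 0\<close> compact_cball by metis
  show thesis
  proof
    fix i and x y p q :: "real ^ 'n" assume "norm p \<le> R" "norm q \<le> R" "dist x y < d" "dist p q < d"
    then have "dist (V x p) (V y q) < e" by (intro d(2)) auto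
    then show "\<bar>H i x p - H i y q\<bar> < e"
      using component_le_norm_cart[of "V x p - V y q" i] by (simp add: V_def dist_norm)
  qed (rule d(1))
qed

lemma mult_D_ge_0: "(\<And>j. r $ j \<le> r $ i) \<Longrightarrow> (D *v r) $ i \<ge> 0"
  by (rule monotone_matrix_mult_ge_0(1)[OF monotone])

lemma mult_D_le_0: "(\<And>j. r $ i \<le> r $ j) \<Longrightarrow> (D *v r) $ i \<le> 0"
  using mult_D_ge_0[of "- r" i] by (simp add: matrix_vector_mult_def sum_negf)

lemma mult_D_diff: "(D *v (r - s)) $ i = (D *v r) $ i - (D *v s) $ i"
  by (simp add: matrix_vector_mult_diff_distrib)

text \<open>If \<open>v\<close> rose above a steep cone with vertex \<open>y\<close>, the maximum of
  the difference would lie off the vertex. There the slope \<open>K\<close> makes the Hamiltonian at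
  least \<open>C + 1\<close>, which a coupling term bounded by \<open>C\<close> cannot
  compensate.\<close>

lemma stationary_subsolution_lipschitz:
  assumes sub: "stationary_subsolution H D v" and v: "torus_fun v" "continuous_on UNIV v"
  obtains L where "L > 0" "\<And>x y i. v x $ i - v y $ i \<le> L * norm (x - y)"
proof -
  obtain B where B: "B > 0" "\<And>x. norm (v x) \<le> B" using torus_continuous_bounded[OF v] by blast
  have vB: "\<bar>v x $ i\<bar> \<le> B" for x i using component_le_norm_cart[of "v x" i] B(2)[of x] by simp
  have "torus_fun (\<lambda>x. D *v v x)" using v(1) by (simp add: torus_fun_def)
  moreover have "continuous_on UNIV (\<lambda>x. D *v v x)"
    by (rule bounded_linear.continuous_on[OF matrix_vector_mul_bounded_linear v(2)])
  ultimately obtain C where C: "C > 0" "\<And>x. norm (D *v v x) \<le> C" by (rule torus_continuous_bounded) (rule that)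
  obtain K where K: "K > 0" "\<And>i x p. norm p \<ge> K \<Longrightarrow> H i x p \<ge> C + 1" using coercive_all by blast
  show thesis
  proof (rule that[OF K(1)], rule ccontr)
    fix x\<^sub>1 y i assume "\<not> v x\<^sub>1 $ i - v y $ i \<le> K * norm (x\<^sub>1 - y)"
    then have viol: "v x\<^sub>1 $ i - K * norm (x\<^sub>1 - y) > v y $ i" by simp
    define \<Phi> where "\<Phi> x = v x $ i - K * norm (x - y)" for x
    have cont: "continuous_on UNIV \<Phi>" unfolding \<Phi>_def by (intro continuous_intros v(2))
    have bdd: "bounded {x \<in> UNIV. \<Phi> x \<ge> \<Phi> x\<^sub>1}"
    proof (rule bounded_subset[OF bounded_cball])
      show "{x \<in> UNIV. \<Phi> x \<ge> \<Phi> x\<^sub>1} \<subseteq> cball y ((B - \<Phi> x\<^sub>1) / K)"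
      proof clarsimp
        fix x assume "\<Phi> x \<ge> \<Phi> x\<^sub>1"
        then have "K * norm (x - y) \<le> B - \<Phi> x\<^sub>1"
          using vB[of x i] unfolding \<Phi>_def[of x] by (simp add: abs_le_iff)
        then show "dist y x \<le> (B - \<Phi> x\<^sub>1) / K"
          using K(1) by (simp add: dist_norm norm_minus_commute field_simps)
      qed
    qed
    obtain x where max: "\<And>y. y \<in> UNIV \<Longrightarrow> \<Phi> y \<le> \<Phi> x"
      by (rule coercive_attains_max[where \<Phi> = \<Phi>, OF closed_UNIV cont UNIV_I bdd]) (rule that)
    have "\<Phi> x > v y $ i" using max[of x\<^sub>1] viol by (simp add: \<Phi>_def)
    then have "x \<noteq> y" by (auto simp: \<Phi>_def)
    obtain p where p: "norm p = K" "H i x p + (D *v v x) $ i \<le> 0"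
      using stationary_subsolution_cone[OF sub less_imp_le[OF K(1)] \<open>x \<noteq> y\<close>] max
      unfolding \<Phi>_def by blast
    then show False
      using K(2)[of p i x] C(2)[of x] component_le_norm_cart[of "D *v v x" i] by (simp add: abs_le_iff)
  qed
qed

text \<open>Multiplying the subsolution by \<open>\<mu> < 1\<close> gains \<open>(1 - \<mu>) H\<^sub>i(x, 0)\<close> by convexity.\<close>

lemma stationary_doubling:
  assumes sub: "stationary_subsolution H D v" and super: "stationary_supersolution H D V"
    and L: "L > 0" "\<And>x y i. v x $ i - v y $ i \<le> L * norm (x - y)"
    and V: "continuous_on UNIV V" and \<mu>: "0 < \<mu>" "\<mu> < 1"
    and x0: "\<And>x. \<mu> * v x $ i - V x $ i \<le> \<mu> * v x\<^sub>0 $ i - V x\<^sub>0 $ i"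
  shows "(D *v (\<mu> *\<^sub>R v x\<^sub>0 - V x\<^sub>0)) $ i \<le> (1 - \<mu>) * H i x\<^sub>0 0"
proof (rule ccontr)
  assume neg: "\<not> ?thesis"
  have "L-lipschitz_on UNIV (\<lambda>x. v x $ j)" for j
  proof (rule lipschitz_onI)
    show "dist (v x $ j) (v y $ j) \<le> L * dist x y" for x y
      using L(2)[of x j y] L(2)[of y j x] by (simp add: dist_real_def dist_norm abs_le_iff norm_minus_commute)
  qed (use L(1) in simp)
  then have cv: "continuous_on UNIV (\<lambda>x. v x $ j)" for j
    by (rule lipschitz_on_continuous_on)
  \<comment> \<open>What is left of the convexified subsolution inequality at \<open>x\<close> minus
    the supersolution inequality at \<open>y\<close>, apart from the difference of the Hamiltonians.
    That difference will be below \<kappa>, while \<open>q\<close> exceeds \<kappa> near the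
    diagonal point.\<close>
  define q where "q z = \<mu> * (\<Sum>j\<in>UNIV. D $ i $ j * v (fst z) $ j) - (\<Sum>j\<in>UNIV. D $ i $ j * V (snd z) $ j)
    - (1 - \<mu>) * H i (fst z) 0" for z
  have "D *v (\<mu> *\<^sub>R v x\<^sub>0 - V x\<^sub>0) = \<mu> *\<^sub>R (D *v v x\<^sub>0) - D *v V x\<^sub>0"
    by (simp add: matrix_vector_mult_diff_distrib matrix_vector_mult_scaleR)
  then have q_pos: "q (x\<^sub>0, x\<^sub>0) > 0" using neg by (simp add: q_def matrix_vector_mult_def)
  define \<kappa> where "\<kappa> = q (x\<^sub>0, x\<^sub>0) / 2"
  have "\<kappa> > 0" using q_pos by (simp add: \<kappa>_def)
  have "continuous_on UNIV q"
    unfolding q_def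
    by (intro continuous_on_diff continuous_on_mult continuous_on_const continuous_on_sum
        continuous_on_compose2[OF cv continuous_on_fst[OF continuous_on_id]]
        continuous_on_compose2[OF continuous_on_component[OF V] continuous_on_snd[OF continuous_on_id]]
        continuous_on_compose2[OF cont_H_0 continuous_on_fst[OF continuous_on_id]]) auto
  then have "\<forall>\<^sub>F z in nhds (x\<^sub>0, x\<^sub>0). q z > \<kappa>"
    using \<open>\<kappa> > 0\<close> by (intro order_tendstoD(1)[of q "q (x\<^sub>0, x\<^sub>0)"])
      (auto simp: continuous_on_eq_continuous_at isCont_def tendsto_at_iff_tendsto_nhds \<kappa>_def)
  then obtain \<delta> where \<delta>: "\<delta> > 0" "\<And>z. dist z (x\<^sub>0, x\<^sub>0) < \<delta> \<Longrightarrow> q z > \<kappa>"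
    unfolding eventually_nhds_metric by blast
  \<comment> \<open>The slope from the doubling term is at most \<open>2 * L\<close>, and the
    localisation term adds at most 2 because \<open>r\<close> is at most 1.\<close>
  obtain d where d: "d > 0" "\<And>i x y p q. norm p \<le> 2 * L + 2 \<Longrightarrow> norm q \<le> 2 * L + 2 \<Longrightarrow> dist x y < d \<Longrightarrow>
      dist p q < d \<Longrightarrow> \<bar>H i x p - H i y q\<bar> < \<kappa>"
    using H_uniformly_continuous[OF \<open>\<kappa> > 0\<close>] by metis
  define r where "r = Min {1, \<delta> / 3, d / 2}"
  have "r \<le> 1" "r \<le> \<delta> / 3" "r \<le> d / 2" unfolding r_def by (intro Min_le; simp)+
  moreover have "r > 0" using \<delta>(1) d(1) by (simp add: r_def)
  ultimately have r: "r > 0" "r \<le> 1" "3 * r \<le> \<delta>" "2 * r \<le> d" by auto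
  \<comment> \<open>One fixed penalty replaces the usual limit of large \<alpha>. Exceeding
    \<open>L / r\<close> brings \<open>x\<close> within \<open>r\<close> of \<open>y\<close>,
    exceeding its square brings \<open>x\<close> within \<open>r\<close> of
    \<open>x\<^sub>0\<close>; the square of \<open>L / r + 1\<close> exceeds both.\<close>
  define \<alpha> where "\<alpha> = (L / r + 1)\<^sup>2"
  have "L / r > 0" using L(1) r(1) by simp
  moreover have "(b + 1)\<^sup>2 > b \<and> (b + 1)\<^sup>2 > b\<^sup>2 \<and> (b + 1)\<^sup>2 > 0" if "b > 0" for b :: real
  proof -
    have "(b + 1)\<^sup>2 = b\<^sup>2 + 2 * b + 1" by (simp add: power2_eq_square algebra_simps)
    then show ?thesis using that zero_le_power2[of b] by (intro conjI; linarith)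
  qed
  ultimately have \<alpha>: "\<alpha> > L / r" "\<alpha> > (L / r)\<^sup>2" "\<alpha> > 0" unfolding \<alpha>_def by blast+
  define m where "m = \<mu> * v x\<^sub>0 $ i - V x\<^sub>0 $ i"
  define \<Phi> where "\<Phi> z = \<mu> * v (fst z) $ i - V (snd z) $ i - \<alpha> * (norm (fst z - snd z))\<^sup>2 - (norm (fst z - x\<^sub>0))\<^sup>2" for z
  have \<Phi>0: "\<Phi> (x\<^sub>0, x\<^sub>0) = m" by (simp add: \<Phi>_def m_def)
  \<comment> \<open>The points are compared through \<open>v\<close> at \<open>x\<close> and at
    \<open>y\<close>, so that only the Lipschitz bound of the subsolution enters.\<close>
  have small: "\<alpha> * norm (x - y) \<le> L" "norm (x - y) < r" "norm (x - x\<^sub>0) < r" if "\<Phi> (x, y) \<ge> m" for x y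
  proof -
    define a where "a = norm (x - y)"
    have "a \<ge> 0" by (simp add: a_def)
    have "\<mu> * (v x $ i - v y $ i) \<le> \<mu> * (L * a)" unfolding a_def using L(2) \<mu>(1) by (intro mult_left_mono) auto
    also have "\<dots> \<le> 1 * (L * a)" using L(1) \<open>a \<ge> 0\<close> \<mu>(2) by (intro mult_right_mono) auto
    finally have "\<mu> * v x $ i - V y $ i \<le> m + L * a" using x0[of y] by (simp add: m_def algebra_simps)
    then have le: "\<alpha> * a\<^sup>2 + (norm (x - x\<^sub>0))\<^sup>2 \<le> L * a"
      using that unfolding \<Phi>_def fst_conv snd_conv a_def[symmetric] by linarith
    then have "\<alpha> * a\<^sup>2 \<le> L * a" using zero_le_power2[of "norm (x - x\<^sub>0)"] by linarith
    then have "a * (\<alpha> * a) \<le> a * L" by (simp add: power2_eq_square algebra_simps)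
    then have aL: "\<alpha> * a \<le> L" using \<open>a \<ge> 0\<close> L(1) by (cases "a = 0") auto
    then show "\<alpha> * norm (x - y) \<le> L" by (simp add: a_def)
    have "\<alpha> * r > L" using \<alpha>(1) r(1) by (simp add: field_simps)
    then have "\<alpha> * a < \<alpha> * r" using aL by simp
    then show "norm (x - y) < r" using \<alpha>(3) by (simp add: a_def)
    have "\<alpha> * (norm (x - x\<^sub>0))\<^sup>2 \<le> \<alpha> * (L * a)"
      using le \<alpha>(3) zero_le_power2[of a] by (intro mult_left_mono) (auto intro: order_trans[rotated])
    also have "\<dots> \<le> L * L" using aL L(1) by (metis less_imp_le mult.left_commute mult_left_mono)
    also have "\<dots> < \<alpha> * r\<^sup>2" using \<alpha>(2) r(1) by (simp add: field_simps power2_eq_square)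
    finally have "(norm (x - x\<^sub>0))\<^sup>2 < r\<^sup>2" using \<alpha>(3) by simp
    then show "norm (x - x\<^sub>0) < r" using r(1) by (metis less_imp_le power_less_imp_less_base)
  qed
  have cont: "continuous_on UNIV \<Phi>"
    unfolding \<Phi>_def
    by (intro continuous_on_diff continuous_on_mult continuous_on_const continuous_on_norm continuous_on_power
        continuous_on_compose2[OF cv continuous_on_fst[OF continuous_on_id]]
        continuous_on_compose2[OF continuous_on_component[OF V] continuous_on_snd[OF continuous_on_id]]
        continuous_on_fst continuous_on_snd continuous_on_id) auto
  have bdd: "bounded {z \<in> UNIV. \<Phi> z \<ge> \<Phi> (x\<^sub>0, x\<^sub>0)}"
  proof (rule bounded_subset)
    show "bounded (cball x\<^sub>0 r \<times> cball x\<^sub>0 (2 * r))" by (intro bounded_Times bounded_cball)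
    show "{z \<in> UNIV. \<Phi> z \<ge> \<Phi> (x\<^sub>0, x\<^sub>0)} \<subseteq> cball x\<^sub>0 r \<times> cball x\<^sub>0 (2 * r)"
    proof clarify
      fix x y assume "\<Phi> (x\<^sub>0, x\<^sub>0) \<le> \<Phi> (x, y)"
      then have "norm (x - y) < r" "norm (x - x\<^sub>0) < r" using small \<Phi>0 by auto
      moreover have "norm (y - x\<^sub>0) \<le> norm (x - y) + norm (x - x\<^sub>0)"
        using norm_triangle_ineq[of "y - x" "x - x\<^sub>0"] by (simp add: norm_minus_commute)
      ultimately show "x \<in> cball x\<^sub>0 r \<and> y \<in> cball x\<^sub>0 (2 * r)"
        by (simp add: dist_norm norm_minus_commute)
    qed
  qed
  obtain z where max': "\<And>z'. z' \<in> UNIV \<Longrightarrow> \<Phi> z' \<le> \<Phi> z"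
    by (rule coercive_attains_max[where \<Phi> = \<Phi>, OF closed_UNIV cont UNIV_I bdd]) (rule that)
  obtain x y where z: "z = (x, y)" by force
  have max: "\<Phi> (x', y') \<le> \<Phi> (x, y)" for x' y' using max' by (simp add: z)
  note sm = small[OF max[of x\<^sub>0 x\<^sub>0, unfolded \<Phi>0]]
  define p where "p = \<alpha> *\<^sub>R (2 *\<^sub>R (x - y))"
  define p' where "p' = p + 2 *\<^sub>R (x - x\<^sub>0)"
  have "H i x ((1 / \<mu>) *\<^sub>R (\<alpha> *\<^sub>R (2 *\<^sub>R (x - y)) + 2 *\<^sub>R (x - x\<^sub>0))) + (D *v v x) $ i \<le> 0"
  proof (rule stationary_subsolution_test[OF sub C1_with_gradient_cmult[OF C1_with_gradient_add[OF
          C1_with_gradient_cmult[OF C1_with_gradient_norm_sq] C1_with_gradient_norm_sq]]])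
    fix x'
    have "\<mu> * (v x' $ i - 1 / \<mu> * (\<alpha> * (norm (x' - y))\<^sup>2 + (norm (x' - x\<^sub>0))\<^sup>2))
        \<le> \<mu> * (v x $ i - 1 / \<mu> * (\<alpha> * (norm (x - y))\<^sup>2 + (norm (x - x\<^sub>0))\<^sup>2))"
      using max[of x' y] \<mu>(1) by (simp add: \<Phi>_def right_diff_distrib)
    then show "v x' $ i - 1 / \<mu> * (\<alpha> * (norm (x' - y))\<^sup>2 + (norm (x' - x\<^sub>0))\<^sup>2)
        \<le> v x $ i - 1 / \<mu> * (\<alpha> * (norm (x - y))\<^sup>2 + (norm (x - x\<^sub>0))\<^sup>2)"
      using \<mu>(1) by simp
  qed
  then have sub': "H i x ((1 / \<mu>) *\<^sub>R p') + (D *v v x) $ i \<le> 0" by (simp add: p'_def p_def)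
  have "H i x ((1 - \<mu>) *\<^sub>R 0 + \<mu> *\<^sub>R ((1 / \<mu>) *\<^sub>R p')) \<le> (1 - \<mu>) * H i x 0 + \<mu> * H i x ((1 / \<mu>) *\<^sub>R p')"
    using \<mu> by (intro convex_onD[OF convex_H]) auto
  moreover have "\<mu> * H i x ((1 / \<mu>) *\<^sub>R p') \<le> \<mu> * (- (D *v v x) $ i)"
    using sub' \<mu>(1) by (intro mult_left_mono) auto
  ultimately have sub'': "H i x p' + \<mu> * (D *v v x) $ i \<le> (1 - \<mu>) * H i x 0" using \<mu>(1) by simp
  have "H i y (- \<alpha> *\<^sub>R (2 *\<^sub>R (y - x))) + (D *v V y) $ i \<ge> 0"
  proof (rule stationary_supersolution_test[OF super C1_with_gradient_cmult[OF C1_with_gradient_norm_sq]])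
    fix y'
    show "V y $ i - - \<alpha> * (norm (y - x))\<^sup>2 \<le> V y' $ i - - \<alpha> * (norm (y' - x))\<^sup>2"
      using max[of x y'] by (simp add: \<Phi>_def norm_minus_commute[of x])
  qed
  moreover have "- \<alpha> *\<^sub>R (2 *\<^sub>R (y - x)) = p" by (simp add: p_def algebra_simps)
  ultimately have super': "H i y p + (D *v V y) $ i \<ge> 0" by simp
  have "norm p = 2 * (\<alpha> * norm (x - y))" using \<alpha>(3) by (simp add: p_def)
  then have p: "norm p \<le> 2 * L" using sm(1) by simp
  have "norm p' \<le> norm p + norm (2 *\<^sub>R (x - x\<^sub>0))" unfolding p'_def by (rule norm_triangle_ineq)
  then have p': "norm p' \<le> 2 * L + 2" using p sm(3) r(2) by simp
  have "dist p' p = 2 * norm (x - x\<^sub>0)" by (simp add: p'_def dist_norm)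
  then have "\<bar>H i x p' - H i y p\<bar> < \<kappa>"
    using p p' sm r by (intro d(2)) (auto simp: dist_norm)
  moreover have "q (x, y) > \<kappa>"
  proof (rule \<delta>(2))
    have "norm (y - x\<^sub>0) \<le> norm (x - y) + norm (x - x\<^sub>0)"
      using norm_triangle_ineq[of "y - x" "x - x\<^sub>0"] by (simp add: norm_minus_commute)
    moreover have "dist (x, y) (x\<^sub>0, x\<^sub>0) \<le> norm (x - x\<^sub>0) + norm (y - x\<^sub>0)"
      unfolding dist_prod_def fst_conv snd_conv dist_norm by (rule sqrt_sum_squares_le_sum) auto
    ultimately show "dist (x, y) (x\<^sub>0, x\<^sub>0) < \<delta>" using sm r by linarith
  qed
  ultimately show False
    using sub'' super' unfolding q_def matrix_vector_mult_def by simp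
qed

text \<open>At a joint maximum of \<mu> times \<open>v\<close> minus \<open>V\<close>, the doubling
  estimate and the maximum principle squeeze the coupling term between zero and a nonpositive
  multiple of the Hamiltonian at slope zero. Irreducibility then makes every component maximal, so
  every \<open>H j z 0\<close> vanishes and the maximum lies where the ordering is assumed.\<close>

lemma stationary_comparison:
  assumes sub: "stationary_subsolution H D v" and v: "torus_fun v" "continuous_on UNIV v"
    and super: "stationary_supersolution H D V" and V: "torus_fun V" "continuous_on UNIV V"
    and zero: "\<And>x i. (\<And>j. H j x 0 = 0) \<Longrightarrow> v x $ i \<le> V x $ i"
  shows "v x $ i \<le> V x $ i"
proof -
  obtain L where L: "L > 0" "\<And>x y i. v x $ i - v y $ i \<le> L * norm (x - y)"
    using stationary_subsolution_lipschitz[OF sub v] by blast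
  obtain B where B: "B > 0" "\<And>x. norm (v x) \<le> B" using torus_continuous_bounded[OF v] by blast
  have vB: "\<bar>v x $ i\<bar> \<le> B" for x i using component_le_norm_cart[of "v x" i] B(2)[of x] by simp
  \<comment> \<open>The allowance \<open>(1 - \<mu>) * B\<close> pays for replacing \<open>v\<close>
    by its multiple at points where \<open>v\<close> is already known to lie below
    \<open>V\<close>.\<close>
  have claim: "\<mu> * v x $ i - V x $ i \<le> (1 - \<mu>) * B" if \<mu>: "0 < \<mu>" "\<mu> < 1" for \<mu> x i
  proof (rule ccontr)
    assume neg: "\<not> ?thesis"
    define \<Phi> where "\<Phi> j y = \<mu> * v y $ j - V y $ j" for j y
    obtain y where y: "y \<in> cbox 0 1" "v y = v x" "V y = V x"
      using torus_representative[of x] v(1) V(1) unfolding torus_fun_def by metis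
    have cont: "continuous_on (cbox 0 1) (\<Phi> j)" for j
      unfolding \<Phi>_def by (intro continuous_intros continuous_on_subset[OF v(2)] continuous_on_subset[OF V(2)]) auto
    have bdd: "bounded {z \<in> cbox 0 1. \<Phi> j z \<ge> \<Phi> i y}" for j
      by (rule bounded_subset[OF bounded_cbox[of 0 1]]) auto
    obtain k z where z: "z \<in> cbox 0 1" and max_box: "\<And>j y. y \<in> cbox 0 1 \<Longrightarrow> \<Phi> j y \<le> \<Phi> k z"
      by (rule family_attains_max[where \<Phi> = \<Phi> and i\<^sub>0 = i, OF closed_cbox cont y(1) bdd]) (rule that)
    have max: "\<Phi> j y \<le> \<Phi> k z" for j y
    proof -
      obtain y' where "y' \<in> cbox 0 1" "v y' = v y" "V y' = V y"
        using torus_representative[of y] v(1) V(1) unfolding torus_fun_def by metis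
      then show ?thesis using max_box[of y' j] by (simp add: \<Phi>_def)
    qed
    have big: "\<Phi> k z > (1 - \<mu>) * B" using max_box[OF y(1), of i] neg y by (simp add: \<Phi>_def)
    define r where "r = \<mu> *\<^sub>R v z - V z"
    have r: "r $ j = \<Phi> j z" for j by (simp add: r_def \<Phi>_def)
    have D: "(D *v r) $ j \<le> (1 - \<mu>) * H j z 0" if "\<Phi> j z = \<Phi> k z" for j
      unfolding r_def using max[of j] that
      by (intro stationary_doubling[OF sub super L V(2) \<mu>]) (simp add: \<Phi>_def)
    have H0: "(1 - \<mu>) * H j z 0 \<le> 0" for j using \<mu>(2) H_0_le[of j z] by (simp add: mult_nonneg_nonpos)
    have "{j. \<Phi> j z = \<Phi> k z} = UNIV"
    proof (rule irreducible_matrix_closed_UNIV[OF irreducible])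
      fix j l assume "j \<in> {j. \<Phi> j z = \<Phi> k z}" and "D $ j $ l \<noteq> 0"
      then have j: "\<Phi> j z = \<Phi> k z" by simp
      then have "r $ l \<le> r $ j" for l using max[of l z] by (simp add: r)
      from monotone_matrix_mult_ge_0(2)[OF monotone this, of l, OF _ \<open>D $ j $ l \<noteq> 0\<close>]
      show "l \<in> {j. \<Phi> j z = \<Phi> k z}" using D[OF j] H0[of j] j by (simp add: r)
    qed auto
    then have all: "\<Phi> j z = \<Phi> k z" for j by auto
    have "H j z 0 = 0" for j
    proof -
      have "(D *v r) $ j \<ge> 0" by (rule mult_D_ge_0) (metis r all order_refl)
      then have "(1 - \<mu>) * H j z 0 = 0" using D[OF all, of j] H0[of j] by linarith
      then show ?thesis using \<mu>(2) by simp
    qed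
    then have "v z $ k \<le> V z $ k" by (rule zero)
    then have "\<Phi> k z \<le> (1 - \<mu>) * (- v z $ k)" by (simp add: \<Phi>_def algebra_simps)
    also have "\<dots> \<le> (1 - \<mu>) * B" using vB[of z k] \<mu>(2) by (intro mult_left_mono) (auto simp: abs_le_iff)
    finally show False using big by simp
  qed
  show ?thesis
  proof (rule field_le_epsilon)
    fix e :: real assume "e > 0"
    \<comment> \<open>\<nu> stands for 1 - \<mu>; the errors from the claim and from restoring the
      factor are each at most \<open>\<nu> * B\<close>.\<close>
    define \<nu> where "\<nu> = min (1 / 2) (e / (2 * B))"
    have \<nu>: "0 < \<nu>" "\<nu> < 1" "\<nu> \<le> e / (2 * B)" using \<open>e > 0\<close> B(1) by (auto simp: \<nu>_def)
    have "v x $ i - V x $ i = ((1 - \<nu>) * v x $ i - V x $ i) + \<nu> * v x $ i" by (simp add: algebra_simps)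
    also have "\<dots> \<le> \<nu> * B + \<nu> * B"
      using claim[of "1 - \<nu>" x i] \<nu> vB[of x i] by (intro add_mono mult_left_mono) (auto simp: abs_le_iff)
    also have "\<dots> \<le> e" using \<nu>(3) B(1) by (simp add: field_simps)
    finally show "v x $ i \<le> V x $ i + e" by simp
  qed
qed

end

subsection \<open>Bounds and moduli of continuity for the evolution\<close>

text \<open>The steep exponential \<open>\<theta>\<close> keeps the maximum away from the terminal time, its positive slope
  makes the inequalities strict.\<close>

lemma exponential_penalty:
  assumes "\<sigma> > 0" and "B > 0"
  obtains \<theta> \<theta>' :: "real \<Rightarrow> real" where "\<And>t. (\<theta> has_real_derivative \<theta>' t) (at t)"
    "\<And>A. continuous_on A \<theta>'" "\<And>A. continuous_on A \<theta>" "\<And>t. \<theta>' t > 0" "\<And>t. \<theta> t > 0" "\<theta> t\<^sub>1 = \<sigma>" "\<theta> (t\<^sub>1 + 1) \<ge> B"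
proof -
  have "B / \<sigma> > 0" using assms by simp
  \<comment> \<open>The rate \<open>B / \<sigma>\<close> suffices because the exponential exceeds
    its argument.\<close>
  define \<theta> where "\<theta> t = \<sigma> * exp (B / \<sigma> * (t - t\<^sub>1))" for t
  define \<theta>' where "\<theta>' t = \<sigma> * (exp (B / \<sigma> * (t - t\<^sub>1)) * (B / \<sigma>))" for t
  have "\<sigma> * (B / \<sigma>) \<le> \<sigma> * exp (B / \<sigma>)"
    using assms by (intro mult_left_mono less_imp_le[OF exp_gt_self]) auto
  then have "\<theta> (t\<^sub>1 + 1) \<ge> B" using assms by (simp add: \<theta>_def)
  moreover have "(\<theta> has_real_derivative \<theta>' t) (at t)" for t
    unfolding \<theta>_def \<theta>'_def by (auto intro!: derivative_eq_intros)
  moreover have "continuous_on A \<theta>'" "continuous_on A \<theta>" for A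
    unfolding \<theta>'_def \<theta>_def by (intro continuous_intros)+
  moreover have "\<theta>' t > 0" "\<theta> t > 0" for t unfolding \<theta>'_def \<theta>_def using assms by simp_all
  moreover have "\<theta> t\<^sub>1 = \<sigma>" by (simp add: \<theta>_def)
  ultimately show thesis using that by blast
qed

locale evolution = normalized_system H D
  for H :: "'m::finite \<Rightarrow> real ^ 'n \<Rightarrow> real ^ 'n \<Rightarrow> real" and D :: "real ^ 'm ^ 'm" +
  fixes w :: "real ^ 'n \<Rightarrow> real \<Rightarrow> real ^ 'm"
  assumes torus_w: "\<And>t. t \<ge> 0 \<Longrightarrow> torus_fun (\<lambda>x. w x t)"
    and cont_w: "continuous_on (UNIV \<times> {0..}) (\<lambda>(x, t). w x t)"
    and sub_w: "evolution_subsolution H D w"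
    and super_w: "evolution_supersolution H D w"
begin

section \<open>Bounds that are uniform in time\<close>

lemma locally_bounded:
  obtains B where "B > 0" "\<And>x t i. 0 \<le> t \<Longrightarrow> t \<le> T \<Longrightarrow> \<bar>w x t $ i\<bar> \<le> B"
proof -
  have "continuous_on (UNIV \<times> {0..T}) (\<lambda>(x, t). w x t)"
    by (rule continuous_on_subset[OF cont_w]) auto
  then obtain B where B: "B > 0" "\<And>x t. t \<in> {0..T} \<Longrightarrow> norm (w x t) \<le> B"
    using torus_compact_bounded[of "{0..T}" w] torus_w compact_Icc atLeastAtMost_iff by metis
  have "\<bar>w x t $ i\<bar> \<le> B" if "0 \<le> t" "t \<le> T" for x t i
    using B(2)[of t x] component_le_norm_cart[of "w x t" i] that by simp
  then show thesis using B(1) that by blast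
qed

text \<open>At a joint maximum of \<open>w\<close> minus cone and penalty, the coupling term is
  nonnegative and the penalty slope positive. Off the vertex, coercivity makes the Hamiltonian
  positive as well; at the vertex, where the cone is not differentiable, restriction to the time
  axis removes the Hamiltonian. Both cases contradict the subsolution inequality.\<close>

lemma bounded_above:
  obtains C where "\<And>x t i. t \<ge> 0 \<Longrightarrow> w x t $ i \<le> C"
proof -
  obtain x\<^sub>0 where x0: "\<And>i. H i x\<^sub>0 0 = 0" using ex_zero by blast
  obtain K where K: "K > 0" "\<And>i x p. norm p \<ge> K \<Longrightarrow> H i x p \<ge> 1" using coercive_all by blast
  obtain C where C: "C > 0" "\<And>x t i. 0 \<le> t \<Longrightarrow> t \<le> 0 \<Longrightarrow> \<bar>w x t $ i\<bar> \<le> C"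
    using locally_bounded by blast
  have cone: "w x\<^sub>1 t\<^sub>1 $ i\<^sub>1 \<le> C + K * norm (x\<^sub>1 - x\<^sub>0)" if "t\<^sub>1 \<ge> 0" for x\<^sub>1 t\<^sub>1 i\<^sub>1
  proof (rule ccontr)
    \<comment> \<open>Half of the excess: after the penalty \<sigma> at time
      \<open>t\<^sub>1\<close> the maximum still exceeds the initial bound \<open>C\<close>.\<close>
    define \<sigma> where "\<sigma> = (w x\<^sub>1 t\<^sub>1 $ i\<^sub>1 - (C + K * norm (x\<^sub>1 - x\<^sub>0))) / 2"
    assume "\<not> ?thesis"
    then have "\<sigma> > 0" by (simp add: \<sigma>_def)
    obtain B where B: "B > 0" "\<And>x t i. 0 \<le> t \<Longrightarrow> t \<le> t\<^sub>1 + 1 \<Longrightarrow> \<bar>w x t $ i\<bar> \<le> B"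
      using locally_bounded by blast
    obtain \<theta> \<theta>' where \<theta>: "\<And>t. (\<theta> has_real_derivative \<theta>' t) (at t)" "\<And>A. continuous_on A \<theta>'"
      "\<And>A. continuous_on A \<theta>" "\<And>t. \<theta>' t > 0" "\<And>t. \<theta> t > 0" "\<theta> t\<^sub>1 = \<sigma>" "\<theta> (t\<^sub>1 + 1) \<ge> B"
      using exponential_penalty[OF \<open>\<sigma> > 0\<close> \<open>B > 0\<close>] by metis
    define X where "X = (UNIV :: (real ^ 'n) set) \<times> {0..t\<^sub>1 + 1}"
    define \<Phi> where "\<Phi> i z = (case z of (x, t) \<Rightarrow> w x t $ i) - K * norm (fst z - x\<^sub>0) - \<theta> (snd z)" for i z
    have \<Phi>: "\<Phi> i (x, t) = w x t $ i - K * norm (x - x\<^sub>0) - \<theta> t" for i x t by (simp add: \<Phi>_def)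
    have "continuous_on X (\<lambda>z. \<theta> (snd z))"
      by (rule continuous_on_compose2[OF \<theta>(3)[of UNIV] continuous_on_snd[OF continuous_on_id]]) auto
    then have cont: "continuous_on X (\<Phi> i)" for i
      unfolding \<Phi>_def
      by (intro continuous_on_diff continuous_on_UNIV_Times_component[OF cont_w]
          continuous_intros) (auto simp: X_def)
    have mem: "(x\<^sub>1, t\<^sub>1) \<in> X" and closed: "closed X" using that by (auto simp: X_def intro!: closed_Times)
    have bdd: "bounded {z \<in> X. \<Phi> i z \<ge> \<Phi> i\<^sub>1 (x\<^sub>1, t\<^sub>1)}" for i
    proof (rule bounded_subset)
      show "bounded (cball x\<^sub>0 ((B - \<Phi> i\<^sub>1 (x\<^sub>1, t\<^sub>1)) / K) \<times> {0..t\<^sub>1 + 1})"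
        by (intro bounded_Times bounded_cball bounded_closed_interval)
      show "{z \<in> X. \<Phi> i z \<ge> \<Phi> i\<^sub>1 (x\<^sub>1, t\<^sub>1)} \<subseteq> cball x\<^sub>0 ((B - \<Phi> i\<^sub>1 (x\<^sub>1, t\<^sub>1)) / K) \<times> {0..t\<^sub>1 + 1}"
      proof (clarsimp simp: X_def)
        fix x t assume "\<Phi> i (x, t) \<ge> \<Phi> i\<^sub>1 (x\<^sub>1, t\<^sub>1)" and t: "0 \<le> t" "t \<le> t\<^sub>1 + 1"
        then have "K * norm (x - x\<^sub>0) \<le> B - \<Phi> i\<^sub>1 (x\<^sub>1, t\<^sub>1)"
          using B(2)[OF t, of x i] \<theta>(5)[of t] unfolding \<Phi>[of i] by linarith
        then show "dist x\<^sub>0 x \<le> (B - \<Phi> i\<^sub>1 (x\<^sub>1, t\<^sub>1)) / K"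
          using K(1) by (simp add: dist_norm norm_minus_commute field_simps)
      qed
    qed
    obtain i z where z: "z \<in> X" and z_max: "\<And>j y. y \<in> X \<Longrightarrow> \<Phi> j y \<le> \<Phi> i z"
      by (rule family_attains_max[where \<Phi> = \<Phi> and i\<^sub>0 = i\<^sub>1, OF closed cont mem bdd]) (rule that)
    obtain x t where zxt: "z = (x, t)" by force
    have "\<Phi> i\<^sub>1 (x\<^sub>1, t\<^sub>1) \<le> \<Phi> i (x, t)" using z_max[OF \<open>(x\<^sub>1, t\<^sub>1) \<in> X\<close>] zxt by simp
    moreover have "\<Phi> i\<^sub>1 (x\<^sub>1, t\<^sub>1) > C" using \<open>\<sigma> > 0\<close> unfolding \<Phi> \<theta>(6) by (simp add: \<sigma>_def field_simps)
    ultimately have big: "w x t $ i > C + K * norm (x - x\<^sub>0) + \<theta> t" by (simp add: \<Phi>)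
    have Kn: "K * norm (x - x\<^sub>0) \<ge> 0" using K(1) by simp
    have t: "0 \<le> t" "t \<le> t\<^sub>1 + 1" using z by (auto simp: X_def zxt)
    have "t \<noteq> 0" using C(2)[of 0 x i] big \<theta>(5)[of t] Kn by fastforce
    moreover have "t \<noteq> t\<^sub>1 + 1" using B(2)[OF t, of x i] big \<theta>(7) Kn C(1) by fastforce
    ultimately have t': "0 < t" "t < t\<^sub>1 + 1" using t by auto
    have "(D *v w x t) $ i \<ge> 0"
    proof (rule mult_D_ge_0)
      show "w x t $ j \<le> w x t $ i" for j using z_max[OF z, of j] by (simp add: zxt \<Phi>)
    qed
    moreover have "\<theta>' t > 0" by (rule \<theta>(4))
    moreover have max: "w y s $ i - K * norm (y - x\<^sub>0) - \<theta> s \<le> w x t $ i - K * norm (x - x\<^sub>0) - \<theta> t"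
      if "\<bar>s - t\<bar> < t\<^sub>1 + 1 - t" "s > 0" for y s
      using z_max[of "(y, s)" i] that by (auto simp: zxt \<Phi> X_def)
    moreover have "x = x\<^sub>0"
    proof (rule ccontr)
      assume "x \<noteq> x\<^sub>0"
      then obtain p where "norm p = K" "\<theta>' t + H i x p + (D *v w x t) $ i \<le> 0"
        using evolution_subsolution_cone[OF sub_w _ _ \<theta>(1,2) t'(1) _ max] K(1) t'(2)
        by (metis diff_gt_0_iff_gt less_imp_le)
      then show False using K(2)[of p i x] \<theta>(4)[of t] \<open>(D *v w x t) $ i \<ge> 0\<close> by linarith
    qed
    moreover have "\<theta>' t + (D *v w x\<^sub>0 t) $ i \<le> 0"
      by (rule evolution_subsolution_restrict[OF sub_w cont_w H_ge cont_H_0 x0 \<theta>(1,2) t'(1), of "t\<^sub>1 + 1 - t"])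
        (use max[of _ x\<^sub>0] t' \<open>x = x\<^sub>0\<close> in auto)
    ultimately show False by simp
  qed
  obtain R where R: "\<And>y. y \<in> cbox (0::real^'n) 1 \<Longrightarrow> norm (y - x\<^sub>0) \<le> R"
  proof -
    have "compact ((\<lambda>y. y - x\<^sub>0) ` cbox (0::real^'n) 1)"
      by (intro compact_continuous_image continuous_intros compact_cbox)
    then show thesis using that by (metis bounded_pos compact_imp_bounded imageI)
  qed
  show thesis
  proof (rule that)
    fix x t i assume "(t::real) \<ge> 0"
    obtain y where y: "y \<in> cbox 0 1" "w y t = w x t"
      using torus_fun_ex_box[OF torus_w[OF \<open>t \<ge> 0\<close>], of x] by blast
    have "K * norm (y - x\<^sub>0) \<le> K * R" using R[OF y(1)] K(1) by simp
    then show "w x t $ i \<le> C + K * R"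
      using cone[OF \<open>t \<ge> 0\<close>, of y i] y(2) by simp
  qed
qed

lemma bounded_below:
  obtains C where "\<And>x t i. t \<ge> 0 \<Longrightarrow> w x t $ i \<ge> C"
proof -
  obtain C where C: "C > 0" "\<And>x t i. 0 \<le> t \<Longrightarrow> t \<le> 0 \<Longrightarrow> \<bar>w x t $ i\<bar> \<le> C"
    using locally_bounded by blast
  have "w x\<^sub>1 t\<^sub>1 $ i\<^sub>1 \<ge> - C" if "t\<^sub>1 \<ge> 0" for x\<^sub>1 t\<^sub>1 i\<^sub>1
  proof (rule ccontr)
    define \<sigma> where "\<sigma> = (- C - w x\<^sub>1 t\<^sub>1 $ i\<^sub>1) / 2"
    assume "\<not> ?thesis"
    then have "\<sigma> > 0" by (simp add: \<sigma>_def)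
    obtain B where B: "B > 0" "\<And>x t i. 0 \<le> t \<Longrightarrow> t \<le> t\<^sub>1 + 1 \<Longrightarrow> \<bar>w x t $ i\<bar> \<le> B"
      using locally_bounded by blast
    obtain \<theta> \<theta>' where \<theta>: "\<And>t. (\<theta> has_real_derivative \<theta>' t) (at t)" "\<And>A. continuous_on A \<theta>'"
      "\<And>A. continuous_on A \<theta>" "\<And>t. \<theta>' t > 0" "\<And>t. \<theta> t > 0" "\<theta> t\<^sub>1 = \<sigma>" "\<theta> (t\<^sub>1 + 1) \<ge> B"
      using exponential_penalty[OF \<open>\<sigma> > 0\<close> \<open>B > 0\<close>] by metis
    define X where "X = cbox (0 :: real ^ 'n) 1 \<times> {0..t\<^sub>1 + 1}"
    define \<Phi> where "\<Phi> i z = - (case z of (x, t) \<Rightarrow> w x t $ i) - \<theta> (snd z)" for i z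
    have \<Phi>: "\<Phi> i (x, t) = - w x t $ i - \<theta> t" for i x t by (simp add: \<Phi>_def)
    obtain y\<^sub>1 where y1: "y\<^sub>1 \<in> cbox 0 1" "w y\<^sub>1 t\<^sub>1 = w x\<^sub>1 t\<^sub>1"
      using torus_fun_ex_box[OF torus_w[OF \<open>t\<^sub>1 \<ge> 0\<close>], of x\<^sub>1] by blast
    have "compact X" unfolding X_def by (intro compact_Times compact_cbox compact_Icc)
    have "continuous_on X (\<lambda>z. \<theta> (snd z))"
      by (rule continuous_on_compose2[OF \<theta>(3)[of UNIV] continuous_on_snd[OF continuous_on_id]]) auto
    then have cont: "continuous_on X (\<Phi> i)" for i
      unfolding \<Phi>_def
      by (intro continuous_on_diff continuous_on_minus continuous_on_UNIV_Times_component[OF cont_w]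
          continuous_intros) (auto simp: X_def)
    have mem: "(y\<^sub>1, t\<^sub>1) \<in> X" and closed: "closed X"
      using that y1 \<open>compact X\<close> by (auto simp: X_def compact_imp_closed)
    have bdd: "bounded {z \<in> X. \<Phi> i z \<ge> \<Phi> i\<^sub>1 (y\<^sub>1, t\<^sub>1)}" for i
      by (rule bounded_subset[OF compact_imp_bounded[OF \<open>compact X\<close>]]) auto
    obtain i z where z: "z \<in> X" and z_max: "\<And>j y. y \<in> X \<Longrightarrow> \<Phi> j y \<le> \<Phi> i z"
      by (rule family_attains_max[where \<Phi> = \<Phi> and i\<^sub>0 = i\<^sub>1, OF closed cont mem bdd]) (rule that)
    obtain x t where zxt: "z = (x, t)" by force
    have "\<Phi> i\<^sub>1 (y\<^sub>1, t\<^sub>1) \<le> \<Phi> i (x, t)" using z_max[OF \<open>(y\<^sub>1, t\<^sub>1) \<in> X\<close>] zxt by simp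
    moreover have "\<Phi> i\<^sub>1 (y\<^sub>1, t\<^sub>1) > C" using \<open>\<sigma> > 0\<close> y1(2) unfolding \<Phi> \<theta>(6) by (simp add: \<sigma>_def field_simps)
    ultimately have big: "- w x t $ i > C + \<theta> t" by (simp add: \<Phi>)
    have t: "0 \<le> t" "t \<le> t\<^sub>1 + 1" using z by (auto simp: X_def zxt)
    have "t \<noteq> 0" using C(2)[of 0 x i] big \<theta>(5)[of t] by fastforce
    moreover have "t \<noteq> t\<^sub>1 + 1" using B(2)[OF t, of x i] big \<theta>(7) C(1) by fastforce
    ultimately have t': "0 < t" "t < t\<^sub>1 + 1" using t by auto
    have "(D *v w x t) $ i \<le> 0"
    proof (rule mult_D_le_0)
      show "w x t $ i \<le> w x t $ j" for j using z_max[OF z, of j] by (simp add: zxt \<Phi>)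
    qed
    moreover have "\<theta>' t > 0" by (rule \<theta>(4))
    moreover have "- \<theta>' t + H i x (- 0) + (D *v w x t) $ i \<ge> 0"
    proof (rule evolution_supersolution_test[OF super_w _ \<theta>(1,2) t'(1)])
      show "C1_with_gradient UNIV (\<lambda>x. 0) (\<lambda>x :: real ^ 'n. 0)"
        by (rule C1_with_gradient_const)
      show "t\<^sub>1 + 1 - t > 0" using t' by simp
      fix y s assume "\<bar>s - t\<bar> < t\<^sub>1 + 1 - t" "s > 0"
      then have s: "s \<in> {0..t\<^sub>1 + 1}" by auto
      obtain y' where y': "y' \<in> cbox 0 1" "w y' s = w y s"
        using torus_fun_ex_box[OF torus_w, of s y] s by auto
      then show "w x t $ i + 0 + \<theta> t \<le> w y s $ i + 0 + \<theta> s"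
        using z_max[of "(y', s)" i] s by (auto simp: X_def zxt \<Phi>)
    qed
    ultimately show False using H_0_le[of i x] by simp
  qed
  then show thesis using that by blast
qed

lemma bounded:
  obtains B where "B > 0" "\<And>x t i. t \<ge> 0 \<Longrightarrow> \<bar>w x t $ i\<bar> \<le> B"
proof -
  obtain C where C: "\<And>x t i. t \<ge> 0 \<Longrightarrow> w x t $ i \<le> C" using bounded_above by blast
  obtain C' where C': "\<And>x t i. t \<ge> 0 \<Longrightarrow> w x t $ i \<ge> C'" using bounded_below by blast
  have "\<bar>w x t $ i\<bar> \<le> \<bar>C\<bar> + \<bar>C'\<bar> + 1" if "t \<ge> 0" for x t i
    using C[OF that, of x i] C'[OF that, of x i] by linarith
  then show thesis using that[of "\<bar>C\<bar> + \<bar>C'\<bar> + 1"] by auto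
qed

lemma mult_D_bounded:
  obtains C where "C > 0" "\<And>x t i. t \<ge> 0 \<Longrightarrow> \<bar>(D *v w x t) $ i\<bar> \<le> C"
proof -
  obtain B where B: "B > 0" "\<And>x t i. t \<ge> 0 \<Longrightarrow> \<bar>w x t $ i\<bar> \<le> B" using bounded by blast
  define C where "C = (\<Sum>i\<in>UNIV. \<Sum>j\<in>UNIV. \<bar>D $ i $ j\<bar> * B)"
  have bound: "\<bar>(D *v w x t) $ i\<bar> \<le> C" if "t \<ge> 0" for x t i
  proof -
    have "\<bar>(D *v w x t) $ i\<bar> \<le> (\<Sum>j\<in>UNIV. \<bar>D $ i $ j * w x t $ j\<bar>)"
      by (simp add: matrix_vector_mult_def sum_abs)
    also have "\<dots> \<le> (\<Sum>j\<in>UNIV. \<bar>D $ i $ j\<bar> * B)"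
      unfolding abs_mult using B(2)[OF that] by (intro sum_mono mult_left_mono) auto
    also have "\<dots> \<le> C"
      unfolding C_def using B(1)
      by (intro member_le_sum[of i UNIV "\<lambda>i. \<Sum>j\<in>UNIV. \<bar>D $ i $ j\<bar> * B"] sum_nonneg) auto
    finally show ?thesis .
  qed
  have "\<bar>(D *v w x t) $ i\<bar> \<le> \<bar>C\<bar> + 1" if "t \<ge> 0" for x t i
    by (rule order_trans[OF bound[OF that]]) simp
  then show thesis by (intro that[of "\<bar>C\<bar> + 1"]) auto
qed

section \<open>Equicontinuity in time and in space\<close>

lemma uniformly_continuous_upto:
  assumes "e > 0"
  obtains d where "d > 0" "\<And>x y s t i. 0 \<le> s \<Longrightarrow> s \<le> T \<Longrightarrow> 0 \<le> t \<Longrightarrow> t \<le> T \<Longrightarrow> norm (x - y) < d \<Longrightarrow>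
    \<bar>s - t\<bar> < d \<Longrightarrow> \<bar>w x s $ i - w y t $ i\<bar> < e"
proof -
  have "continuous_on (UNIV \<times> {0..T}) (\<lambda>(x, t). w x t)"
    by (rule continuous_on_subset[OF cont_w]) auto
  then obtain d where d: "d > 0" "\<And>x y s t. s \<in> {0..T} \<Longrightarrow> t \<in> {0..T} \<Longrightarrow> dist x y < d \<Longrightarrow> dist s t < d
      \<Longrightarrow> dist (w x s) (w y t) < e"
    using torus_compact_uniformly_continuous[of "{0..T}" w e] torus_w compact_Icc atLeastAtMost_iff
      \<open>e > 0\<close> by metis
  show thesis
  proof
    fix x y :: "real ^ 'n" and i and s t :: real
    assume "0 \<le> s" "s \<le> T" "0 \<le> t" "t \<le> T" "norm (x - y) < d" "\<bar>s - t\<bar> < d"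
    then have "dist (w x s) (w y t) < e" by (intro d(2)) (auto simp: dist_norm)
    then show "\<bar>w x s $ i - w y t $ i\<bar> < e"
      using component_le_norm_cart[of "w x s - w y t" i] by (simp add: dist_norm)
  qed (rule d(1))
qed

text \<open>Doubling of variables with separate scales: for a fixed time penalty \<open>\<beta>\<close> the time slope is
  bounded, so coercivity bounds the spatial slope uniformly in the space penalty \<open>\<alpha>\<close>.\<close>

lemma contraction:
  assumes h: "h \<ge> 0" and k: "k \<ge> 0" and m: "\<And>x i. w x h $ i - w x k $ i \<le> m" and t1: "t\<^sub>1 \<ge> 0"
  shows "w x\<^sub>1 (t\<^sub>1 + h) $ i\<^sub>1 - w x\<^sub>1 (t\<^sub>1 + k) $ i\<^sub>1 \<le> m"
proof (rule ccontr)
  \<comment> \<open>A quarter of the excess: the linear penalty costs at most one \<gamma> at the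
    reference point, and the oscillation near the initial times is below another.\<close>
  define \<gamma> where "\<gamma> = (w x\<^sub>1 (t\<^sub>1 + h) $ i\<^sub>1 - w x\<^sub>1 (t\<^sub>1 + k) $ i\<^sub>1 - m) / 4"
  assume "\<not> ?thesis"
  then have "\<gamma> > 0" by (simp add: \<gamma>_def)
  define \<sigma> where "\<sigma> = \<gamma> / (t\<^sub>1 + 1)"
  have "\<sigma> > 0" using \<open>\<gamma> > 0\<close> t1 by (simp add: \<sigma>_def)
  have "\<sigma> * t\<^sub>1 \<le> \<gamma>" using \<open>\<gamma> > 0\<close> t1 by (simp add: \<sigma>_def field_simps)
  obtain y\<^sub>1 l where l: "\<forall>j. l $ j \<in> \<int>" and y1: "y\<^sub>1 = x\<^sub>1 + l" "y\<^sub>1 \<in> cbox 0 1"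
    using torus_representative by blast
  have w_y1: "w y\<^sub>1 t = w x\<^sub>1 t" if "t \<ge> 0" for t
    using torus_w[OF that] l by (simp add: y1(1) torus_fun_def)
  obtain B where B: "B > 0" "\<And>x t i. t \<ge> 0 \<Longrightarrow> \<bar>w x t $ i\<bar> \<le> B" using bounded by blast
  obtain C where C: "C > 0" "\<And>x t i. t \<ge> 0 \<Longrightarrow> \<bar>(D *v w x t) $ i\<bar> \<le> C" using mult_D_bounded by blast
  define c where "c = m + 4 * \<gamma> - \<sigma> * t\<^sub>1"
  \<comment> \<open>Wherever \<Psi> reaches \<open>c\<close>, the penalty \<open>P\<close> stays
    below \<open>Q\<close>. Hence the coefficients \<open>Q / d\<^sup>2\<close> in time and
    \<open>Q / r\<^sup>2\<close> in space confine the two points to distances \<open>d\<close> and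
    \<open>r\<close>.\<close>
  define Q where "Q = 2 * B - c + 1"
  have c_eq: "c = w x\<^sub>1 (t\<^sub>1 + h) $ i\<^sub>1 - w x\<^sub>1 (t\<^sub>1 + k) $ i\<^sub>1 - \<sigma> * t\<^sub>1" by (simp add: c_def \<gamma>_def field_simps)
  have "Q > 0"
    using B(2)[of "t\<^sub>1 + h" x\<^sub>1 i\<^sub>1] B(2)[of "t\<^sub>1 + k" x\<^sub>1 i\<^sub>1] h k t1 \<open>\<sigma> > 0\<close> mult_nonneg_nonneg[of \<sigma> t\<^sub>1]
    unfolding Q_def c_eq by linarith
  \<comment> \<open>This window is long enough, since the estimate is used only when
    \<open>t\<close> or \<open>s\<close> vanishes and then the other is below 1.\<close>
  obtain d\<^sub>0 where d0: "d\<^sub>0 > 0" "\<And>x y s t i. 0 \<le> s \<Longrightarrow> s \<le> h + k + 1 \<Longrightarrow> 0 \<le> t \<Longrightarrow> t \<le> h + k + 1 \<Longrightarrow>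
      norm (x - y) < d\<^sub>0 \<Longrightarrow> \<bar>s - t\<bar> < d\<^sub>0 \<Longrightarrow> \<bar>w x s $ i - w y t $ i\<bar> < \<gamma>"
    using uniformly_continuous_upto[OF \<open>\<gamma> > 0\<close>] by metis
  define d where "d = min 1 d\<^sub>0"
  have d: "d > 0" "d \<le> 1" "d \<le> d\<^sub>0" using d0(1) by (auto simp: d_def)
  define \<beta> where "\<beta> = Q / d\<^sup>2"
  have \<beta>: "\<beta> > 0" "\<beta> * d\<^sup>2 = Q" using \<open>Q > 0\<close> d(1) by (auto simp: \<beta>_def)
  \<comment> \<open>\<open>R\<close> depends on \<beta> but not on \<alpha>; this permits
    \<open>e\<close>, then \<open>r\<close>, and finally \<alpha> to be chosen after
    \<open>R\<close>, without any Lipschitz bound for \<open>w\<close>.\<close>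
  obtain R where R: "R > 0" "\<And>i x p. norm p \<ge> R \<Longrightarrow> H i x p \<ge> 2 * \<beta> * d + C" using coercive_all by blast
  obtain e where e: "e > 0" "\<And>i x y p q. norm p \<le> R \<Longrightarrow> norm q \<le> R \<Longrightarrow> dist x y < e \<Longrightarrow> dist p q < e \<Longrightarrow>
      \<bar>H i x p - H i y q\<bar> < \<sigma>"
    using H_uniformly_continuous[OF \<open>\<sigma> > 0\<close>] by metis
  define r where "r = min d e"
  have r: "r > 0" "r \<le> d" "r \<le> e" using d(1) e(1) by (auto simp: r_def)
  define \<alpha> where "\<alpha> = Q / r\<^sup>2"
  have \<alpha>: "\<alpha> > 0" "\<alpha> * r\<^sup>2 = Q" using \<open>Q > 0\<close> r(1) by (auto simp: \<alpha>_def)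
  define P where "P x y t s = \<alpha> * (norm (x - y))\<^sup>2 + \<beta> * (t - s)\<^sup>2 + \<sigma> * t" for x y :: "real ^ 'n" and t s
  define \<Psi> where "\<Psi> i x y t s = w x (t + h) $ i - w y (s + k) $ i - P x y t s" for i x y t s
  have small: "norm (x - y) < r" "\<bar>t - s\<bar> < d" "\<sigma> * t \<le> Q"
    if "\<Psi> i x y t s \<ge> c" "t \<ge> 0" "s \<ge> 0" for i x y t s
  proof -
    have P: "P x y t s < Q"
      using that B(2)[of "t + h" x i] B(2)[of "s + k" y i] h k unfolding \<Psi>_def Q_def by linarith
    have "\<alpha> * (norm (x - y))\<^sup>2 \<ge> 0" "\<beta> * (t - s)\<^sup>2 \<ge> 0" "\<sigma> * t \<ge> 0"
      using \<alpha>(1) \<beta>(1) \<open>\<sigma> > 0\<close> that(2) by auto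
    then have "\<alpha> * (norm (x - y))\<^sup>2 < \<alpha> * r\<^sup>2" "\<beta> * (t - s)\<^sup>2 < \<beta> * d\<^sup>2" "\<sigma> * t \<le> Q"
      using P unfolding \<alpha>(2) \<beta>(2) P_def by linarith+
    then have "(norm (x - y))\<^sup>2 < r\<^sup>2" "\<bar>t - s\<bar>\<^sup>2 < d\<^sup>2" using \<alpha>(1) \<beta>(1) by auto
    then show "norm (x - y) < r" "\<bar>t - s\<bar> < d" using power_less_imp_less_base r(1) d(1) by (metis less_imp_le)+
    show "\<sigma> * t \<le> Q" by fact
  qed
  \<comment> \<open>Only \<open>x\<close> is kept in the unit cube, because integer translations
    must move both points together; \<open>y\<close> is held near \<open>x\<close> by the
    penalty.\<close>
  define X where "X = (cbox (0 :: real ^ 'n) 1 \<times> (UNIV :: (real ^ 'n) set)) \<times> {0::real..} \<times> {0::real..}"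
  define \<Phi> where "\<Phi> i z = \<Psi> i (fst (fst z)) (snd (fst z)) (fst (snd z)) (snd (snd z))" for i z
  have closed: "closed X" unfolding X_def by (intro closed_Times closed_cbox closed_UNIV closed_atLeast)
  have cont: "continuous_on X (\<Phi> i)" for i
  proof -
    have "continuous_on X (\<lambda>z. case (fst (fst z), fst (snd z) + h) of (x, t) \<Rightarrow> w x t $ i)"
      by (rule continuous_on_compose2[OF continuous_on_UNIV_Times_component[OF cont_w, of "UNIV \<times> {0..}"]])
        (use h in \<open>auto simp: X_def intro!: continuous_intros\<close>)
    moreover have "continuous_on X (\<lambda>z. case (snd (fst z), snd (snd z) + k) of (x, t) \<Rightarrow> w x t $ i)"
      by (rule continuous_on_compose2[OF continuous_on_UNIV_Times_component[OF cont_w, of "UNIV \<times> {0..}"]])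
        (use k in \<open>auto simp: X_def intro!: continuous_intros\<close>)
    ultimately show ?thesis
      unfolding \<Phi>_def \<Psi>_def P_def by (auto intro!: continuous_intros)
  qed
  define z\<^sub>1 where "z\<^sub>1 = ((y\<^sub>1, y\<^sub>1), (t\<^sub>1, t\<^sub>1))"
  have mem: "z\<^sub>1 \<in> X" using y1(2) t1 by (simp add: z\<^sub>1_def X_def)
  have \<Phi>_z1: "\<Phi> i\<^sub>1 z\<^sub>1 = c"
    using h k t1 by (simp add: z\<^sub>1_def \<Phi>_def \<Psi>_def P_def w_y1 c_eq)
  have bdd: "bounded {z \<in> X. \<Phi> i z \<ge> \<Phi> i\<^sub>1 z\<^sub>1}" for i
  proof -
    obtain N where N: "\<And>x. x \<in> cbox (0 :: real ^ 'n) 1 \<Longrightarrow> norm x \<le> N"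
      using bounded_cbox bounded_iff by metis
    show ?thesis
    proof (rule bounded_subset)
      show "bounded ((cball (0 :: real ^ 'n) N \<times> cball (0 :: real ^ 'n) (N + r)) \<times> {0..Q / \<sigma>} \<times> {0..Q / \<sigma> + d})"
        by (intro bounded_Times bounded_cball bounded_closed_interval)
      show "{z \<in> X. \<Phi> i z \<ge> \<Phi> i\<^sub>1 z\<^sub>1} \<subseteq> (cball 0 N \<times> cball 0 (N + r)) \<times> {0..Q / \<sigma>} \<times> {0..Q / \<sigma> + d}"
      proof
        fix z assume z: "z \<in> {z \<in> X. \<Phi> i z \<ge> \<Phi> i\<^sub>1 z\<^sub>1}"
        obtain x y t s where zz: "z = ((x, y), (t, s))" by (metis prod.collapse)
        have xts: "x \<in> cbox 0 1" "t \<ge> 0" "s \<ge> 0" "\<Psi> i x y t s \<ge> c"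
          using z \<Phi>_z1 by (auto simp: zz X_def \<Phi>_def)
        note sm = small[OF xts(4,2,3)]
        have "norm y \<le> norm x + norm (x - y)" using norm_triangle_sub[of y x] by (simp add: norm_minus_commute)
        moreover have "t \<le> Q / \<sigma>" using sm(3) \<open>\<sigma> > 0\<close> by (simp add: field_simps)
        ultimately show "z \<in> (cball 0 N \<times> cball 0 (N + r)) \<times> {0..Q / \<sigma>} \<times> {0..Q / \<sigma> + d}"
          using N[OF xts(1)] sm(1,2) xts by (auto simp: zz)
      qed
    qed
  qed
  obtain i z where z: "z \<in> X" and z_max: "\<And>j y. y \<in> X \<Longrightarrow> \<Phi> j y \<le> \<Phi> i z"
    by (rule family_attains_max[where \<Phi> = \<Phi> and i\<^sub>0 = i\<^sub>1, OF closed cont mem bdd]) (rule that)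
  obtain x y t s where zz: "z = ((x, y), (t, s))" by (metis prod.collapse)
  have ts: "t \<ge> 0" "s \<ge> 0" using z by (auto simp: zz X_def)
  have max: "\<Psi> j x' y' t' s' \<le> \<Psi> i x y t s" if "t' \<ge> 0" "s' \<ge> 0" for j x' y' t' s'
  proof -
    obtain l where l: "\<forall>j. l $ j \<in> \<int>" "x' + l \<in> cbox 0 1" using torus_representative by blast
    have "\<Psi> j x' y' t' s' = \<Psi> j (x' + l) (y' + l) t' s'"
      using torus_w[of "t' + h"] torus_w[of "s' + k"] l(1) h k that by (simp add: \<Psi>_def P_def torus_fun_def)
    also have "\<dots> \<le> \<Psi> i x y t s"
      using z_max[of "((x' + l, y' + l), (t', s'))" j] l(2) that by (simp add: X_def zz \<Phi>_def)
    finally show ?thesis .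
  qed
  have ge: "\<Psi> i x y t s \<ge> c"
    using z_max[OF mem, of i\<^sub>1] \<Phi>_z1 by (simp add: zz \<Phi>_def)
  note sm = small[OF ge ts]
  have "P x y t s \<ge> 0" using \<alpha>(1) \<beta>(1) \<open>\<sigma> > 0\<close> ts by (simp add: P_def)
  then have big: "w x (t + h) $ i - w y (s + k) $ i > m + 2 * \<gamma>"
    using ge \<open>\<sigma> * t\<^sub>1 \<le> \<gamma>\<close> \<open>\<gamma> > 0\<close> unfolding \<Psi>_def c_def by linarith
  have "t > 0"
  proof (rule ccontr)
    assume "\<not> t > 0"
    then have "t = 0" using ts by simp
    then have "\<bar>w x k $ i - w y (s + k) $ i\<bar> < \<gamma>"
      using sm ts d r h k by (intro d0(2)) auto
    then show False using big m[of x i] \<open>t = 0\<close> \<open>\<gamma> > 0\<close> by simp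
  qed
  have "s > 0"
  proof (rule ccontr)
    assume "\<not> s > 0"
    then have "s = 0" using ts by simp
    then have "\<bar>w x (t + h) $ i - w y h $ i\<bar> < \<gamma>"
      using sm ts d r h k by (intro d0(2)) auto
    then show False using big m[of y i] \<open>s = 0\<close> \<open>\<gamma> > 0\<close> by simp
  qed
  define p where "p = \<alpha> *\<^sub>R (2 *\<^sub>R (x - y))"
  have sub: "(2 * \<beta> * (t - s) + \<sigma>) + H i x p + (D *v w x (t + h)) $ i \<le> 0"
  proof -
    have "(2 * \<beta> * ((t + h) - h - s) + \<sigma>) + H i x (\<alpha> *\<^sub>R (2 *\<^sub>R (x - y))) + (D *v w x (t + h)) $ i \<le> 0"
    proof (rule evolution_subsolution_test[OF sub_w C1_with_gradient_cmult[OF C1_with_gradient_norm_sq], where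
          \<theta> = "\<lambda>\<tau>. \<beta> * (\<tau> - h - s)\<^sup>2 + \<sigma> * (\<tau> - h)" and \<theta>' = "\<lambda>\<tau>. 2 * \<beta> * (\<tau> - h - s) + \<sigma>" and \<delta> = t])
      show "((\<lambda>\<tau>. \<beta> * (\<tau> - h - s)\<^sup>2 + \<sigma> * (\<tau> - h)) has_real_derivative 2 * \<beta> * (\<tau> - h - s) + \<sigma>) (at \<tau>)" for \<tau>
        by (auto intro!: derivative_eq_intros)
      fix x' \<tau> assume "\<bar>\<tau> - (t + h)\<bar> < t"
      then have "\<Psi> i x' y (\<tau> - h) s \<le> \<Psi> i x y t s" using ts by (intro max) auto
      then show "w x' \<tau> $ i - \<alpha> * (norm (x' - y))\<^sup>2 - (\<beta> * (\<tau> - h - s)\<^sup>2 + \<sigma> * (\<tau> - h))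
          \<le> w x (t + h) $ i - \<alpha> * (norm (x - y))\<^sup>2 - (\<beta> * (t + h - h - s)\<^sup>2 + \<sigma> * (t + h - h))"
        by (simp add: \<Psi>_def P_def)
    qed (use \<open>t > 0\<close> h in \<open>auto intro!: continuous_intros\<close>)
    then show ?thesis by (simp add: p_def)
  qed
  have super: "2 * \<beta> * (t - s) + H i y p + (D *v w y (s + k)) $ i \<ge> 0"
  proof -
    have "- (2 * \<beta> * ((s + k) - k - t)) + H i y (- (\<alpha> *\<^sub>R (2 *\<^sub>R (y - x)))) + (D *v w y (s + k)) $ i \<ge> 0"
    proof (rule evolution_supersolution_test[OF super_w C1_with_gradient_cmult[OF C1_with_gradient_norm_sq], where
          \<theta> = "\<lambda>\<tau>. \<beta> * (\<tau> - k - t)\<^sup>2" and \<theta>' = "\<lambda>\<tau>. 2 * \<beta> * (\<tau> - k - t)" and \<delta> = s])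
      show "((\<lambda>\<tau>. \<beta> * (\<tau> - k - t)\<^sup>2) has_real_derivative 2 * \<beta> * (\<tau> - k - t)) (at \<tau>)" for \<tau>
        by (auto intro!: derivative_eq_intros)
      fix y' \<tau> assume "\<bar>\<tau> - (s + k)\<bar> < s"
      then have "\<Psi> i x y' t (\<tau> - k) \<le> \<Psi> i x y t s" using ts by (intro max) auto
      then show "w y (s + k) $ i + \<alpha> * (norm (y - x))\<^sup>2 + \<beta> * (s + k - k - t)\<^sup>2
          \<le> w y' \<tau> $ i + \<alpha> * (norm (y' - x))\<^sup>2 + \<beta> * (\<tau> - k - t)\<^sup>2"
        by (simp add: \<Psi>_def P_def norm_minus_commute[of x] power2_commute[of t])
    qed (use \<open>s > 0\<close> k in \<open>auto intro!: continuous_intros\<close>)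
    moreover have "- (\<alpha> *\<^sub>R (2 *\<^sub>R (y - x))) = p" by (simp add: p_def algebra_simps)
    ultimately show ?thesis by (simp add: algebra_simps)
  qed
  have "norm p < R"
  proof (rule ccontr)
    assume "\<not> ?thesis"
    then have "H i x p \<ge> 2 * \<beta> * d + C" using R(2) by simp
    moreover have "2 * \<beta> * (t - s) \<ge> 2 * \<beta> * (- d)" using sm(2) \<beta>(1) by (intro mult_left_mono) auto
    ultimately show False
      using sub C(2)[of "t + h" x i] ts h \<open>\<sigma> > 0\<close> by (simp add: abs_le_iff)
  qed
  then have "\<bar>H i x p - H i y p\<bar> < \<sigma>"
    using sm(1) r e(1) by (intro e(2)) (auto simp: dist_norm)
  \<comment> \<open>The penalty is the same for every component, so component \<open>i\<close> also
    maximises the difference of the two vectors.\<close>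
  moreover have "(D *v (w x (t + h) - w y (s + k))) $ i \<ge> 0"
  proof (rule mult_D_ge_0)
    show "(w x (t + h) - w y (s + k)) $ j \<le> (w x (t + h) - w y (s + k)) $ i" for j
      using max[OF ts, of j x y] by (simp add: \<Psi>_def)
  qed
  ultimately show False using sub super unfolding mult_D_diff by linarith
qed

text \<open>Comparing \<open>w\<close> with its own time translate carries the modulus of continuity
  at time zero to all later times.\<close>

lemma time_modulus:
  assumes "e > 0"
  obtains \<rho> where "\<rho> > 0" "\<And>x s t i. 0 \<le> s \<Longrightarrow> 0 \<le> t \<Longrightarrow> \<bar>s - t\<bar> < \<rho> \<Longrightarrow> \<bar>w x s $ i - w x t $ i\<bar> \<le> e"
proof -
  obtain d where d: "d > 0" "\<And>x y s t i. 0 \<le> s \<Longrightarrow> s \<le> 1 \<Longrightarrow> 0 \<le> t \<Longrightarrow> t \<le> 1 \<Longrightarrow> norm (x - y) < d \<Longrightarrow>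
      \<bar>s - t\<bar> < d \<Longrightarrow> \<bar>w x s $ i - w y t $ i\<bar> < e"
    using uniformly_continuous_upto[OF \<open>e > 0\<close>] by metis
  define \<rho> where "\<rho> = min d 1"
  have \<rho>: "\<rho> > 0" "\<rho> \<le> d" "\<rho> \<le> 1" using d(1) by (auto simp: \<rho>_def)
  have le: "\<bar>w x t $ i - w x s $ i\<bar> \<le> e" if "0 \<le> s" "s \<le> t" "t - s < \<rho>" for x s t i
  proof -
    have init: "\<bar>w x (t - s) $ i - w x 0 $ i\<bar> < e" for x i
      using that \<rho> d(1) by (intro d(2)) auto
    have "w x (s + (t - s)) $ i - w x (s + 0) $ i \<le> e"
      using that init by (intro contraction) (auto simp: abs_less_iff intro: less_imp_le)
    moreover have "w x (s + 0) $ i - w x (s + (t - s)) $ i \<le> e"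
      using that init by (intro contraction) (auto simp: abs_less_iff intro: less_imp_le)
    ultimately show ?thesis by simp
  qed
  show thesis
  proof (rule that[OF \<rho>(1)])
    fix x i and s t :: real assume "0 \<le> s" "0 \<le> t" "\<bar>s - t\<bar> < \<rho>"
    then show "\<bar>w x s $ i - w x t $ i\<bar> \<le> e"
      using le[of s t x i] le[of t s x i] by (cases "s \<le> t") (auto simp: abs_minus_commute)
  qed
qed

text \<open>A cone in space is combined with a parabola in time. At the vertex the time modulus
  allows a rise of at most \<open>e\<close>; elsewhere the slope \<open>K\<close> is too steep for
  the bounded time slope and coupling. Starting at time 1 leaves room for the time window.\<close>

lemma space_modulus:
  assumes "e > 0"
  obtains K where "K > 0" "\<And>x y t i. t \<ge> 1 \<Longrightarrow> w x t $ i - w y t $ i \<le> e + K * norm (x - y)"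
proof -
  obtain \<rho>\<^sub>0 where \<rho>0: "\<rho>\<^sub>0 > 0"
    "\<And>x s t i. 0 \<le> s \<Longrightarrow> 0 \<le> t \<Longrightarrow> \<bar>s - t\<bar> < \<rho>\<^sub>0 \<Longrightarrow> \<bar>w x s $ i - w x t $ i\<bar> \<le> e"
    using time_modulus[OF \<open>e > 0\<close>] by metis
  define \<rho> where "\<rho> = min \<rho>\<^sub>0 (1 / 2)"
  have \<rho>: "\<rho> > 0" "\<rho> \<le> \<rho>\<^sub>0" "\<rho> < 1" using \<rho>0(1) by (auto simp: \<rho>_def)
  obtain B where B: "B > 0" "\<And>x t i. t \<ge> 0 \<Longrightarrow> \<bar>w x t $ i\<bar> \<le> B" using bounded by blast
  obtain C where C: "C > 0" "\<And>x t i. t \<ge> 0 \<Longrightarrow> \<bar>(D *v w x t) $ i\<bar> \<le> C" using mult_D_bounded by blast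
  \<comment> \<open>At the ends of the window the penalty equals \<open>2 * B\<close>, the largest
    possible oscillation of \<open>w\<close>.\<close>
  define \<beta> where "\<beta> = 2 * B / \<rho>\<^sup>2"
  have \<beta>: "\<beta> > 0" "\<beta> * \<rho>\<^sup>2 = 2 * B" using B(1) \<rho>(1) by (auto simp: \<beta>_def)
  obtain K where K: "K > 0" "\<And>i x p. norm p \<ge> K \<Longrightarrow> H i x p \<ge> 2 * \<beta> * \<rho> + C + 1" using coercive_all by blast
  show thesis
  proof (rule that[OF K(1)], rule ccontr)
    fix x\<^sub>1 y i and t\<^sub>1 :: real
    assume t1: "t\<^sub>1 \<ge> 1" and "\<not> w x\<^sub>1 t\<^sub>1 $ i - w y t\<^sub>1 $ i \<le> e + K * norm (x\<^sub>1 - y)"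
    then have viol: "w x\<^sub>1 t\<^sub>1 $ i - K * norm (x\<^sub>1 - y) > w y t\<^sub>1 $ i + e" by simp
    define X where "X = (UNIV :: (real ^ 'n) set) \<times> {t\<^sub>1 - \<rho>..t\<^sub>1 + \<rho>}"
    define \<Phi> where "\<Phi> z = (case z of (x, t) \<Rightarrow> w x t $ i) - K * norm (fst z - y) - \<beta> * (snd z - t\<^sub>1)\<^sup>2" for z
    have \<Phi>: "\<Phi> (x, t) = w x t $ i - K * norm (x - y) - \<beta> * (t - t\<^sub>1)\<^sup>2" for x t by (simp add: \<Phi>_def)
    have closed: "closed X" unfolding X_def by (intro closed_Times closed_UNIV closed_atLeastAtMost)
    have cont: "continuous_on X \<Phi>"
      unfolding \<Phi>_def
      by (intro continuous_on_diff continuous_on_UNIV_Times_component[OF cont_w] continuous_intros)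
        (use t1 \<rho> in \<open>auto simp: X_def\<close>)
    have mem: "(x\<^sub>1, t\<^sub>1) \<in> X" using \<rho> by (simp add: X_def)
    have bdd: "bounded {z \<in> X. \<Phi> z \<ge> \<Phi> (x\<^sub>1, t\<^sub>1)}"
    proof (rule bounded_subset)
      show "bounded (cball y ((B - \<Phi> (x\<^sub>1, t\<^sub>1)) / K) \<times> {t\<^sub>1 - \<rho>..t\<^sub>1 + \<rho>})"
        by (intro bounded_Times bounded_cball bounded_closed_interval)
      show "{z \<in> X. \<Phi> z \<ge> \<Phi> (x\<^sub>1, t\<^sub>1)} \<subseteq> cball y ((B - \<Phi> (x\<^sub>1, t\<^sub>1)) / K) \<times> {t\<^sub>1 - \<rho>..t\<^sub>1 + \<rho>}"
      proof (clarsimp simp: X_def)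
        fix x t assume ge: "\<Phi> (x, t) \<ge> \<Phi> (x\<^sub>1, t\<^sub>1)" and t: "t\<^sub>1 - \<rho> \<le> t" "t \<le> t\<^sub>1 + \<rho>"
        have "\<beta> * (t - t\<^sub>1)\<^sup>2 \<ge> 0" using \<beta>(1) by simp
        then have "K * norm (x - y) \<le> B - \<Phi> (x\<^sub>1, t\<^sub>1)"
          using ge B(2)[of t x i] t1 t \<rho> unfolding \<Phi>[of x] by linarith
        then show "dist y x \<le> (B - \<Phi> (x\<^sub>1, t\<^sub>1)) / K"
          using K(1) by (simp add: dist_norm norm_minus_commute field_simps)
      qed
    qed
    obtain z where z: "z \<in> X" and z_max: "\<And>y. y \<in> X \<Longrightarrow> \<Phi> y \<le> \<Phi> z"
      by (rule coercive_attains_max[where \<Phi> = \<Phi>, OF closed cont mem bdd]) (rule that)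
    obtain x t where zxt: "z = (x, t)" by force
    have "\<Phi> (x\<^sub>1, t\<^sub>1) \<le> \<Phi> (x, t)" using z_max[OF mem] zxt by simp
    then have big: "w x t $ i - K * norm (x - y) - \<beta> * (t - t\<^sub>1)\<^sup>2 > w y t\<^sub>1 $ i + e"
      using viol by (simp add: \<Phi>)
    have t: "\<bar>t - t\<^sub>1\<bar> \<le> \<rho>" using z by (auto simp: X_def zxt)
    then have "t > 0" using t1 \<rho> by auto
    have Kn: "K * norm (x - y) \<ge> 0" using K(1) by simp
    have t_in: "\<bar>t - t\<^sub>1\<bar> < \<rho>"
    proof (rule ccontr)
      assume "\<not> ?thesis"
      then have "\<bar>t - t\<^sub>1\<bar> = \<rho>" using t by simp
      then have "\<beta> * (t - t\<^sub>1)\<^sup>2 = 2 * B" using \<beta>(2) by (metis power2_abs)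
      then show False
        using big B(2)[of t x i] B(2)[of t\<^sub>1 y i] \<open>t > 0\<close> t1 Kn \<open>e > 0\<close> by linarith
    qed
    have "x \<noteq> y"
    proof
      assume "x = y"
      moreover have "\<bar>w y t $ i - w y t\<^sub>1 $ i\<bar> \<le> e"
        using \<open>t > 0\<close> t1 t_in \<rho> by (intro \<rho>0(2)) auto
      moreover have "\<beta> * (t - t\<^sub>1)\<^sup>2 \<ge> 0" using \<beta>(1) by simp
      ultimately show False using big by simp
    qed
    have "\<exists>p. norm p = K \<and> 2 * \<beta> * (t - t\<^sub>1) + H i x p + (D *v w x t) $ i \<le> 0"
    proof (rule evolution_subsolution_cone[OF sub_w less_imp_le[OF K(1)] \<open>x \<noteq> y\<close>, where t = t and i = i and
          \<theta> = "\<lambda>t. \<beta> * (t - t\<^sub>1)\<^sup>2" and \<theta>' = "\<lambda>t. 2 * \<beta> * (t - t\<^sub>1)" and \<delta> = "\<rho> - \<bar>t - t\<^sub>1\<bar>"])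
      show "((\<lambda>t. \<beta> * (t - t\<^sub>1)\<^sup>2) has_real_derivative 2 * \<beta> * (t - t\<^sub>1)) (at t)" for t
        by (auto intro!: derivative_eq_intros)
      fix x' s assume "\<bar>s - t\<bar> < \<rho> - \<bar>t - t\<^sub>1\<bar>"
      then have "(x', s) \<in> X" by (auto simp: X_def)
      then show "w x' s $ i - K * norm (x' - y) - \<beta> * (s - t\<^sub>1)\<^sup>2 \<le> w x t $ i - K * norm (x - y) - \<beta> * (t - t\<^sub>1)\<^sup>2"
        using z_max by (fastforce simp: \<Phi> zxt)
    qed (use \<open>t > 0\<close> t_in in \<open>auto intro!: continuous_intros\<close>)
    then obtain p where p: "norm p = K" "2 * \<beta> * (t - t\<^sub>1) + H i x p + (D *v w x t) $ i \<le> 0" by blast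
    have "2 * \<beta> * (t - t\<^sub>1) \<ge> 2 * \<beta> * (- \<rho>)" using t \<beta>(1) by (intro mult_left_mono) auto
    then show False
      using p(2) K(2)[of p i x] p(1) C(2)[of t x i] \<open>t > 0\<close> by (simp add: abs_le_iff)
  qed
qed

subsection \<open>Large time behaviour\<close>

text \<open>On the axis over such a point the Hamiltonian drops out, and the remaining inequality
  for \<open>w\<close> and \<open>D\<close> does not let the largest component grow. The slope
  \<sigma> makes the contradiction strict.\<close>

lemma nonincreasing_at_zero:
  assumes x0: "\<And>i. H i x\<^sub>0 0 = 0" and "0 \<le> s" "s \<le> t" and m: "\<And>j. w x\<^sub>0 s $ j \<le> m"
  shows "w x\<^sub>0 t $ i \<le> m"
proof (rule ccontr)
  \<comment> \<open>The added 1 covers \<open>t = s\<close>; the penalty then uses up less than half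
    of the gap.\<close>
  define \<sigma> where "\<sigma> = (w x\<^sub>0 t $ i - m) / (2 * (t - s + 1))"
  assume "\<not> ?thesis"
  then have gap: "w x\<^sub>0 t $ i - m > 0" by simp
  then have "\<sigma> > 0" using \<open>s \<le> t\<close> by (simp add: \<sigma>_def)
  have "2 * (\<sigma> * (t - s + 1)) = w x\<^sub>0 t $ i - m" using \<open>s \<le> t\<close> by (simp add: \<sigma>_def field_simps)
  then have \<sigma>: "\<sigma> * (t - s) < w x\<^sub>0 t $ i - m" using gap \<open>\<sigma> > 0\<close> by (simp add: algebra_simps)
  obtain B where B: "B > 0" "\<And>x t i. t \<ge> 0 \<Longrightarrow> \<bar>w x t $ i\<bar> \<le> B" using bounded by blast
  define \<Phi> where "\<Phi> j \<tau> = w x\<^sub>0 \<tau> $ j - \<sigma> * (\<tau> - s)" for j \<tau>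
  have closed: "closed {s..}" by simp
  have cont: "continuous_on {s..} (\<Phi> j)" for j
  proof -
    have "continuous_on {s..} (\<lambda>\<tau>. case (x\<^sub>0, \<tau>) of (x, t) \<Rightarrow> w x t $ j)"
      by (rule continuous_on_compose2[OF continuous_on_UNIV_Times_component[OF cont_w, of "UNIV \<times> {0..}"]])
        (use \<open>0 \<le> s\<close> in \<open>auto intro!: continuous_intros\<close>)
    then show ?thesis unfolding \<Phi>_def by (auto intro!: continuous_intros)
  qed
  have mem: "t \<in> {s..}" using \<open>s \<le> t\<close> by simp
  have bdd: "bounded {\<tau> \<in> {s..}. \<Phi> j \<tau> \<ge> \<Phi> i t}" for j
  proof (rule bounded_subset[OF bounded_closed_interval])
    show "{\<tau> \<in> {s..}. \<Phi> j \<tau> \<ge> \<Phi> i t} \<subseteq> {s..s + (B - \<Phi> i t) / \<sigma>}"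
    proof clarsimp
      fix \<tau> assume "s \<le> \<tau>" "\<Phi> j \<tau> \<ge> \<Phi> i t"
      then have "\<sigma> * (\<tau> - s) \<le> B - \<Phi> i t"
        using B(2)[of \<tau> x\<^sub>0 j] \<open>0 \<le> s\<close> unfolding \<Phi>_def[of j] by linarith
      then show "\<tau> \<le> s + (B - \<Phi> i t) / \<sigma>" using \<open>\<sigma> > 0\<close> by (simp add: field_simps)
    qed
  qed
  obtain j \<tau> where "\<tau> \<in> {s..}" and max: "\<And>j' t. t \<in> {s..} \<Longrightarrow> \<Phi> j' t \<le> \<Phi> j \<tau>"
    by (rule family_attains_max[where \<Phi> = \<Phi> and i\<^sub>0 = i, OF closed cont mem bdd]) (rule that)
  have "\<Phi> j \<tau> > m" using max[OF mem, of i] \<sigma> by (simp add: \<Phi>_def)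
  then have "\<tau> \<noteq> s" using m[of j] by (auto simp: \<Phi>_def)
  then have "\<tau> > s" using \<open>\<tau> \<in> {s..}\<close> by simp
  have "\<sigma> + (D *v w x\<^sub>0 \<tau>) $ j \<le> 0"
  proof (rule evolution_subsolution_restrict[OF sub_w cont_w H_ge cont_H_0 x0, where
        \<theta> = "\<lambda>t. \<sigma> * (t - s)" and \<theta>' = "\<lambda>_. \<sigma>" and \<delta> = "\<tau> - s"])
    show "((\<lambda>t. \<sigma> * (t - s)) has_real_derivative \<sigma>) (at t)" for t
      by (auto intro!: derivative_eq_intros)
    fix t assume "\<bar>t - \<tau>\<bar> < \<tau> - s"
    then show "w x\<^sub>0 t $ j - \<sigma> * (t - s) \<le> w x\<^sub>0 \<tau> $ j - \<sigma> * (\<tau> - s)"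
      using max[of t j] by (simp add: \<Phi>_def)
  qed (use \<open>\<tau> > s\<close> \<open>0 \<le> s\<close> in auto)
  moreover have "(D *v w x\<^sub>0 \<tau>) $ j \<ge> 0"
    using max[OF \<open>\<tau> \<in> {s..}\<close>] by (intro mult_D_ge_0) (simp add: \<Phi>_def)
  ultimately show False using \<open>\<sigma> > 0\<close> by simp
qed

text \<open>If the claim failed, a parabola of opening \<open>A\<close> would touch component
  \<open>i\<close> inside the window. There its slope is at least \<open>- 2 * A * h\<close>,
  component \<open>k\<close> contributes at least \<open>- D $ i $ k * \<delta>\<close> to the
  coupling, and the diagonal loses at most \<open>D $ i $ i * A * h\<^sup>2\<close>. The condition
  on \<open>A\<close> says that the subsolution inequality then fails.\<close>

lemma drop_at_zero:
  assumes x0: "\<And>i. H i x\<^sub>0 0 = 0" and "h > 0" "h < \<tau>"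
    and m: "\<And>t j. \<bar>t - \<tau>\<bar> \<le> h \<Longrightarrow> w x\<^sub>0 t $ j \<le> m"
    and k: "\<And>t. \<bar>t - \<tau>\<bar> \<le> h \<Longrightarrow> w x\<^sub>0 t $ k \<le> m - \<delta>" and "i \<noteq> k"
    and A: "A > 0" "A * (2 * h + D $ i $ i * h\<^sup>2) < - D $ i $ k * \<delta>"
  shows "w x\<^sub>0 \<tau> $ i \<le> m - A * h\<^sup>2"
proof (rule ccontr)
  assume neg: "\<not> ?thesis"
  define I where "I = {\<tau> - h..\<tau> + h}"
  define y where "y t = w x\<^sub>0 t $ i - A * (t - \<tau>)\<^sup>2" for t
  have "continuous_on I (\<lambda>t. case (x\<^sub>0, t) of (x, t) \<Rightarrow> w x t $ i)"
    by (rule continuous_on_compose2[OF continuous_on_UNIV_Times_component[OF cont_w, of "UNIV \<times> {0..}"]])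
      (use \<open>h < \<tau>\<close> in \<open>auto simp: I_def intro!: continuous_intros\<close>)
  then have "continuous_on I y" unfolding y_def by (auto intro!: continuous_intros)
  moreover have "compact I" "\<tau> \<in> I" using \<open>h > 0\<close> by (auto simp: I_def)
  ultimately obtain t where t: "t \<in> I" and max: "\<And>s. s \<in> I \<Longrightarrow> y s \<le> y t"
    using continuous_attains_sup[of I y] by blast
  have tI: "\<bar>t - \<tau>\<bar> \<le> h" using t by (auto simp: I_def)
  have "y t > m - A * h\<^sup>2" using max[OF \<open>\<tau> \<in> I\<close>] neg by (simp add: y_def)
  then have "A * (t - \<tau>)\<^sup>2 < A * h\<^sup>2" using m[OF tI, of i] by (simp add: y_def)
  then have "\<bar>t - \<tau>\<bar>\<^sup>2 < h\<^sup>2" using A(1) by simp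
  then have t_in: "\<bar>t - \<tau>\<bar> < h" using \<open>h > 0\<close> by (metis less_imp_le power_less_imp_less_base)
  have "2 * A * (t - \<tau>) + (D *v w x\<^sub>0 t) $ i \<le> 0"
  proof (rule evolution_subsolution_restrict[OF sub_w cont_w H_ge cont_H_0 x0, where
        \<theta> = "\<lambda>t. A * (t - \<tau>)\<^sup>2" and \<theta>' = "\<lambda>t. 2 * A * (t - \<tau>)" and \<delta> = "h - \<bar>t - \<tau>\<bar>"])
    show "((\<lambda>t. A * (t - \<tau>)\<^sup>2) has_real_derivative 2 * A * (t - \<tau>)) (at t)" for t
      by (auto intro!: derivative_eq_intros)
    fix s assume "\<bar>s - t\<bar> < h - \<bar>t - \<tau>\<bar>"
    then have "\<tau> - h \<le> s" "s \<le> \<tau> + h" by linarith+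
    then show "w x\<^sub>0 s $ i - A * (s - \<tau>)\<^sup>2 \<le> w x\<^sub>0 t $ i - A * (t - \<tau>)\<^sup>2"
      using max[of s] by (auto simp: y_def I_def)
  qed (use t_in \<open>h < \<tau>\<close> in \<open>auto intro!: continuous_intros\<close>)
  moreover have "(D *v w x\<^sub>0 t) $ i \<ge> - D $ i $ k * \<delta> - D $ i $ i * (A * h\<^sup>2)"
  proof -
    define r where "r j = D $ i $ j * (w x\<^sub>0 t $ j - m)" for j
    have D: "D $ i $ i \<ge> 0" "\<And>j. j \<noteq> i \<Longrightarrow> D $ i $ j \<le> 0" "(\<Sum>j\<in>UNIV. D $ i $ j) = 0"
      using monotone by (auto simp: monotone_matrix_def)
    have "(D *v w x\<^sub>0 t) $ i = (D *v w x\<^sub>0 t) $ i - (\<Sum>j\<in>UNIV. D $ i $ j) * m" using D(3) by simp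
    also have "\<dots> = (\<Sum>j\<in>UNIV. r j)"
      by (simp add: r_def matrix_vector_mult_def sum_distrib_right right_diff_distrib sum_subtractf)
    also have "\<dots> = r i + (r k + (\<Sum>j\<in>UNIV - {i} - {k}. r j))"
      using \<open>i \<noteq> k\<close> by (simp add: sum.remove[of UNIV i] sum.remove[of "UNIV - {i}" k])
    finally have eq: "(D *v w x\<^sub>0 t) $ i = r i + (r k + (\<Sum>j\<in>UNIV - {i} - {k}. r j))" .
    have "A * (t - \<tau>)\<^sup>2 \<ge> 0" using A(1) by simp
    then have "w x\<^sub>0 t $ i - m \<ge> - (A * h\<^sup>2)" using \<open>y t > m - A * h\<^sup>2\<close> unfolding y_def by linarith
    then have "r i \<ge> D $ i $ i * (- (A * h\<^sup>2))" unfolding r_def using D(1) by (rule mult_left_mono)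
    moreover have "r k \<ge> D $ i $ k * (- \<delta>)"
      unfolding r_def using D(2)[of k] \<open>i \<noteq> k\<close> k[OF tI] by (intro mult_left_mono_neg) auto
    moreover have "(\<Sum>j\<in>UNIV - {i} - {k}. r j) \<ge> 0"
      unfolding r_def using D(2) m[OF tI] by (intro sum_nonneg mult_nonpos_nonpos) auto
    ultimately show ?thesis unfolding eq by simp
  qed
  moreover have "2 * A * (t - \<tau>) \<ge> 2 * A * (- h)" using A(1) tI by (intro mult_left_mono) auto
  ultimately show False using A(2) by (simp add: algebra_simps)
qed

text \<open>The maximum of the components decreases to a limit \<open>M\<close>. If some components stayed below \<open>M\<close>
  along a sequence of times, so would any component coupled to one of them; by irreducibility all
  components would, which contradicts the definition of \<open>M\<close>.\<close>

lemma convergence_at_zero: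
  assumes x0: "\<And>i. H i x\<^sub>0 0 = 0"
  obtains M where "\<And>e. e > 0 \<Longrightarrow> \<exists>T. \<forall>t\<ge>T. \<forall>i. \<bar>w x\<^sub>0 t $ i - M\<bar> \<le> e"
proof -
  obtain B where B: "B > 0" "\<And>x t i. t \<ge> 0 \<Longrightarrow> \<bar>w x t $ i\<bar> \<le> B" using bounded by blast
  \<comment> \<open>A bound for all components at one time persists afterwards, so the infimum
    \<open>M\<close> is the limit of the largest component.\<close>
  define S where "S = {a. \<exists>t\<ge>0. \<forall>j. w x\<^sub>0 t $ j \<le> a}"
  define M where "M = Inf S"
  have "B \<in> S" using B(2)[of 0] by (auto simp: S_def abs_le_iff)
  have bdd: "bdd_below S"
  proof (rule bdd_belowI)
    fix a assume "a \<in> S"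
    then obtain t where "t \<ge> 0" "w x\<^sub>0 t $ undefined \<le> a" by (auto simp: S_def)
    then show "- B \<le> a" using B(2)[of t x\<^sub>0 undefined] by (simp add: abs_le_iff)
  qed
  have upper: "\<exists>T\<ge>0. \<forall>t\<ge>T. \<forall>j. w x\<^sub>0 t $ j \<le> M + e" if "e > 0" for e
  proof -
    have "M < M + e" using that by simp
    then obtain a where "a \<in> S" "a < M + e"
      unfolding M_def using cInf_less_iff[OF _ bdd] \<open>B \<in> S\<close> by blast
    then obtain T where T: "T \<ge> 0" "\<And>j. w x\<^sub>0 T $ j \<le> a" by (auto simp: S_def)
    have "w x\<^sub>0 t $ j \<le> M + e" if "t \<ge> T" for t j
      using nonincreasing_at_zero[OF x0 T(1) that T(2), of j] \<open>a < M + e\<close> by simp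
    then show ?thesis using T(1) by blast
  qed
  \<comment> \<open>One gap \<delta> and the same arbitrarily late times serve all components of
    \<open>I\<close> at once.\<close>
  define Low where "Low I \<longleftrightarrow> (\<exists>\<delta>>0. \<forall>T. \<exists>t\<ge>T. \<forall>j\<in>I. w x\<^sub>0 t $ j \<le> M - \<delta>)" for I
  have not_low: "\<not> Low UNIV"
  proof
    assume "Low UNIV"
    then obtain \<delta> t where "\<delta> > 0" "t \<ge> 0" "\<forall>j. w x\<^sub>0 t $ j \<le> M - \<delta>" unfolding Low_def by blast
    then have "M - \<delta> \<in> S" by (auto simp: S_def)
    then show False using cInf_lower[OF _ bdd] \<open>\<delta> > 0\<close> by (fastforce simp: M_def)
  qed
  have step: "\<exists>i. i \<notin> I \<and> Low (insert i I)" if "Low I" "I \<noteq> {}" "I \<noteq> UNIV" for I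
  proof -
    have "- I \<noteq> {}" "- I \<noteq> UNIV" using that(2,3) by auto
    \<comment> \<open>Irreducibility is applied to the complement of \<open>I\<close>: the new index
      \<open>i\<close> lies outside and is coupled to some \<open>k\<close> inside.\<close>
    then obtain i k where ik: "i \<notin> I" "k \<in> I" "D $ i $ k \<noteq> 0"
      using irreducible unfolding irreducible_matrix_def by (metis ComplD ComplI)
    then have "i \<noteq> k" by auto
    then have Dik: "D $ i $ k < 0" "D $ i $ i \<ge> 0"
      using monotone ik(3) by (auto simp: monotone_matrix_def less_le)
    obtain \<delta> where \<delta>: "\<delta> > 0" "\<And>T. \<exists>t\<ge>T. \<forall>j\<in>I. w x\<^sub>0 t $ j \<le> M - \<delta>"
      using \<open>Low I\<close> unfolding Low_def by blast
    have "\<delta> / 2 > 0" using \<delta>(1) by simp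
    obtain \<rho> where \<rho>: "\<rho> > 0" "\<And>x s t i. 0 \<le> s \<Longrightarrow> 0 \<le> t \<Longrightarrow> \<bar>s - t\<bar> < \<rho> \<Longrightarrow> \<bar>w x s $ i - w x t $ i\<bar> \<le> \<delta> / 2"
      using time_modulus[OF \<open>\<delta> / 2 > 0\<close>] by metis
    \<comment> \<open>Over this window component \<open>k\<close> rises by at most half of its gap,
      so it stays low enough to pull component \<open>i\<close> down.\<close>
    define h where "h = \<rho> / 2"
    have h: "h > 0" "h < \<rho>" using \<rho>(1) by (auto simp: h_def)
    define E where "E = 2 * h + D $ i $ i * h\<^sup>2"
    have "E > 0" using h Dik(2) by (simp add: E_def add_pos_nonneg)
    define b where "b = - D $ i $ k * (\<delta> / 2)"
    define A where "A = b / (2 * E)"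
    have "b > 0" using Dik(1) \<delta>(1) by (simp add: b_def mult_neg_pos)
    then have "A > 0" "A * E < b" using \<open>E > 0\<close> by (auto simp: A_def)
    then have A: "A > 0" "A * E < - D $ i $ k * (\<delta> / 2)" by (auto simp: b_def)
    \<comment> \<open>Half of the drop: starting from the bound \<open>M + e\<close>, component
      \<open>i\<close> ends at most at \<open>M - e\<close>.\<close>
    define e where "e = A * h\<^sup>2 / 2"
    have "e > 0" using A(1) h(1) by (simp add: e_def)
    obtain T\<^sub>1 where T1: "T\<^sub>1 \<ge> 0" "\<And>t j. t \<ge> T\<^sub>1 \<Longrightarrow> w x\<^sub>0 t $ j \<le> M + e" using upper[OF \<open>e > 0\<close>] by blast
    have "\<exists>t\<ge>T. \<forall>j\<in>insert i I. w x\<^sub>0 t $ j \<le> M - min \<delta> e" for T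
    proof -
      obtain t where t: "t \<ge> max T T\<^sub>1 + h + 1" "\<forall>j\<in>I. w x\<^sub>0 t $ j \<le> M - \<delta>" using \<delta>(2) by blast
      have "w x\<^sub>0 t $ i \<le> (M + e) - A * h\<^sup>2"
      proof (rule drop_at_zero[OF x0 h(1) _ _ _ \<open>i \<noteq> k\<close> A(1) A(2)[unfolded E_def]])
        show "h < t" using t(1) T1(1) by simp
        fix s assume s: "\<bar>s - t\<bar> \<le> h"
        then show "w x\<^sub>0 s $ j \<le> M + e" for j using t(1) by (intro T1(2)) auto
        have "\<bar>w x\<^sub>0 s $ k - w x\<^sub>0 t $ k\<bar> \<le> \<delta> / 2" using s h t(1) T1(1) by (intro \<rho>(2)) auto
        moreover have "w x\<^sub>0 t $ k \<le> M - \<delta>" using t(2) ik(2) by blast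
        ultimately show "w x\<^sub>0 s $ k \<le> M + e - \<delta> / 2" using \<open>e > 0\<close> by linarith
      qed
      then have "w x\<^sub>0 t $ i \<le> M - e" by (simp add: e_def)
      moreover have "t \<ge> T" using t(1) h(1) by simp
      ultimately show ?thesis using t(2) by (intro exI[of _ t]) auto
    qed
    then have "Low (insert i I)" unfolding Low_def using \<delta>(1) \<open>e > 0\<close> by (intro exI[of _ "min \<delta> e"]) auto
    then show ?thesis using ik(1) by blast
  qed
  have none: "\<not> Low I" if "I \<noteq> {}" for I
    using that
  proof (induction "card (- I)" arbitrary: I rule: less_induct)
    case less
    show ?case
    proof
      assume "Low I"
      then have "I \<noteq> UNIV" using not_low by blast
      then obtain i where i: "i \<notin> I" "Low (insert i I)" using step[OF \<open>Low I\<close> less.prems] by blast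
      have "card (- insert i I) < card (- I)" using i(1) by (intro psubset_card_mono) auto
      then show False using less.hyps[of "insert i I"] i(2) by simp
    qed
  qed
  have lower: "\<exists>T. \<forall>t\<ge>T. w x\<^sub>0 t $ i \<ge> M - e" if "e > 0" for e i
  proof (rule ccontr)
    assume "\<not> ?thesis"
    then have "\<forall>T. \<exists>t\<ge>T. \<forall>j\<in>{i}. w x\<^sub>0 t $ j \<le> M - e" by (auto simp: not_le intro: less_imp_le)
    then have "Low {i}" unfolding Low_def using that by blast
    then show False using none by blast
  qed
  show thesis
  proof (rule that)
    fix e :: real assume "e > 0"
    obtain T where T: "\<And>t j. t \<ge> T \<Longrightarrow> w x\<^sub>0 t $ j \<le> M + e" using upper[OF \<open>e > 0\<close>] by blast
    obtain T' where T': "\<And>i t. t \<ge> T' i \<Longrightarrow> w x\<^sub>0 t $ i \<ge> M - e" using lower[OF \<open>e > 0\<close>] by metis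
    have "\<bar>w x\<^sub>0 t $ i - M\<bar> \<le> e" if "t \<ge> max T (Max (range T'))" for t i
      using T[of t i] T'[of i t] that Max_ge[of "range T'" "T' i"] by (auto simp: abs_le_iff)
    then show "\<exists>T. \<forall>t\<ge>T. \<forall>i. \<bar>w x\<^sub>0 t $ i - M\<bar> \<le> e" by blast
  qed
qed

lemma uniform_convergence:
  obtains W L where "\<And>i. L-lipschitz_on UNIV (\<lambda>x. W x $ i)" "torus_fun W" "continuous_on UNIV W"
    "stationary_subsolution H D W" "stationary_supersolution H D W" "uniform_limit UNIV (\<lambda>t x. w x t) W at_top"
proof -
  have D: "\<And>i j. i \<noteq> j \<Longrightarrow> D $ i $ j \<le> 0" using monotone by (auto simp: monotone_matrix_def)
  obtain B where "B > 0" and B: "\<And>x t i. t \<ge> 0 \<Longrightarrow> \<bar>w x t $ i\<bar> \<le> B" using bounded by blast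
  have modulus: "\<exists>K>0. \<forall>x y t i. t \<ge> 1 \<longrightarrow> w x t $ i - w y t $ i \<le> e + K * norm (x - y)" if "e > 0" for e
  proof -
    obtain K where K: "K > 0" "\<And>x y t i. t \<ge> 1 \<Longrightarrow> w x t $ i - w y t $ i \<le> e + K * norm (x - y)"
      by (rule space_modulus[OF \<open>e > 0\<close>]) (rule that)
    show ?thesis using K(1) by (intro exI[of _ K] conjI allI impI K(2))
  qed
  obtain W where W: "torus_fun W" "continuous_on UNIV W" "stationary_subsolution H D W"
    and W_upper: "\<And>e. e > 0 \<Longrightarrow> \<exists>T. \<forall>t\<ge>T. \<forall>x i. w x t $ i \<le> W x $ i + e"
    and W_attained: "\<And>e T x i. e > 0 \<Longrightarrow> \<exists>t\<ge>T. W x $ i - e \<le> w x t $ i"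
    by (rule ex_relaxed_limit[OF sub_w torus_w cont_w D cont_H B modulus]) (assumption | rule that)+
  have neg_torus: "torus_fun (\<lambda>x. - w x t)" if "t \<ge> 0" for t
    using torus_w[OF that] by (simp add: torus_fun_def)
  have neg_cont: "continuous_on (UNIV \<times> {0..}) (\<lambda>(x, t). - w x t)"
    using continuous_on_minus[OF cont_w] by (simp add: case_prod_unfold)
  have neg_H: "continuous_on UNIV (\<lambda>(x, p). - H i x (- p))" for i
  proof -
    have "continuous_on UNIV (\<lambda>z. - (\<lambda>(x, p). H i x p) (fst z, - snd z))"
      by (intro continuous_on_minus continuous_on_compose2[OF cont_H]) (auto intro!: continuous_intros)
    then show ?thesis by (simp add: case_prod_unfold)
  qed
  have neg_B: "\<bar>(- w x t) $ i\<bar> \<le> B" if "t \<ge> 0" for x t i using B[OF that] by simp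
  have neg_modulus: "\<exists>K>0. \<forall>x y t i. t \<ge> 1 \<longrightarrow> (- w x t) $ i - (- w y t) $ i \<le> e + K * norm (x - y)"
    if "e > 0" for e
  proof -
    obtain K where K: "K > 0" "\<And>x y t i. t \<ge> 1 \<Longrightarrow> w x t $ i - w y t $ i \<le> e + K * norm (x - y)"
      by (rule space_modulus[OF \<open>e > 0\<close>]) (rule that)
    have "(- w x t) $ i - (- w y t) $ i \<le> e + K * norm (x - y)" if "t \<ge> 1" for x y t i
      using K(2)[OF that, of y i x] by (simp add: norm_minus_commute)
    then show ?thesis using K(1) by (intro exI[of _ K] conjI allI impI)
  qed
  \<comment> \<open>\<open>V\<close> is the upper limit of \<open>- w\<close>, so \<open>- V\<close>
    is the lower limit of \<open>w\<close>, and reflection makes it a supersolution for the original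
    Hamiltonian.\<close>
  obtain V where V: "torus_fun V" "continuous_on UNIV V" "stationary_subsolution (\<lambda>i x p. - H i x (- p)) D V"
    and V_upper: "\<And>e. e > 0 \<Longrightarrow> \<exists>T. \<forall>t\<ge>T. \<forall>x i. (- w x t) $ i \<le> V x $ i + e"
    and V_attained: "\<And>e T x i. e > 0 \<Longrightarrow> \<exists>t\<ge>T. V x $ i - e \<le> (- w x t) $ i"
    by (rule ex_relaxed_limit[OF super_w[unfolded evolution_supersolution_iff_neg] neg_torus neg_cont D
          neg_H neg_B neg_modulus]) (assumption | rule that)+
  define U where "U x = - V x" for x
  have U: "torus_fun U" "continuous_on UNIV U" "stationary_supersolution H D U"
    using V by (auto simp: U_def[abs_def] torus_fun_def stationary_supersolution_iff_neg
        intro: continuous_on_minus)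
  have U_lower: "\<exists>T. \<forall>t\<ge>T. \<forall>x i. U x $ i - e \<le> w x t $ i" if "e > 0" for e
  proof -
    obtain T where T: "\<And>t x i. t \<ge> T \<Longrightarrow> (- w x t) $ i \<le> V x $ i + e"
      using V_upper[OF \<open>e > 0\<close>] by blast
    have "U x $ i - e \<le> w x t $ i" if "t \<ge> T" for t x i using T[OF that, of x i] by (simp add: U_def)
    then show ?thesis by blast
  qed
  have U_attained: "\<exists>t\<ge>T. w x t $ i \<le> U x $ i + e" if "e > 0" for e T x i
    using V_attained[OF that, of T x i] by (auto simp: U_def algebra_simps)
  have "W x $ i \<le> U x $ i" if "\<And>j. H j x 0 = 0" for x i
  proof (rule field_le_epsilon)
    fix e :: real assume "e > 0"
    obtain M where M: "\<And>e. e > 0 \<Longrightarrow> \<exists>T. \<forall>t\<ge>T. \<forall>i. \<bar>w x t $ i - M\<bar> \<le> e"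
      using convergence_at_zero[OF \<open>\<And>j. H j x 0 = 0\<close>] by metis
    obtain T where T: "\<And>t. t \<ge> T \<Longrightarrow> \<bar>w x t $ i - M\<bar> \<le> e / 4" using M[of "e / 4"] \<open>e > 0\<close> by auto
    obtain t where t: "t \<ge> T" "W x $ i - e / 4 \<le> w x t $ i"
      using W_attained[of "e / 4" T x i] \<open>e > 0\<close> by auto
    obtain s where s: "s \<ge> T" "w x s $ i \<le> U x $ i + e / 4"
      using U_attained[of "e / 4" T x i] \<open>e > 0\<close> by auto
    show "W x $ i \<le> U x $ i + e" using T[OF t(1)] T[OF s(1)] t(2) s(2) unfolding abs_le_iff by linarith
  qed
  then have WU: "W x $ i \<le> U x $ i" for x i
    by (rule stationary_comparison[OF W(3,1,2) U(3,1,2)])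
  have UW: "U x $ i \<le> W x $ i" for x i
  proof (rule field_le_epsilon)
    fix e :: real assume "e > 0"
    then have "e / 2 > 0" by simp
    obtain T where T: "\<And>t. t \<ge> T \<Longrightarrow> U x $ i - e / 2 \<le> w x t $ i" using U_lower[OF \<open>e / 2 > 0\<close>] by blast
    obtain T' where T': "\<And>t. t \<ge> T' \<Longrightarrow> w x t $ i \<le> W x $ i + e / 2" using W_upper[OF \<open>e / 2 > 0\<close>] by blast
    show "U x $ i \<le> W x $ i + e" using T[of "max T T'"] T'[of "max T T'"] by simp
  qed
  have "U = W" using WU UW by (intro ext) (simp add: vec_eq_iff order_antisym)
  obtain L where L: "L > 0" "\<And>x y i. W x $ i - W y $ i \<le> L * norm (x - y)"
    using stationary_subsolution_lipschitz[OF W(3,1,2)] by blast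
  have "L-lipschitz_on UNIV (\<lambda>x. W x $ i)" for i
  proof (rule lipschitz_onI)
    show "dist (W x $ i) (W y $ i) \<le> L * dist x y" for x y
      using L(2)[of x i y] L(2)[of y i x] by (simp add: dist_real_def dist_norm abs_le_iff norm_minus_commute)
  qed (use L(1) in simp)
  moreover have "uniform_limit UNIV (\<lambda>t x. w x t) W at_top"
    unfolding uniform_limit_iff
  proof (intro allI impI)
    fix e :: real assume "e > 0"
    define c where "c = real CARD('m)"
    have "c > 0" by (simp add: c_def)
    define e' where "e' = e / (2 * c)"
    have "e' > 0" using \<open>e > 0\<close> \<open>c > 0\<close> by (simp add: e'_def)
    obtain T where T: "\<And>t x i. t \<ge> T \<Longrightarrow> U x $ i - e' \<le> w x t $ i" using U_lower[OF \<open>e' > 0\<close>] by blast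
    obtain T' where T': "\<And>t x i. t \<ge> T' \<Longrightarrow> w x t $ i \<le> W x $ i + e'" using W_upper[OF \<open>e' > 0\<close>] by blast
    have "dist (w x t) (W x) < e" if "t \<ge> max T T'" for t x
    proof -
      have "norm (w x t - W x) \<le> (\<Sum>i\<in>UNIV. \<bar>(w x t - W x) $ i\<bar>)" by (rule norm_le_l1_cart)
      also have "\<dots> \<le> (\<Sum>i\<in>(UNIV :: 'm set). e')"
        using T[of t x] T'[of t x] that unfolding \<open>U = W\<close>
        by (intro sum_mono) (auto simp: abs_le_iff algebra_simps)
      also have "\<dots> = c * e'" by (simp add: c_def)
      also have "\<dots> < e" using \<open>e > 0\<close> \<open>c > 0\<close> by (simp add: e'_def)
      finally show ?thesis by (simp add: dist_norm)
    qed
    then show "\<forall>\<^sub>F t in at_top. \<forall>x\<in>UNIV. dist (w x t) (W x) < e"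
      using eventually_ge_at_top[of "max T T'"] by (auto elim: eventually_mono)
  qed
  ultimately show thesis using that[of L W] W U(3) \<open>U = W\<close> by blast
qed

end

section \<open>Normalisation of the Cauchy problem and return to the original unknowns\<close>

theorem theorem1p3:
  fixes D :: "real ^ 'm ^ 'm"
    and F H :: "'m \<Rightarrow> real ^ 'n \<Rightarrow> real ^ 'n \<Rightarrow> real"
    and f u0 :: "'m \<Rightarrow> real ^ 'n \<Rightarrow> real"
    and u :: "real ^ 'n \<Rightarrow> real \<Rightarrow> real ^ 'm"
  assumes "monotone_matrix D"
    and "irreducible_matrix D"
    and "\<exists>i. \<forall>j. D $ i $ j \<noteq> 0"
    and "\<And>i. torus_fun (u0 i)" and "\<And>i. continuous_on UNIV (u0 i)"
    and "\<And>i. torus_fun (F i)" and "\<And>i. continuous_on UNIV (\<lambda>(x, p). F i x p)"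
    and "\<And>i. torus_fun (f i)" and "\<And>i. continuous_on UNIV (f i)"
    and "\<And>i x p. H i x p = F i x p - f i x"
    and "\<And>i x. convex_on UNIV (F i x)"
    and "\<And>i. uniformly_coercive (F i)"
    and "\<And>i x p. F i x p \<ge> F i x 0" and "\<And>i x. F i x 0 = 0"
    and "common_minimizers f \<noteq> {}"
    and "cauchy_solution H D u0 u"
  shows "\<exists>(c1 :: real) (c :: real ^ 'm) (u_inf :: real ^ 'n \<Rightarrow> real ^ 'm).
           c = (\<chi> i. c1) \<and>
           (\<forall>i. \<exists>L. L-lipschitz_on UNIV (\<lambda>x. u_inf x $ i)) \<and>
           stationary_solution H D c1 u_inf \<and>
           uniform_limit UNIV (\<lambda>t x. u x t + t *\<^sub>R c) u_inf at_top"
proof -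
  note mono = assms(1) and irr = assms(2) and F_torus = assms(6) and F_cont = assms(7)
    and f_torus = assms(8) and f_cont = assms(9) and H = assms(10) and F_convex = assms(11)
    and F_coercive = assms(12) and F_ge = assms(13) and F_0 = assms(14)
  obtain x\<^sub>0 where x0: "\<And>i x. f i x\<^sub>0 \<le> f i x"
    using assms(15) by (auto simp: common_minimizers_def)
  obtain a c where a: "D *v a = (\<chi> i. f i x\<^sub>0) + (\<chi> i. c)"
    using monotone_irreducible_solvable[OF mono irr] by blast
  then have Da: "(\<Sum>j\<in>UNIV. D $ i $ j * a $ j) = f i x\<^sub>0 + c" for i
    by (simp add: vec_eq_iff matrix_vector_mult_def)
  have D1: "(\<Sum>j\<in>UNIV. D $ i $ j) = 0" for i
    using mono by (simp add: monotone_matrix_def)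
  define H' where "H' i x p = F i x p - (f i x - f i x\<^sub>0)" for i x p
  define w where "w x t = u x t + (\<chi> i. c * t) - a" for x t
  \<comment> \<open>Zero row sums make the coupling blind to the drift \<open>c * t\<close>; the
    constant left over by \<open>a\<close> cancels both the minimum of \<open>f i\<close> and the
    time derivative \<open>c\<close> of the drift.\<close>
  have Dw: "(\<Sum>j\<in>UNIV. D $ i $ j * w x t $ j) = (\<Sum>j\<in>UNIV. D $ i $ j * u x t $ j) - f i x\<^sub>0 - c" for i x t
  proof -
    have "(\<Sum>j\<in>UNIV. D $ i $ j * w x t $ j)
      = (\<Sum>j\<in>UNIV. D $ i $ j * u x t $ j) + (\<Sum>j\<in>UNIV. D $ i $ j) * (c * t) - (\<Sum>j\<in>UNIV. D $ i $ j * a $ j)"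
      unfolding sum_distrib_right sum.distrib[symmetric] sum_subtractf[symmetric]
      by (simp add: w_def algebra_simps)
    then show ?thesis by (simp add: Da D1)
  qed
  interpret normalized_system H' D
  proof
    show "torus_fun (H' i)" for i
      using F_torus f_torus by (simp add: H'_def[abs_def] torus_fun_def)
    have "continuous_on UNIV (\<lambda>z. (\<lambda>(x, p). F i x p) z - (f i (fst z) - f i x\<^sub>0))" for i
      by (intro continuous_on_diff F_cont continuous_on_const
          continuous_on_compose2[OF f_cont continuous_on_fst[OF continuous_on_id]]) auto
    then show "continuous_on UNIV (\<lambda>(x, p). H' i x p)" for i
      by (simp add: H'_def case_prod_unfold)
    show "convex_on UNIV (H' i x)" for i x
      using convex_on_add[OF F_convex[of i x] convex_on_const[of UNIV "f i x\<^sub>0 - f i x", THEN iffD2, OF convex_UNIV]]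
      by (simp add: H'_def[abs_def] algebra_simps)
    show "uniformly_coercive (H' i)" for i
      unfolding uniformly_coercive_def
    proof
      fix M
      obtain B where B: "\<And>x. norm (f i x) \<le> B"
        by (rule torus_continuous_bounded[OF f_torus f_cont]) (rule that)
      obtain R where R: "\<And>x p. norm p \<ge> R \<Longrightarrow> F i x p \<ge> M + 2 * B"
        using F_coercive[of i] unfolding uniformly_coercive_def by blast
      have "H' i x p \<ge> M" if "norm p \<ge> R" for x p
        using R[OF that, of x] B[of x] B[of x\<^sub>0] by (simp add: H'_def abs_le_iff)
      then show "\<exists>R. \<forall>x p. norm p \<ge> R \<longrightarrow> H' i x p \<ge> M" by blast
    qed
    show "H' i x p \<ge> H' i x 0" for i x p using F_ge by (simp add: H'_def)
    show "H' i x 0 \<le> 0" for i x using x0 by (simp add: H'_def F_0)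
    show "\<exists>x. \<forall>i. H' i x 0 = 0" by (intro exI[of _ x\<^sub>0]) (simp add: H'_def F_0)
  qed (fact mono irr)+
  have u: "\<And>t. t \<ge> 0 \<Longrightarrow> torus_fun (\<lambda>x. u x t)" "continuous_on (UNIV \<times> {0..}) (\<lambda>(x, t). u x t)"
    "viscosity_solution (UNIV \<times> {0<..})
       (\<lambda>i (x, t) r (p, a). a + H i x p + (\<Sum>j\<in>UNIV. D $ i $ j * r $ j)) (\<lambda>(x, t). u x t)"
    using assms(16) by (auto simp: cauchy_solution_def)
  have C1: "C1_with_gradient (UNIV \<times> {0<..}) (\<lambda>(x :: real ^ 'n, t). 0 + c * t) (\<lambda>(x, t). (0, c))"
    by (rule C1_with_gradient_Times[OF C1_with_gradient_const]) (auto intro!: derivative_eq_intros)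
  have op: "open ((UNIV :: (real ^ 'n) set) \<times> {0::real<..})" by (intro open_Times) auto
  interpret evolution H' D w
  proof
    show "torus_fun (\<lambda>x. w x t)" if "t \<ge> 0" for t
      using u(1)[OF that] by (simp add: w_def torus_fun_def)
    have "continuous_on (UNIV \<times> {0..}) (\<lambda>z. (\<lambda>(x, t). u x t) z + (\<chi> i. c * snd z) - a)"
      by (intro continuous_intros u(2) continuous_on_vec_lambda)
    then show "continuous_on (UNIV \<times> {0..}) (\<lambda>(x, t). w x t)"
      by (simp add: w_def case_prod_unfold)
    show "evolution_subsolution H' D w"
      unfolding evolution_subsolution_def
      by (rule viscosity_subsolution_shift[OF _ C1 _ _ op, where a = "- a" and u = "\<lambda>(x, t). u x t"])
        (use u(3) in \<open>(auto simp: viscosity_solution_def Dw H H'_def)[]\<close>, simp_all add: split_beta Dw H H'_def, simp add: w_def)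
    show "evolution_supersolution H' D w"
      unfolding evolution_supersolution_def
      by (rule viscosity_supersolution_shift[OF _ C1 _ _ op, where a = "- a" and u = "\<lambda>(x, t). u x t"])
        (use u(3) in \<open>(auto simp: viscosity_solution_def Dw H H'_def)[]\<close>, simp_all add: split_beta Dw H H'_def, simp add: w_def)
  qed
  obtain W L where W: "\<And>i. L-lipschitz_on UNIV (\<lambda>x. W x $ i)" "torus_fun W" "continuous_on UNIV W"
    "stationary_subsolution H' D W" "stationary_supersolution H' D W" "uniform_limit UNIV (\<lambda>t x. w x t) W at_top"
    by (rule uniform_convergence) (rule that)
  \<comment> \<open>Adding \<open>a\<close> back restores the minima of \<open>f i\<close> and
    produces the constant \<open>c\<close> on the right-hand side.\<close>
  define v where "v x = W x + a" for x
  have Dv: "(\<Sum>j\<in>UNIV. D $ i $ j * v x $ j) = (\<Sum>j\<in>UNIV. D $ i $ j * W x $ j) + f i x\<^sub>0 + c" for i x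
    by (simp add: v_def distrib_left sum.distrib Da)
  have "L-lipschitz_on UNIV (\<lambda>x. v x $ i)" for i
    using W(1)[of i] by (simp add: v_def lipschitz_on_def dist_real_def)
  moreover have "stationary_solution H D c v"
    unfolding stationary_solution_def viscosity_solution_def
  proof (intro conjI)
    show "torus_fun v" using W(2) by (simp add: v_def torus_fun_def)
    show "continuous_on UNIV v" unfolding v_def by (intro continuous_intros W(3))
    show "viscosity_subsolution UNIV (\<lambda>i x r p. H i x p + (\<Sum>j\<in>UNIV. D $ i $ j * r $ j) - c) v"
      by (rule viscosity_subsolution_shift[OF W(4)[unfolded stationary_subsolution_def]
            C1_with_gradient_const[of _ 0] _ _ open_UNIV, where a = a])
        (auto simp: v_def[symmetric] Dv H H'_def, simp add: v_def)
    show "viscosity_supersolution UNIV (\<lambda>i x r p. H i x p + (\<Sum>j\<in>UNIV. D $ i $ j * r $ j) - c) v"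
      by (rule viscosity_supersolution_shift[OF W(5)[unfolded stationary_supersolution_def]
            C1_with_gradient_const[of _ 0] _ _ open_UNIV, where a = a])
        (auto simp: v_def[symmetric] Dv H H'_def, simp add: v_def)
  qed
  moreover have "uniform_limit UNIV (\<lambda>t x. u x t + t *\<^sub>R (\<chi> i. c)) v at_top"
  proof -
    have "u x t + t *\<^sub>R (\<chi> i. c) = w x t + a" for x t
      by (simp add: w_def vec_eq_iff)
    then show ?thesis
      using W(6) by (simp add: v_def uniform_limit_iff)
  qed
  ultimately show ?thesis by blast
qed

end
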